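(* Let $G$ be a compact (Hausdorff) topological group. Then every BN-pair $(B,N)$ for $G$ is spherical, i.e. its Weyl group $W=N/(B\cap N)$ is finite. Here $B$ and $N$ are arbitrary abstract subgroups satisfying the BN-pair axioms; they are not assumed to be closed in $G$.
   Context: A BN-pair for a group $G$ is a pair of subgroups $B,N$ generating $G$ such that $T:=B\cap N$ is normal in $N$ and $W:=N/T$ is generated by a finite set $S$ of involutions satisfying the usual axioms ($sBw\subseteq BwB\cup BswB$ and $sBs\neq B$ for $s\in S$, $w\in W$). All BN-pairs are assumed to have finite rank ($S$ finite). The BN-pair is called spherical if $W$ is finite. *)

theory Defs
  imports "HOL-Analysis.Analysis"
begin

text \<open>Groups are written additively: the type class topological_group_add
  is a (not necessarily commutative) group with continuous operations.\<close>

definition cplx :: "'a::plus set \<Rightarrow> 'a set \<Rightarrow> 'a set" where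
  "cplx A C = {a + c | a c. a \<in> A \<and> c \<in> C}"

definition subgrp :: "'a::group_add set \<Rightarrow> bool" where
  "subgrp H \<longleftrightarrow> 0 \<in> H \<and> (\<forall>x\<in>H. \<forall>y\<in>H. x + y \<in> H) \<and> (\<forall>x\<in>H. - x \<in> H)"

definition gen_subgrp :: "'a::group_add set \<Rightarrow> 'a set" where
  "gen_subgrp A = \<Inter>{H. subgrp H \<and> A \<subseteq> H}"

definition normal_in :: "'a::group_add set \<Rightarrow> 'a set \<Rightarrow> bool" where
  "normal_in T N \<longleftrightarrow> subgrp T \<and> T \<subseteq> N \<and> (\<forall>n\<in>N. \<forall>t\<in>T. n + t - n \<in> T)"

text \<open>Weyl group W = N/T, T = B \<inter> N, as the set of cosets n + T; the product of
  cosets is the complex product, the identity is T itself.\<close>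

definition weyl :: "'a::group_add set \<Rightarrow> 'a set \<Rightarrow> 'a set set" where
  "weyl B N = {cplx {n} (B \<inter> N) | n. n \<in> N}"

inductive_set wgen :: "'a::group_add set \<Rightarrow> 'a set set \<Rightarrow> 'a set set" for T S where
  one: "T \<in> wgen T S"
| step: "w \<in> wgen T S \<Longrightarrow> s \<in> S \<Longrightarrow> cplx s w \<in> wgen T S"

definition BN_pair :: "'a::group_add set \<Rightarrow> 'a set \<Rightarrow> 'a set set \<Rightarrow> bool" where
  "BN_pair B N S \<longleftrightarrow>
     subgrp B \<and> subgrp N \<and> gen_subgrp (B \<union> N) = UNIV \<and>
     normal_in (B \<inter> N) N \<and>
     finite S \<and> S \<subseteq> weyl B N \<and>
     (\<forall>s\<in>S. s \<noteq> B \<inter> N \<and> cplx s s = B \<inter> N) \<and>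
     wgen (B \<inter> N) S = weyl B N \<and>
     (\<forall>s\<in>S. \<forall>w\<in>weyl B N.
        cplx (cplx s B) w \<subseteq> cplx (cplx B w) B \<union> cplx (cplx B (cplx s w)) B) \<and>
     (\<forall>s\<in>S. cplx (cplx s B) s \<noteq> B)"

end

theory Submission
  imports Defs
begin

text \<open>Suppose \<open>W\<close> is infinite. The geometric representation shows that some two reflections of \<open>W\<close>
  have a product \<open>c\<close> of infinite order: otherwise every pair consisting of a simple root and a root lies,
  up to conjugation, in a finite standard parabolic subgroup, and there would be only finitely many
  roots. Counting the walls that separate the two ends of \<open>c\<^sup>j\<close>, with sign, gives a homomorphism \<open>D\<close> from
  the group of all \<open>y \<in> W\<close> commuting with a power of \<open>c\<close> to the integers, with \<open>D c \<noteq> 0\<close>.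

  Let \<open>n \<in> N\<close> be a lift of \<open>c\<close>, and let \<open>r : G \<rightarrow> W\<close> be the retraction of the building centered at an end of
  the orbit of \<open>n\<close>. If \<open>h\<close> centralizes \<open>n\<close>, then \<open>r (h x)\<close> and \<open>r x\<close> differ by an element \<open>y\<close> commuting with a
  power of \<open>c\<close>; passing to an adjacent chamber changes \<open>y\<close> at most by an involution, so \<open>D y\<close>
  depends on \<open>h\<close> only. Hence the centralizer of \<open>n\<close> in \<open>G\<close> has a homomorphism to the integers that is
  nonzero at \<open>n\<close>. In a compact group this is impossible: \<open>n\<close> is the product of an element with
  \<open>2\<^sup>k\<close>-th roots and an element with \<open>3\<^sup>k\<close>-th roots for all \<open>k\<close>, all inside its centralizer.\<close>

section \<open>Words and reduced words\<close>

text \<open>The topology gives no hold on \<open>B\<close>, which need not be closed. It enters only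
  through centralizers, which are closed in a Hausdorff group, and through continuity of the power
  maps. So the obstruction has to live on the centralizer of a single element. \<open>W\<close>
  itself offers no homomorphism to the integers, being generated by involutions. This is why
  elements commuting with a power of \<open>c\<close> appear: they permute the walls that separate
  the two ends, and this makes the signed count additive on them. The retraction is centered at an
  end because \<open>h\<close> commutes with the powers of \<open>n\<close> leading there: the
  conjugates of \<open>y\<close> by c^j then lie in a finite set for infinitely many
  \<open>j\<close>, and two equal conjugates make \<open>y\<close> commute with a power of
  \<open>c\<close>. The end is reached as a cluster point of retractions centered at chambers, since
  the group may be uncountable. The numbers 2 and 3 matter only as coprime numbers above 1: Bezout
  splits \<open>n\<close>, and an integer divisible by every power of such a number is zero.\<close>

lemma sum_list_rev_involutions:
  fixes ws :: "'a::group_add list"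
  assumes "\<forall>s\<in>set ws. s + s = 0"
  shows "sum_list (rev ws) = - sum_list ws"
  using assms by (induction ws) (auto simp: minus_add simp flip: eq_neg_iff_add_eq_0)

definition word_group :: "'a::group_add set \<Rightarrow> 'a set" where
  "word_group S = sum_list ` lists S"

definition word_len :: "'a::group_add set \<Rightarrow> 'a \<Rightarrow> nat" where
  "word_len S w = (LEAST n. \<exists>ws\<in>lists S. length ws = n \<and> sum_list ws = w)"

definition reduced_word :: "'a::group_add set \<Rightarrow> 'a list \<Rightarrow> bool" where
  "reduced_word S ws \<longleftrightarrow> ws \<in> lists S \<and> word_len S (sum_list ws) = length ws"

lemma word_len_le: "ws \<in> lists S \<Longrightarrow> word_len S (sum_list ws) \<le> length ws"
  unfolding word_len_def by (rule Least_le) auto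

lemma word_len_exists:
  assumes "w \<in> word_group S"
  shows "\<exists>ws. reduced_word S ws \<and> sum_list ws = w"
proof -
  have "\<exists>n. \<exists>ws\<in>lists S. length ws = n \<and> sum_list ws = w"
    using assms unfolding word_group_def by auto
  from LeastI_ex[OF this] show ?thesis
    unfolding word_len_def[symmetric] reduced_word_def by metis
qed

lemma word_group_sum_list: "ws \<in> lists S \<Longrightarrow> sum_list ws \<in> word_group S"
  by (auto simp: word_group_def)

lemma word_group_zero [simp]: "0 \<in> word_group S"
  using word_group_sum_list[of "[]" S] by simp

lemma word_group_gen: "s \<in> S \<Longrightarrow> s \<in> word_group S"
  using word_group_sum_list[of "[s]" S] by simp

lemma word_group_add: "v \<in> word_group S \<Longrightarrow> w \<in> word_group S \<Longrightarrow> v + w \<in> word_group S"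
  unfolding word_group_def by (force simp flip: sum_list_append)

lemma word_group_mono: "J \<subseteq> S \<Longrightarrow> word_group J \<subseteq> word_group S"
  unfolding word_group_def using lists_mono by blast

text \<open>Coxeter systems enter through the exchange condition because that is what a BN-pair
  yields directly. The group is only a subset of the type, so that standard parabolic subgroups
  satisfy the same locale on the same type.\<close>

locale coxeter_group =
  fixes S :: "'a::group_add set"
  assumes fin: "finite S"
    and zero_notin: "0 \<notin> S"
    and invol: "s \<in> S \<Longrightarrow> s + s = 0"
    and exchange: "s \<in> S \<Longrightarrow> reduced_word S ws \<Longrightarrow> word_len S (s + sum_list ws) \<le> length ws \<Longrightarrow>
      \<exists>i<length ws. s + sum_list ws = sum_list (take i ws @ drop (Suc i) ws)"
begin

abbreviation W where "W \<equiv> word_group S"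
abbreviation len where "len \<equiv> word_len S"

lemma uminus_gen: "s \<in> S \<Longrightarrow> - s = s"
  using invol minus_unique by blast

lemma invol_add [simp]: "s \<in> S \<Longrightarrow> s + (s + w) = w"
  using invol by (simp flip: add.assoc)

lemma sum_list_rev: "ws \<in> lists S \<Longrightarrow> sum_list (rev ws) = - sum_list ws"
  by (rule sum_list_rev_involutions) (auto simp: invol)

lemma W_uminus: "w \<in> W \<Longrightarrow> - w \<in> W"
  unfolding word_group_def
  by (smt (verit, best) image_iff in_lists_conv_set set_rev sum_list_rev)

lemma W_step: "s \<in> S \<Longrightarrow> w \<in> W \<Longrightarrow> s + w \<in> W"
  by (simp add: word_group_add word_group_gen)

lemma len_uminus:
  assumes "w \<in> W" shows "len (- w) = len w"
proof -
  have le: "len (- w) \<le> len w" if "w \<in> W" for w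
  proof -
    obtain ws where "reduced_word S ws" "sum_list ws = w" using word_len_exists \<open>w \<in> W\<close> by blast
    moreover from this have "rev ws \<in> lists S" by (auto simp: reduced_word_def)
    ultimately show ?thesis using word_len_le[of "rev ws" S] sum_list_rev[of ws] by (auto simp: reduced_word_def)
  qed
  show ?thesis using le[OF assms] le[OF W_uminus[OF assms]] by simp
qed

lemma len_step_le:
  assumes "s \<in> S" "w \<in> W" shows "len (s + w) \<le> Suc (len w)"
proof -
  obtain ws where "reduced_word S ws" "sum_list ws = w" using word_len_exists assms by blast
  then show ?thesis using word_len_le[of "s # ws" S] assms by (auto simp: reduced_word_def)
qed

text \<open>If the length does not grow, exchange deletes a letter, so it drops; it cannot stay
  equal.\<close>

lemma len_step:
  assumes "s \<in> S" "w \<in> W"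
  shows "len (s + w) = Suc (len w) \<or> Suc (len (s + w)) = len w"
proof (cases "len (s + w) \<le> len w")
  case True
  obtain ws where ws: "reduced_word S ws" "sum_list ws = w" using word_len_exists assms by blast
  then obtain i where i: "i < length ws" "s + w = sum_list (take i ws @ drop (Suc i) ws)"
    using exchange[of s ws] True assms by (auto simp: reduced_word_def)
  have "take i ws @ drop (Suc i) ws \<in> lists S"
    using ws by (auto simp: reduced_word_def dest!: in_set_takeD in_set_dropD)
  from word_len_le[OF this] have "len (s + w) \<le> len w - 1" "0 < len w"
    using i ws unfolding i(2) by (auto simp: reduced_word_def)
  moreover have "len w \<le> Suc (len (s + w))" using len_step_le[of s "s + w"] assms W_step by simp
  ultimately show ?thesis by linarith
next
  case False
  then show ?thesis using len_step_le[OF assms] by simp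
qed

lemma len_zero [simp]: "len 0 = 0"
  using word_len_le[of "[]" S] by simp

lemma reduced_appendD:
  assumes "reduced_word S (xs @ ys)"
  shows "reduced_word S xs" "reduced_word S ys"
proof -
  have l: "xs \<in> lists S" "ys \<in> lists S" using assms by (auto simp: reduced_word_def)
  obtain xs' where xs': "reduced_word S xs'" "sum_list xs' = sum_list xs"
    using word_len_exists word_group_sum_list l by blast
  obtain ys' where ys': "reduced_word S ys'" "sum_list ys' = sum_list ys"
    using word_len_exists word_group_sum_list l by blast
  have "length (xs @ ys) \<le> length (xs' @ ys')"
    using word_len_le[of "xs' @ ys'" S] assms xs' ys' by (auto simp: reduced_word_def)
  then show "reduced_word S xs" "reduced_word S ys"
    using xs' ys' l word_len_le[OF l(1)] word_len_le[OF l(2)] by (auto simp: reduced_word_def)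
qed

lemma reduced_Cons:
  "s \<in> S \<Longrightarrow> reduced_word S ws \<Longrightarrow> len (s + sum_list ws) = Suc (len (sum_list ws)) \<Longrightarrow> reduced_word S (s # ws)"
  by (auto simp: reduced_word_def)

lemma reduced_ConsD: "reduced_word S (s # ws) \<Longrightarrow> s \<in> S \<and> reduced_word S ws"
  using reduced_appendD[of "[s]" ws] by (auto simp: reduced_word_def)

text \<open>The deletion property. Keeping the letters inside \<open>set ws\<close> is what makes
  lengths in parabolic subgroups agree with lengths in \<open>W\<close>.\<close>

lemma reduced_subword:
  "ws \<in> lists S \<Longrightarrow> \<exists>us. reduced_word S us \<and> set us \<subseteq> set ws \<and> sum_list us = sum_list ws"
proof (induction ws)
  case Nil
  have "reduced_word S []" by (simp add: reduced_word_def)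
  then show ?case by (intro exI[of _ "[]"]) auto
next
  case (Cons s ws)
  then obtain us where us: "reduced_word S us" "set us \<subseteq> set ws" "sum_list us = sum_list ws" by auto
  have s: "s \<in> S" using Cons by auto
  have W: "sum_list us \<in> W" using us word_group_sum_list by (metis reduced_word_def)
  consider "len (s + sum_list us) = Suc (len (sum_list us))" | "Suc (len (s + sum_list us)) = len (sum_list us)"
    using len_step[OF s W] by blast
  then show ?case
  proof cases
    case 1
    then show ?thesis using us s reduced_Cons by (intro exI[of _ "s # us"]) auto
  next
    case 2
    then obtain i where i: "i < length us" "s + sum_list us = sum_list (take i us @ drop (Suc i) us)"
      using exchange[of s us] us s by (auto simp: reduced_word_def)
    let ?v = "take i us @ drop (Suc i) us"
    have v: "set ?v \<subseteq> set us" by (auto dest!: in_set_takeD in_set_dropD)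
    have "reduced_word S ?v" unfolding reduced_word_def i(2)[symmetric]
      using v us i 2 by (auto simp: reduced_word_def)
    then show ?thesis using v us i by (intro exI[of _ ?v]) auto
  qed
qed

lemma parabolic:
  assumes "J \<subseteq> S"
  shows "coxeter_group J" "\<And>w. w \<in> word_group J \<Longrightarrow> word_len J w = len w"
proof -
  have eq: "word_len J w = len w" if w: "w \<in> word_group J" for w
  proof (rule antisym)
    obtain ws where ws: "ws \<in> lists J" "sum_list ws = w" using w by (auto simp: word_group_def)
    obtain us where us: "reduced_word S us" "set us \<subseteq> set ws" "sum_list us = w"
      using reduced_subword[of ws] ws assms by auto
    have "us \<in> lists J" using us ws by auto
    from word_len_le[OF this] show "word_len J w \<le> len w" using us by (auto simp: reduced_word_def)
    obtain vs where "reduced_word J vs" "sum_list vs = w" using w word_len_exists by blast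
    moreover from this have "vs \<in> lists S" using assms by (auto simp: reduced_word_def)
    ultimately show "len w \<le> word_len J w" using word_len_le[of vs S] by (auto simp: reduced_word_def)
  qed
  then show "\<And>w. w \<in> word_group J \<Longrightarrow> word_len J w = len w" .
  show "coxeter_group J"
  proof
    fix s ws assume s: "s \<in> J" and ws: "reduced_word J ws" "word_len J (s + sum_list ws) \<le> length ws"
    have W: "sum_list ws \<in> word_group J" "s + sum_list ws \<in> word_group J"
      using ws s by (auto simp: reduced_word_def intro: word_group_sum_list word_group_add word_group_gen)
    have "reduced_word S ws" "s \<in> S" using ws eq[OF W(1)] assms s by (auto simp: reduced_word_def)
    then show "\<exists>i<length ws. s + sum_list ws = sum_list (take i ws @ drop (Suc i) ws)"
      using exchange ws(2) eq[OF W(2)] by simp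
  qed (use assms fin zero_notin invol finite_subset in auto)
qed

text \<open>\<open>v\<close> is an element of minimal length in the coset of \<open>w\<close> modulo
  the subgroup generated by \<open>J\<close>. Lengths add up because exchange can delete a letter
  neither from the reduced \<open>J\<close>-part nor from \<open>v\<close>.\<close>

lemma coset_decomp:
  assumes J: "J \<subseteq> S" and w: "w \<in> W"
  shows "\<exists>a v. a \<in> lists J \<and> reduced_word S a \<and> v \<in> W \<and> w = sum_list a + v \<and>
    (\<forall>a'\<in>lists J. reduced_word S a' \<longrightarrow> len (sum_list a' + v) = length a' + len v)"
proof -
  let ?C = "{sum_list a + w | a. a \<in> lists J}"
  have CW: "?C \<subseteq> W" using w J by (auto intro!: word_group_add word_group_sum_list)
  have "w \<in> ?C" by (auto intro!: exI[of _ "[]"])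
  then obtain v where v: "v \<in> ?C" and min: "\<And>x. x \<in> ?C \<Longrightarrow> len v \<le> len x"
    using ex_has_least_nat[of "\<lambda>x. x \<in> ?C" w len] by blast
  have vW: "v \<in> W" using v CW by blast
  have add: "sum_list a + x \<in> ?C" if "a \<in> lists J" "x \<in> ?C" for a x
  proof -
    obtain b where "b \<in> lists J" "x = sum_list b + w" using \<open>x \<in> ?C\<close> by blast
    then show ?thesis using that(1) by (auto intro!: exI[of _ "a @ b"] simp: add.assoc)
  qed
  have key: "len (sum_list a + v) = length a + len v" if "a \<in> lists J" "reduced_word S a" for a
    using that
  proof (induction a rule: list.induct)
    case Nil then show ?case by simp
  next
    case (Cons r a)
    have r: "r \<in> S" "r \<in> J" "a \<in> lists J" "reduced_word S a"
      using Cons.prems reduced_ConsD[of r a] by simp_all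
    then have IH: "len (sum_list a + v) = length a + len v" using Cons.IH by blast
    obtain vs where vs: "reduced_word S vs" "sum_list vs = v" using vW word_len_exists by blast
    have red: "reduced_word S (a @ vs)" using IH vs r by (auto simp: reduced_word_def)
    have aW: "sum_list a + v \<in> W" using r vW J by (auto intro!: word_group_add word_group_sum_list)
    show ?case
    proof (rule ccontr)
      assume "\<not> ?thesis"
      then have "len (r + sum_list (a @ vs)) \<le> length (a @ vs)"
        using len_step[OF r(1) aW] IH vs by (auto simp: add.assoc reduced_word_def)
      then obtain i where i: "i < length (a @ vs)"
        "r + sum_list (a @ vs) = sum_list (take i (a @ vs) @ drop (Suc i) (a @ vs))"
        using exchange[OF r(1) red] by blast
      show False
      proof (cases "i < length a")
        case True
        then have "r + sum_list a + v = sum_list (take i a @ drop (Suc i) a) + v"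
          using i(2) vs by (simp add: add.assoc)
        then have "sum_list (r # a) = sum_list (take i a @ drop (Suc i) a)" by simp
        moreover have "len (sum_list (take i a @ drop (Suc i) a)) \<le> length (take i a @ drop (Suc i) a)"
          by (rule word_len_le) (use r J in \<open>auto dest!: in_set_takeD in_set_dropD\<close>)
        ultimately have "len (sum_list (r # a)) \<le> length a" using True by simp
        then show False using Cons.prems(2) by (simp add: reduced_word_def)
      next
        case False
        \<comment> \<open>The deleted letter belongs to \<open>v\<close>: the shortened word still
          represents an element of the coset, against minimality.\<close>
        define k where "k = i - length a"
        have k: "k < length vs" "i = length a + k" using False i(1) by (auto simp: k_def)
        let ?v' = "take k vs @ drop (Suc k) vs"
        have "r + sum_list a + v = sum_list a + sum_list ?v'"
          using i(2) vs k by (simp add: add.assoc)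
        then have "sum_list ?v' = sum_list (rev a) + (sum_list (r # a) + v)"
          using sum_list_rev[of a] r by (auto simp: add.assoc reduced_word_def)
        moreover have "\<dots> \<in> ?C" by (rule add[OF _ add[OF _ v]]) (use r in auto)
        ultimately have "sum_list ?v' \<in> ?C" by (simp only:)
        then have "len v \<le> len (sum_list ?v')" by (rule min)
        also have "\<dots> \<le> length ?v'"
          by (rule word_len_le) (use vs in \<open>auto simp: reduced_word_def dest!: in_set_takeD in_set_dropD\<close>)
        finally show False using vs k by (auto simp: reduced_word_def)
      qed
    qed
  qed
  obtain b where b: "b \<in> lists J" "v = sum_list b + w" using v by blast
  have "rev b \<in> lists S" using b J by auto
  then obtain a where a: "reduced_word S a" "set a \<subseteq> set (rev b)" "sum_list a = sum_list (rev b)"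
    using reduced_subword by blast
  have "b \<in> lists S" using b J by auto
  then have "w = sum_list a + v" using a b sum_list_rev[of b] by (simp add: add.assoc[symmetric])
  moreover have "a \<in> lists J" using a b by auto
  ultimately show ?thesis using a vW key by blast
qed

end

section \<open>Alternating words and Matsumoto's theorem\<close>

fun alternating :: "nat \<Rightarrow> 'a \<Rightarrow> 'a \<Rightarrow> 'a list" where
  "alternating 0 s t = []"
| "alternating (Suc k) s t = s # alternating k t s"

lemma length_alternating [simp]: "length (alternating k s t) = k"
  by (induction k s t rule: alternating.induct) auto

lemma alternating_in_lists: "s \<in> S \<Longrightarrow> t \<in> S \<Longrightarrow> alternating k s t \<in> lists S"
  by (induction k s t rule: alternating.induct) auto

lemma alternating_snoc:
  "alternating (Suc k) s t = alternating k s t @ [if even k then s else t]"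
  by (induction k arbitrary: s t) auto

lemma alternating_add:
  "alternating (j + k) s t = alternating j s t @ (if even j then alternating k s t else alternating k t s)"
  by (induction j arbitrary: s t) auto

context coxeter_group
begin

lemma reduced_alternating:
  assumes "a \<in> lists {s, t}" "reduced_word S a"
  shows "a = alternating (length a) s t \<or> a = alternating (length a) t s"
  using assms
proof (induction a rule: list.induct)
  case Nil then show ?case by simp
next
  case (Cons r a)
  have r: "r \<in> S" "reduced_word S a" "a \<in> lists {s, t}" "r \<in> {s,t}"
    using Cons.prems reduced_ConsD[of r a] by simp_all
  have IH: "a = alternating (length a) s t \<or> a = alternating (length a) t s" using Cons.IH r by blast
  have "a = [] \<or> hd a \<noteq> r"
  proof (rule ccontr)
    assume "\<not> ?thesis"
    then obtain b where b: "a = r # b" by (cases a) auto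
    have "len (sum_list b) \<le> length b" by (rule word_len_le) (use r b in \<open>auto simp: reduced_word_def\<close>)
    then show False using Cons.prems(2) r b by (auto simp: reduced_word_def)
  qed
  then show ?case using IH r(4) by (cases a) auto
qed

text \<open>If two reduced words of \<open>w\<close> begin with different letters \<open>s\<close>
  and \<open>t\<close>, both letters shorten \<open>w\<close>. Then the rank-two part of
  \<open>w\<close> can be written as an alternating word beginning with either letter, and the two
  given words are compared through these two forms.\<close>

lemma matsumoto:
  fixes f :: "'a \<Rightarrow> 'b \<Rightarrow> 'b"
  assumes braid: "\<And>s t m. \<lbrakk>s \<in> S; t \<in> S; s \<noteq> t; reduced_word S (alternating m s t); reduced_word S (alternating m t s);
      sum_list (alternating m s t) = sum_list (alternating m t s)\<rbrakk> \<Longrightarrow>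
      foldr f (alternating m s t) = foldr f (alternating m t s)"
  shows "reduced_word S ws \<Longrightarrow> reduced_word S ws' \<Longrightarrow> sum_list ws = sum_list ws' \<Longrightarrow> foldr f ws = foldr f ws'"
proof (induction "length ws" arbitrary: ws ws')
  case 0
  then show ?case by (auto simp: reduced_word_def)
next
  case (Suc n)
  have len: "length ws' = length ws" using Suc.prems by (simp add: reduced_word_def)
  obtain s x where ws: "ws = s # x" using Suc.hyps by (cases ws) auto
  obtain t y where ws': "ws' = t # y" using Suc.hyps len by (cases ws') auto
  have n: "length x = n" "length y = n" using Suc.hyps ws ws' len by auto
  have st: "s \<in> S" "t \<in> S" "reduced_word S x" "reduced_word S y"
    using Suc.prems reduced_ConsD ws ws' by auto
  define w where "w = sum_list ws"
  have w: "w \<in> W" using Suc.prems(1) word_group_sum_list by (auto simp: reduced_word_def w_def)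
  show ?case
  proof (cases "s = t")
    case True
    then show ?thesis using Suc.hyps(1)[of x y] n st Suc.prems ws ws' by auto
  next
    case False
    let ?J = "{s, t}"
    have J: "?J \<subseteq> S" using st by auto
    obtain a v where a: "a \<in> lists ?J" "reduced_word S a" "v \<in> W" "w = sum_list a + v"
      and add: "\<And>a'. a' \<in> lists ?J \<Longrightarrow> reduced_word S a' \<Longrightarrow> len (sum_list a' + v) = length a' + len v"
      using coset_decomp[OF J w] by blast
    obtain z where z: "reduced_word S z" "sum_list z = v" using a word_len_exists by blast
    define m where "m = length a"
    \<comment> \<open>Stripping \<open>r\<close> from \<open>w\<close> strips it from the rank-two
      part \<open>a\<close>, so \<open>a\<close> is the alternating word beginning with
      \<open>r\<close>; the induction hypothesis then rewrites the rest of the word.\<close>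
    have step: "reduced_word S (alternating m r r') \<and> sum_list (alternating m r r') = sum_list a \<and>
        foldr f (r # u) = foldr f (alternating m r r' @ z)"
      if r: "{r, r'} = ?J" and u: "reduced_word S (r # u)" "sum_list (r # u) = w" "length u = n" for r r' u
    proof -
      have rS: "r \<in> S" "reduced_word S u" using u reduced_ConsD by blast+

      obtain b where b: "reduced_word S b" "set b \<subseteq> set (r # a)" "sum_list b = sum_list (r # a)"
      proof -
        have "r # a \<in> lists S" using a(2) rS(1) by (simp add: reduced_word_def)
        from reduced_subword[OF this] that show thesis by blast
      qed
      have bJ: "b \<in> lists ?J" using b a r by auto
      have "length b + len v = len (r + w)" using add[OF bJ b(1)] b a by (simp add: add.assoc)
      also have "r + w = sum_list u" using u rS by (simp flip: u(2))
      also have "len \<dots> = n" using rS u by (simp add: reduced_word_def)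
      finally have 1: "length b + len v = n" .
      have 2: "length a + len v = Suc n" using add[OF a(1,2)] a(4) u by (simp add: reduced_word_def)
      have la: "length a = Suc (length b)" using 1 2 by simp
      have sb: "sum_list (r # b) = sum_list a" using b rS by simp
      have rb: "reduced_word S (r # b)" using sb la a b rS by (simp add: reduced_word_def)
      have "r # b \<in> lists {r, r'}" using bJ r by auto
      from reduced_alternating[OF this rb] have alt: "r # b = alternating m r r'"
        using la False r by (auto simp: m_def doubleton_eq_iff)
      have rz: "reduced_word S (b @ z)" "sum_list (b @ z) = sum_list u"
      proof -
        show e: "sum_list (b @ z) = sum_list u" using b z a(4) u(2) rS invol_add[of r] by (metis add.assoc sum_list.Cons sum_list_append)
        show "reduced_word S (b @ z)" using e u rS b z 1 by (auto simp: reduced_word_def)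
      qed
      have "foldr f u = foldr f (b @ z)"
        by (rule Suc.hyps(1)) (use rz u rS in auto)
      then show ?thesis using alt[symmetric] rb sb by auto
    qed
    have 1: "reduced_word S (alternating m s t) \<and> sum_list (alternating m s t) = sum_list a \<and>
        foldr f ws = foldr f (alternating m s t @ z)"
      using step[of s t x] Suc.prems ws n by (simp add: w_def)
    have 2: "reduced_word S (alternating m t s) \<and> sum_list (alternating m t s) = sum_list a \<and>
        foldr f ws' = foldr f (alternating m t s @ z)"
      using step[of t s y] Suc.prems ws' n by (simp add: w_def insert_commute)
    show ?thesis using braid[of s t m] st False 1 2 by (auto simp: fun_eq_iff)
  qed
qed

end

section \<open>The geometric representation\<close>

text \<open>The Chebyshev polynomial of the second kind, with index shifted by one:
  \<open>cheb c k\<close> is sin (k x) / sin x at c = cos x. It gives the coordinates of the roots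
  in rank two.\<close>

fun cheb :: "real \<Rightarrow> nat \<Rightarrow> real" where
  "cheb c 0 = 0"
| "cheb c (Suc 0) = 1"
| "cheb c (Suc (Suc k)) = 2 * c * cheb c (Suc k) - cheb c k"

lemma sin_cheb: "sin x * cheb (cos x) k = sin (real k * x)"
proof (induction "cos x" k rule: cheb.induct)
  case (3 k)
  have "real (Suc (Suc k)) * x = real (Suc k) * x + x" "real k * x = real (Suc k) * x - x"
    by (simp_all add: algebra_simps)
  then have "sin (real (Suc (Suc k)) * x) = 2 * cos x * sin (real (Suc k) * x) - sin (real k * x)"
    by (simp only: sin_add sin_diff) simp
  then show ?case using 3 by (simp add: right_diff_distrib mult.left_commute[of "sin x"])
qed auto

lemma cheb_1: "cheb 1 k = real k"
  by (induction "1::real" k rule: cheb.induct) auto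

definition lincomb :: "real \<Rightarrow> ('a \<Rightarrow> real) \<Rightarrow> real \<Rightarrow> ('a \<Rightarrow> real) \<Rightarrow> 'a \<Rightarrow> real" where
  "lincomb x u y v = (\<lambda>r. x * u r + y * v r)"

definition lin_map :: "(('a \<Rightarrow> real) \<Rightarrow> 'b \<Rightarrow> real) \<Rightarrow> bool" where
  "lin_map f \<longleftrightarrow> (\<forall>x u y v. f (lincomb x u y v) = lincomb x (f u) y (f v))"

lemma lin_mapD: "lin_map f \<Longrightarrow> f (lincomb x u y v) = lincomb x (f u) y (f v)"
  by (simp add: lin_map_def)

lemma lin_map_uminus: "lin_map f \<Longrightarrow> f (\<lambda>r. - u r) = (\<lambda>r. - f u r)"
  using lin_mapD[of f "-1" u 0 u] by (simp add: lincomb_def)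

definition simple_root :: "'a \<Rightarrow> 'a \<Rightarrow> real" where
  "simple_root s = (\<lambda>r. if r = s then 1 else 0)"

lemma simple_root_times: "simple_root s r * x = (if r = s then x else 0)"
  by (simp add: simple_root_def)

lemma rev_alternating:
  "rev (alternating k x y) = (if even k then alternating k y x else alternating k x y)"
proof (induction k arbitrary: x y)
  case (Suc k)
  have "rev (alternating (Suc k) x y) = rev (alternating k y x) @ [x]" by simp
  also have "\<dots> = (if even k then alternating k x y else alternating k y x) @ [x]" using Suc by simp
  finally show ?case
    using alternating_snoc[of k x y] alternating_snoc[of k y x] by (auto simp del: alternating.simps)
qed simp

context coxeter_group
begin

definition braid_rel :: "'a \<Rightarrow> 'a \<Rightarrow> nat \<Rightarrow> bool" where
  "braid_rel s t m \<longleftrightarrow> 0 < m \<and> sum_list (alternating m s t) = sum_list (alternating m t s)"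

text \<open>The Coxeter matrix, with the value 0 in place of infinity.\<close>

definition cox_mat :: "'a \<Rightarrow> 'a \<Rightarrow> nat" where
  "cox_mat s t = (if \<exists>m. braid_rel s t m then LEAST m. braid_rel s t m else 0)"

text \<open>The Gram matrix of the Tits form on the simple roots; -1 is the limit of - cos (pi / m)
  for growing m.\<close>

definition cosine :: "'a \<Rightarrow> 'a \<Rightarrow> real" where
  "cosine s t = (if s = t then 1 else if cox_mat s t = 0 then -1 else - cos (pi / cox_mat s t))"

definition pairing :: "'a \<Rightarrow> ('a \<Rightarrow> real) \<Rightarrow> real" where
  "pairing s v = (\<Sum>t\<in>S. v t * cosine t s)"

definition refl :: "'a \<Rightarrow> ('a \<Rightarrow> real) \<Rightarrow> ('a \<Rightarrow> real)" where
  "refl s v = lincomb 1 v (- 2 * pairing s v) (simple_root s)"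

definition form :: "('a \<Rightarrow> real) \<Rightarrow> ('a \<Rightarrow> real) \<Rightarrow> real" where
  "form u v = (\<Sum>s\<in>S. u s * pairing s v)"

lemma braid_rel_commute: "braid_rel s t m = braid_rel t s m"
  by (auto simp: braid_rel_def)

lemma cosine_commute: "cosine s t = cosine t s"
proof -
  have "braid_rel s t = braid_rel t s" using braid_rel_commute by blast
  then show ?thesis by (auto simp: cosine_def cox_mat_def)
qed

lemma cosine_self [simp]: "cosine s s = 1"
  by (simp add: cosine_def)

lemma pairing_lincomb: "pairing s (lincomb x u y v) = x * pairing s u + y * pairing s v"
  by (simp add: pairing_def lincomb_def sum_distrib_left sum.distrib algebra_simps)

lemma pairing_simple_root: "t \<in> S \<Longrightarrow> pairing s (simple_root t) = cosine t s"
  unfolding pairing_def using fin by (simp add: simple_root_times)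

lemma form_lincomb1: "form (lincomb x u y v) w = x * form u w + y * form v w"
  by (simp add: form_def lincomb_def sum_distrib_left sum.distrib algebra_simps)

lemma form_lincomb2: "form w (lincomb x u y v) = x * form w u + y * form w v"
  by (simp add: form_def pairing_lincomb sum_distrib_left sum.distrib algebra_simps)

lemma form_simple_root: "s \<in> S \<Longrightarrow> form (simple_root s) v = pairing s v"
  unfolding form_def using fin by (simp add: simple_root_times)

lemma form_commute: "form u v = form v u"
proof -
  have "form u v = (\<Sum>s\<in>S. \<Sum>t\<in>S. u s * v t * cosine t s)"
    by (simp add: form_def pairing_def sum_distrib_left mult.assoc)
  also have "\<dots> = (\<Sum>t\<in>S. \<Sum>s\<in>S. u s * v t * cosine t s)" by (rule sum.swap)
  also have "\<dots> = form v u"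
    by (subst cosine_commute) (simp add: form_def pairing_def sum_distrib_left mult_ac)
  finally show ?thesis .
qed

lemma refl_lin: "lin_map (refl s)"
  unfolding lin_map_def by (auto simp: refl_def pairing_lincomb) (simp add: lincomb_def fun_eq_iff algebra_simps)

lemma refl_refl: "s \<in> S \<Longrightarrow> refl s (refl s v) = v"
  by (simp add: refl_def pairing_lincomb pairing_simple_root) (simp add: lincomb_def)

lemma form_refl: "s \<in> S \<Longrightarrow> form (refl s u) (refl s v) = form u v"
  by (simp add: refl_def form_lincomb1 form_lincomb2 form_simple_root pairing_lincomb pairing_simple_root
      form_commute[of u "simple_root s"] algebra_simps)

lemma foldr_refl_lin: "lin_map (foldr refl ws)"
  by (induction ws) (auto simp: lin_map_def lin_mapD[OF refl_lin])

lemma cox_mat_ge2: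
  assumes "s \<in> S" "t \<in> S" "s \<noteq> t" "cox_mat s t \<noteq> 0"
  shows "cox_mat s t \<ge> 2" "braid_rel s t (cox_mat s t)"
proof -
  have ex: "\<exists>m. braid_rel s t m" using assms(4) by (auto simp: cox_mat_def split: if_splits)
  then show b: "braid_rel s t (cox_mat s t)"
    unfolding cox_mat_def using LeastI_ex by simp
  have "\<not> braid_rel s t 1" using assms(3) by (simp add: braid_rel_def)
  then have "cox_mat s t \<noteq> 1" using b by metis
  then show "cox_mat s t \<ge> 2" using assms(4) by linarith
qed

text \<open>One letter beyond the Coxeter number, the braid relation brings two equal letters
  together at the front, and they cancel.\<close>

lemma reduced_alternating_le:
  assumes st: "s \<in> S" "t \<in> S" "s \<noteq> t" and m: "cox_mat s t \<noteq> 0"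
    and red: "reduced_word S (alternating j s t)"
  shows "j \<le> cox_mat s t"
proof (rule ccontr)
  define m where "m = cox_mat s t"
  assume "\<not> ?thesis"
  then have "j = Suc m + (j - Suc m)" by (simp add: m_def)
  then have "reduced_word S (alternating (Suc m) s t)"
    using red reduced_appendD(1) alternating_add by metis
  then have l: "len (sum_list (alternating (Suc m) s t)) = Suc m" by (simp add: reduced_word_def)
  obtain k where k: "m = Suc k" using m by (auto simp: m_def gr0_conv_Suc)
  have "sum_list (alternating (Suc m) s t) = s + sum_list (alternating m s t)"
    using cox_mat_ge2(2)[OF st m] by (simp add: braid_rel_def m_def)
  also have "\<dots> = sum_list (alternating k t s)" using k st by simp
  finally have "sum_list (alternating (Suc m) s t) = sum_list (alternating k t s)" .
  moreover have "len (sum_list (alternating k t s)) \<le> k"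
    using word_len_le[OF alternating_in_lists[of t S s k]] st by simp
  ultimately show False using k l by (simp del: alternating.simps)
qed

text \<open>The images stay in the plane of the two simple roots, where a reflection acts on the
  coefficients by the recurrence of \<open>cheb\<close>.\<close>

lemma foldr_alternating:
  assumes "s \<in> S" "t \<in> S" "s \<noteq> t"
  shows "foldr refl (alternating k s t) (simple_root (if even k then s else t)) =
    lincomb (cheb (- cosine s t) (Suc k)) (simple_root s) (cheb (- cosine s t) k) (simple_root t)"
  using assms
proof (induction k arbitrary: s t)
  case 0
  then show ?case by (simp add: lincomb_def)
next
  case (Suc k)
  define c where "c = - cosine s t"
  have c: "- cosine t s = c" by (simp add: c_def cosine_commute)
  have "foldr refl (alternating (Suc k) s t) (simple_root (if even (Suc k) then s else t)) =
    refl s (foldr refl (alternating k t s) (simple_root (if even k then t else s)))" by simp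
  also have "\<dots> = refl s (lincomb (cheb c (Suc k)) (simple_root t) (cheb c k) (simple_root s))"
    using Suc.IH[of t s] Suc.prems c by simp
  also have "\<dots> = lincomb (cheb c (Suc (Suc k))) (simple_root s) (cheb c (Suc k)) (simple_root t)"
    using Suc.prems c
    by (simp add: refl_def pairing_lincomb pairing_simple_root) (simp add: lincomb_def fun_eq_iff algebra_simps c_def)
  finally show ?case by (simp add: c_def)
qed

text \<open>For a finite Coxeter number \<open>m\<close> the angle k pi / m stays in [0, pi], so its
  sine is nonnegative; in the infinite case the value is \<open>k\<close>.\<close>

lemma cheb_nonneg:
  assumes st: "s \<in> S" "t \<in> S" "s \<noteq> t" and k: "cox_mat s t = 0 \<or> k \<le> cox_mat s t"
  shows "cheb (- cosine s t) k \<ge> 0"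
proof (cases "cox_mat s t = 0")
  case True
  then show ?thesis using st by (simp add: cosine_def cheb_1)
next
  case False
  define m where "m = cox_mat s t"
  define x where "x = pi / m"
  have m: "m \<ge> 2" using cox_mat_ge2[OF st False] by (simp add: m_def)
  have x: "0 < x" "x < pi" using m by (auto simp: x_def field_simps)
  have "real k * x \<le> real m * x" using k False x by (intro mult_right_mono) (auto simp: m_def)
  also have "\<dots> = pi" using m by (simp add: x_def)
  finally have "sin (real k * x) \<ge> 0" using x by (intro sin_ge_zero) auto
  moreover have "sin x > 0" using x by (rule sin_gt_zero)
  moreover have "- cosine s t = cos x" using False st by (simp add: cosine_def x_def m_def)
  ultimately show ?thesis using sin_cheb[of x k] zero_le_mult_iff[of "sin x" "cheb (cos x) k"] by auto
qed

text \<open>Both products send each of the two simple roots to the same negative root and fix every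
  vector orthogonal to both. As the form is nondegenerate on their plane, these vectors determine
  the maps.\<close>

lemma refl_braid:
  assumes st: "s \<in> S" "t \<in> S" "s \<noteq> t"
    and red: "reduced_word S (alternating m s t)" "reduced_word S (alternating m t s)"
    and eq: "sum_list (alternating m s t) = sum_list (alternating m t s)"
  shows "foldr refl (alternating m s t) = foldr refl (alternating m t s)"
proof (cases m)
  case 0
  then show ?thesis by simp
next
  case (Suc k)
  have b: "braid_rel s t m" using eq Suc by (simp add: braid_rel_def)
  then have ex: "\<exists>m. braid_rel s t m" by blast
  have "braid_rel s t (LEAST m. braid_rel s t m)" using b by (rule LeastI)
  then have "(LEAST m. braid_rel s t m) > 0" unfolding braid_rel_def by blast
  then have m0: "cox_mat s t \<noteq> 0" using ex by (simp add: cox_mat_def)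
  \<comment> \<open>\<open>m\<close> is the Coxeter number: minimality gives one inequality,
    reducedness of the alternating word the other.\<close>
  have "cox_mat s t \<le> m" using ex b by (simp add: cox_mat_def Least_le)
  then have m: "cox_mat s t = m" using reduced_alternating_le[OF st m0 red(1)] by simp
  have m2: "m \<ge> 2" using cox_mat_ge2[OF st m0] m by simp
  define x where "x = pi / m"
  have x: "0 < x" "x < pi" using m2 by (auto simp: x_def field_simps)
  have sx: "sin x > 0" using x by (rule sin_gt_zero)
  define c where "c = - cosine s t"
  have c: "c = cos x" "- cosine t s = c" "cosine s t = - c" "cosine t s = - c"
  proof -
    show "c = cos x" using st m m0 by (simp add: c_def cosine_def x_def)
  qed (simp_all add: c_def cosine_commute[of t s])
  have mx: "real m * x = pi" using m2 by (simp add: x_def)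
  have ch: "cheb c m = 0" "cheb c (Suc m) = -1" "cheb c k = 1"
  proof -
    have "sin x * cheb c m = 0" using sin_cheb[of x m] mx c by simp
    then show "cheb c m = 0" using sx by simp
    have "sin x * cheb c (Suc m) = sin (real m * x + x)"
      using sin_cheb[of x "Suc m"] c by (simp add: algebra_simps)
    then have "sin x * (cheb c (Suc m) + 1) = 0" using mx by (simp add: sin_add distrib_left)
    then show "cheb c (Suc m) = -1" using sx by (simp del: cheb.simps)
    have "sin x * cheb c k = sin (real m * x - x)"
      using sin_cheb[of x k] c Suc by (simp add: algebra_simps)
    then have "sin x * (cheb c k - 1) = 0" using mx by (simp add: sin_diff right_diff_distrib)
    then show "cheb c k = 1" using sx by (simp del: cheb.simps)
  qed
  have root: "foldr refl (alternating m p q) (simple_root (if even m then p else q)) = (\<lambda>r. - simple_root p r) \<and>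
     foldr refl (alternating m q p) (simple_root (if even m then p else q)) = (\<lambda>r. - simple_root p r)"
    if pq: "p \<in> S" "q \<in> S" "p \<noteq> q" "- cosine p q = c" "- cosine q p = c" for p q
  proof -
    let ?r = "if even m then p else q"
    have "foldr refl (alternating m p q) (simple_root ?r) = (\<lambda>r. - simple_root p r)"
      using foldr_alternating[OF pq(1-3), of m] ch pq(4) by (simp add: lincomb_def)
    moreover have "alternating m q p = alternating k q p @ [?r]"
      using alternating_snoc[of k q p] Suc by simp
    then have "foldr refl (alternating m q p) (simple_root ?r) = foldr refl (alternating k q p) (refl ?r (simple_root ?r))"
      by simp
    moreover have "refl ?r (simple_root ?r) = (\<lambda>r. - simple_root ?r r)"
      using pq by (simp add: refl_def pairing_simple_root lincomb_def)
    moreover have "foldr refl (alternating k q p) (simple_root ?r) = simple_root p"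
      using foldr_alternating[of q p k] ch pq Suc by (auto simp: lincomb_def)
    ultimately show ?thesis by (simp add: lin_map_uminus[OF foldr_refl_lin])
  qed
  let ?f = "foldr refl (alternating m s t)" and ?g = "foldr refl (alternating m t s)"
  have on_roots: "?f (simple_root r) = ?g (simple_root r)" if "r \<in> {s, t}" for r
    using root[OF st] root[of t s] st c that by (auto split: if_splits)
  show ?thesis
  proof (rule ext)
    fix v
    \<comment> \<open>\<open>a\<close> and \<open>b\<close> solve the linear system that makes
      \<open>u\<close> orthogonal to both roots; \<open>d\<close> is the determinant of its Gram
      matrix.\<close>
    define d where "d = 1 - c\<^sup>2"
    have "d = (sin x)\<^sup>2" by (simp add: d_def c sin_squared_eq)
    then have d: "d \<noteq> 0" using sx by simp
    define a where "a = (pairing s v + c * pairing t v) / d"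
    define b where "b = (pairing t v + c * pairing s v) / d"
    define u where "u = lincomb 1 v (-1) (lincomb a (simple_root s) b (simple_root t))"
    have v: "v = lincomb 1 (lincomb a (simple_root s) b (simple_root t)) 1 u"
      by (simp add: u_def lincomb_def)
    have da: "d * a = pairing s v + c * pairing t v" "d * b = pairing t v + c * pairing s v"
      using d by (simp_all add: a_def b_def)
    have "d * (pairing s v - a + c * b) = 0" "d * (pairing t v - b + c * a) = 0"
    proof -
      have "d * (pairing s v - a + c * b) = d * pairing s v - d * a + c * (d * b)"
        "d * (pairing t v - b + c * a) = d * pairing t v - d * b + c * (d * a)"
        by (simp_all add: algebra_simps)
      then show "d * (pairing s v - a + c * b) = 0" "d * (pairing t v - b + c * a) = 0"
        unfolding da by (simp_all add: d_def algebra_simps power2_eq_square)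
    qed
    then have "pairing s v - a + c * b = 0" "pairing t v - b + c * a = 0" using d by simp_all
    then have "pairing s u = 0" "pairing t u = 0"
      using st c by (simp_all add: u_def pairing_lincomb pairing_simple_root algebra_simps)
    then have fix_u: "refl s u = u" "refl t u = u" by (simp_all add: refl_def lincomb_def)
    have fu: "foldr refl (alternating j p q) u = u" if "p \<in> {s,t}" "q \<in> {s,t}" for j p q
      using that by (induction j arbitrary: p q) (auto simp: fix_u)
    show "?f v = ?g v"
      by (subst (1 2) v) (simp add: lin_mapD[OF foldr_refl_lin] fu on_roots)
  qed
qed

text \<open>By Matsumoto's theorem the chosen reduced word does not matter. This yields the action
  of \<open>W\<close> without a presentation by generators and relations.\<close>

definition act :: "'a \<Rightarrow> ('a \<Rightarrow> real) \<Rightarrow> ('a \<Rightarrow> real)" where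
  "act w = foldr refl (SOME ws. reduced_word S ws \<and> sum_list ws = w)"

lemma act_reduced:
  assumes "reduced_word S ws"
  shows "act (sum_list ws) = foldr refl ws"
proof -
  let ?v = "SOME vs. reduced_word S vs \<and> sum_list vs = sum_list ws"
  have "reduced_word S ?v \<and> sum_list ?v = sum_list ws"
    by (rule someI[of _ ws]) (use assms in simp)
  then show ?thesis unfolding act_def
    using matsumoto[of refl, OF refl_braid] assms by blast
qed

lemma act_step:
  assumes s: "s \<in> S" and w: "w \<in> W"
  shows "act (s + w) v = refl s (act w v)"
proof -
  have up: "act (s + w) v = refl s (act w v)" if w: "w \<in> W" and l: "len (s + w) = Suc (len w)" for w
  proof -
    obtain ws where ws: "reduced_word S ws" "sum_list ws = w" using w word_len_exists by blast
    then have "reduced_word S (s # ws)" using l reduced_Cons s by blast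
    then show ?thesis using ws act_reduced[of ws] act_reduced[of "s # ws"] by auto
  qed
  show ?thesis
  proof (cases "len (s + w) = Suc (len w)")
    case True then show ?thesis using up w by blast
  next
    case False
    then have "len (s + (s + w)) = Suc (len (s + w))" using len_step[OF s w] s by simp
    from up[OF W_step[OF s w] this] have "act w v = refl s (act (s + w) v)" using s by simp
    then show ?thesis using refl_refl s by simp
  qed
qed

lemma act_sum_list: "ws \<in> lists S \<Longrightarrow> act (sum_list ws) v = foldr refl ws v"
proof (induction ws rule: list.induct)
  case Nil
  have "reduced_word S []" by (simp add: reduced_word_def)
  from act_reduced[OF this] show ?case by simp
next
  case (Cons s ws)
  then show ?case using act_step[OF _ word_group_sum_list, of s ws v] by auto
qed

lemma act_zero [simp]: "act 0 v = v"
  using act_sum_list[of "[]"] by simp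

lemma act_gen: "s \<in> S \<Longrightarrow> act s v = refl s v"
  using act_sum_list[of "[s]"] by simp

lemma act_add:
  assumes "u \<in> W" "w \<in> W" shows "act (u + w) v = act u (act w v)"
proof -
  obtain us ws where "us \<in> lists S" "u = sum_list us" "ws \<in> lists S" "w = sum_list ws"
    using assms by (auto simp: word_group_def)
  then show ?thesis using act_sum_list[of "us @ ws"] act_sum_list[of us] act_sum_list[of ws] by auto
qed

lemma act_uminus [simp]:
  assumes "w \<in> W" shows "act w (act (- w) v) = v" "act (- w) (act w v) = v"
  using act_add[OF assms W_uminus[OF assms]] act_add[OF W_uminus[OF assms] assms] by simp_all

lemma act_lin: "lin_map (act w)"
  unfolding act_def by (rule foldr_refl_lin)

lemma form_act:
  assumes "w \<in> W" shows "form (act w u) (act w v) = form u v"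
proof -
  have "form (foldr refl ws u) (foldr refl ws v) = form u v" if "ws \<in> lists S" for ws
    using that by (induction ws rule: list.induct) (auto simp: form_refl)
  then show ?thesis using assms act_sum_list by (force simp: word_group_def)
qed

lemma len_step_right:
  assumes s: "s \<in> S" and w: "w \<in> W"
  shows "len (w + s) = Suc (len w) \<or> Suc (len (w + s)) = len w"
proof -
  have "len (w + s) = len (s + - w)"
    using len_uminus[of "w + s"] w s by (simp add: minus_add uminus_gen word_group_add word_group_gen)
  then show ?thesis using len_step[OF s W_uminus[OF w]] len_uminus[OF w] by simp
qed

section \<open>Positivity of roots\<close>

definition pos :: "('a \<Rightarrow> real) \<Rightarrow> bool" where
  "pos v \<longleftrightarrow> (\<forall>r. v r \<ge> 0)"

lemma pos_lincomb: "pos u \<Longrightarrow> pos v \<Longrightarrow> x \<ge> 0 \<Longrightarrow> y \<ge> 0 \<Longrightarrow> pos (lincomb x u y v)"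
  by (simp add: pos_def lincomb_def)

text \<open>Split off from \<open>w\<close> on the right the longest possible alternating word in \<open>s\<close> and the last
  letter \<open>t\<close> of a reduced word for \<open>w\<close>.\<close>

lemma act_pos:
  assumes "w \<in> W" "s \<in> S" "len (w + s) = Suc (len w)"
  shows "pos (act w (simple_root s))"
  using assms
proof (induction "len w" arbitrary: w s rule: less_induct)
  case less
  show ?case
  proof (cases "w = 0")
    case True
    then show ?thesis by (simp add: pos_def simple_root_def)
  next
    case False
    have s: "s \<in> S" and w: "w \<in> W" and lws: "len (w + s) = Suc (len w)" using less.prems by auto
    \<comment> \<open>The inverse of \<open>w\<close> is used because \<open>coset_decomp\<close>
      splits off factors on the left.\<close>
    obtain ws where ws: "reduced_word S (rev ws)" "sum_list (rev ws) = - w"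
      using word_len_exists[OF W_uminus[OF w]] by (metis rev_rev_ident)
    from False ws obtain t where t: "t \<in> S" "Suc (len (t + - w)) = len w"
    proof -
      obtain t x where tx: "rev ws = t # x" using ws False by (cases "rev ws") auto
      have "t \<in> S" using ws tx reduced_ConsD by auto
      moreover have "reduced_word S x" using ws tx reduced_ConsD by auto
      moreover have "t + - w = sum_list x" using \<open>t \<in> S\<close> ws(2) tx by (simp flip: ws(2))
      ultimately show thesis using that[of t] ws tx len_uminus[OF w] by (auto simp: reduced_word_def)
    qed
    have lsw: "len (s + - w) = Suc (len w)"
      using lws len_uminus[of "w + s"] w s by (simp add: minus_add uminus_gen word_group_add word_group_gen)
    have st: "s \<noteq> t" using t lsw by auto
    let ?J = "{s, t}"
    obtain a v where a: "a \<in> lists ?J" "reduced_word S a" "v \<in> W" "- w = sum_list a + v"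
      and add: "\<And>a'. a' \<in> lists ?J \<Longrightarrow> reduced_word S a' \<Longrightarrow> len (sum_list a' + v) = length a' + len v"
      using coset_decomp[OF _ W_uminus[OF w], of ?J] s t(1) by blast
    have aS: "a \<in> lists S" using a by (simp add: reduced_word_def)
    have lw: "len w = length a + len v" using add[OF a(1,2)] a(4) len_uminus[OF w] by simp
    have "a \<noteq> []"
    proof
      assume "a = []"
      then have v: "v = - w" using a by simp
      have "len t = 1" using len_step[OF t(1), of 0] by simp
      then have "reduced_word S [t]" using t by (simp add: reduced_word_def)
      from add[OF _ this] show False using t v len_uminus[OF w] by simp
    qed
    have ra: "reduced_word S (s # a)"
    proof (rule reduced_Cons[OF s a(2)], rule ccontr)
      have aW: "sum_list a \<in> W" using aS word_group_sum_list by blast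
      assume "len (s + sum_list a) \<noteq> Suc (len (sum_list a))"
      then have l: "Suc (len (s + sum_list a)) = length a"
        using len_step[OF s aW] a(2) by (simp add: reduced_word_def)
      obtain b where b: "reduced_word S b" "set b \<subseteq> set (s # a)" "sum_list b = sum_list (s # a)"
        using reduced_subword[of "s # a"] aS s by auto
      then have "b \<in> lists ?J" using a by auto
      from add[OF this b(1)] have "len (s + - w) = length b + len v" using b a by (simp add: add.assoc)
      then show False using lsw lw l b by (simp add: reduced_word_def)
    qed
    define k where "k = length a"
    have "s # a \<in> lists {s, t}" using a by simp
    from reduced_alternating[OF this ra] st have "s # a = alternating (Suc k) s t"
      by (auto simp: k_def)
    then have ak: "a = alternating k t s" by simp
    \<comment> \<open>Prefixing \<open>s\<close> keeps the alternating word reduced, so even k + 1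
      is at most the Coxeter number, and both coefficients below are nonnegative.\<close>
    have kle: "cox_mat s t = 0 \<or> Suc k \<le> cox_mat s t"
      using reduced_alternating_le[OF s t(1) st _ , of "Suc k"] ra ak by auto
    let ?p = "if even k then t else s" and ?q = "if even k then s else t"
    have pq: "?p \<in> S" "?q \<in> S" "?p \<noteq> ?q" "?p \<in> ?J" "?q \<in> ?J" using s t st by auto
    have rev_ak: "rev a = alternating k ?q ?p"
      using rev_alternating[of k t s] ak by simp
    have w_eq: "w = - v + sum_list (rev a)"
    proof -
      have "w = - (- w)" by simp
      also have "\<dots> = - v + - sum_list a" by (simp only: a(4) minus_add)
      finally show ?thesis using sum_list_rev[OF aS] by simp
    qed
    have vW: "- v \<in> W" using a W_uminus by blast
    \<comment> \<open>\<open>v\<close> is minimal in its coset, so both letters lengthen its inverse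
      on the right, and it is shorter than \<open>w\<close> because \<open>a\<close> is not
      empty.\<close>
    have IH: "pos (act (- v) (simple_root r))" if "r \<in> ?J" for r
    proof (rule less.hyps)
      have rS: "r \<in> S" using that s t by auto
      show "len (- v) < len w" using lw \<open>a \<noteq> []\<close> len_uminus[OF a(3)] by simp
      have "len r = 1"
        using len_step[OF rS, of 0] by simp
      then have "reduced_word S [r]" using rS by (simp add: reduced_word_def)
      from add[OF _ this] have "len (r + v) = Suc (len v)" using that by simp
      then show "len (- v + r) = Suc (len (- v))"
        using len_uminus[of "r + v"] len_uminus[OF a(3)] a(3) rS
        by (simp add: minus_add uminus_gen word_group_add word_group_gen)
    qed (use vW that s t in auto)
    have s_eq: "s = (if even k then ?q else ?p)" by simp
    have "act w (simple_root s) = act (- v) (foldr refl (rev a) (simple_root s))"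
    proof -
      have "rev a \<in> lists S" using aS by auto
      then show ?thesis
        using w_eq act_add[OF vW word_group_sum_list[of "rev a" S]] act_sum_list[of "rev a"] by metis
    qed
    also have "foldr refl (rev a) (simple_root s) =
      lincomb (cheb (- cosine ?q ?p) (Suc k)) (simple_root ?q) (cheb (- cosine ?q ?p) k) (simple_root ?p)"
      unfolding rev_ak using foldr_alternating[of s t k] foldr_alternating[of t s k] s t(1) st
      by (cases "even k") simp_all
    finally have "act w (simple_root s) =
      lincomb (cheb (- cosine ?q ?p) (Suc k)) (act (- v) (simple_root ?q)) (cheb (- cosine ?q ?p) k) (act (- v) (simple_root ?p))"
      by (simp add: lin_mapD[OF act_lin])
    moreover have "cosine ?q ?p = cosine s t" by (simp add: cosine_commute)
    ultimately show ?thesis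
      using IH pq cheb_nonneg[OF s t(1) st, of k] cheb_nonneg[OF s t(1) st, of "Suc k"] kle
      by (auto intro!: pos_lincomb)
  qed
qed

end

section \<open>Roots and infinite dihedral reflection subgroups\<close>

primrec nmul :: "nat \<Rightarrow> 'a::monoid_add \<Rightarrow> 'a" where
  "nmul 0 x = 0"
| "nmul (Suc n) x = x + nmul n x"

lemma nmul_add: "nmul (m + n) x = nmul m x + nmul n x"
  by (induction m) (auto simp: add.assoc)

lemma nmul_mult: "nmul (m * n) x = nmul m (nmul n x)"
  by (induction m) (auto simp: nmul_add)

lemma nmul_zero [simp]: "nmul n (0::'a::monoid_add) = 0"
  by (induction n) auto

lemma nmul_commute: "nmul n x + x = x + nmul n x"
  using nmul_add[of n 1 x] nmul_add[of 1 n x] by (simp add: add.commute)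

lemma nmul_uminus: "nmul n (- x) = - nmul n (x :: 'a::group_add)"
proof (induction n)
  case (Suc n)
  have "nmul (Suc n) (- x) = - (nmul n x + x)" using Suc by (simp add: minus_add)
  then show ?case by (simp add: nmul_commute)
qed simp

lemma nmul_mod:
  assumes "nmul n x = 0"
  shows "nmul (k mod n) x = nmul k x"
proof -
  have "nmul k x = nmul ((k div n) * n + k mod n) x" by (simp only: div_mult_mod_eq)
  then show ?thesis using assms by (simp only: nmul_add nmul_mult) simp
qed

lemma word_group_mem_induct [consumes 1, case_names zero step]:
  assumes "w \<in> word_group S" "P 0" "\<And>s w. s \<in> S \<Longrightarrow> w \<in> word_group S \<Longrightarrow> P w \<Longrightarrow> P (s + w)"
  shows "P w"
proof -
  have "P (sum_list ws)" if "ws \<in> lists S" for ws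
    using that
  proof (induction ws rule: list.induct)
    case (Cons s ws)
    then show ?case using assms(3)[of s "sum_list ws"] word_group_sum_list[of ws S] by simp
  qed (use assms(2) in simp)
  then show ?thesis using assms(1) by (auto simp: word_group_def)
qed

text \<open>Every element is a power of the rotation \<open>p\<close>, possibly followed by
  \<open>s\<close>, and \<open>p\<close> has only finitely many powers.\<close>

lemma finite_dihedral:
  fixes s t :: "'a::group_add"
  assumes s: "s + s = 0" and t: "t + t = 0" and n: "n > 0" "nmul n (s + t) = 0"
  shows "finite (word_group {s, t})"
proof -
  define p where "p = s + t"
  have t_eq: "t + x = s + (p + x)" for x using s by (simp add: p_def flip: add.assoc)
  have neg: "- nmul k p = nmul ((n - 1) * k) p" for k
  proof -
    have "nmul k p + nmul ((n - 1) * k) p = nmul (k + (n - 1) * k) p" by (simp add: nmul_add)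
    also have "k + (n - 1) * k = k * n" using n(1) by (cases n) auto
    also have "nmul (k * n) p = 0" using n(2) by (simp add: nmul_mult p_def)
    finally show ?thesis by (simp add: minus_unique)
  qed
  have conj: "s + nmul k p + s = - nmul k p" for k
  proof (induction k)
    case (Suc k)
    have "- p = t + s" using s t by (simp add: p_def minus_add minus_unique)
    then have sp: "s + p = - p + s" using s t by (simp add: p_def add.assoc flip: add.assoc[of s s])
    have "s + nmul (Suc k) p + s = - p + (s + nmul k p + s)"
      using sp by (simp add: add.assoc[symmetric])
    also have "\<dots> = - nmul (Suc k) p" using Suc by (simp add: minus_add nmul_commute[symmetric])
    finally show ?case .
  qed (use s in simp)
  define F where "F = (\<lambda>k. nmul k p) ` UNIV \<union> (\<lambda>k. nmul k p + s) ` UNIV"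
  have sF: "s + x \<in> F" if "x \<in> F" for x
  proof -
    obtain k where "x = nmul k p \<or> x = nmul k p + s" using \<open>x \<in> F\<close> unfolding F_def by blast
    then show ?thesis
    proof
      assume x: "x = nmul k p + s"
      then have "s + x = nmul ((n - 1) * k) p" using conj[of k] neg[of k] by (simp add: add.assoc)
      then show ?thesis by (auto simp: F_def)
    next
      assume x: "x = nmul k p"
      have "s + x = s + x + s + s" using s by (simp add: add.assoc)
      also have "\<dots> = nmul ((n - 1) * k) p + s" using x conj[of k] neg[of k] by simp
      finally show ?thesis by (auto simp: F_def)
    qed
  qed
  have pF: "p + x \<in> F" if "x \<in> F" for x
  proof -
    obtain k where "x = nmul k p \<or> x = nmul k p + s" using \<open>x \<in> F\<close> unfolding F_def by blast
    then have "p + x = nmul (Suc k) p \<or> p + x = nmul (Suc k) p + s" by (auto simp: add.assoc)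
    then show ?thesis by (auto simp: F_def simp del: nmul.simps)
  qed
  have "word_group {s, t} \<subseteq> F"
  proof
    fix x assume "x \<in> word_group {s, t}"
    then show "x \<in> F"
    proof (induction rule: word_group_mem_induct)
      case zero
      have "0 = nmul 0 p" by simp
      then show ?case unfolding F_def by blast
    next
      case (step r w)
      then show ?case using sF pF t_eq by auto
    qed
  qed
  moreover have "finite F"
  proof -
    have r: "range (\<lambda>k. nmul k p) \<subseteq> (\<lambda>k. nmul k p) ` {..<n}"
    proof clarify
      fix k
      have "nmul k p = nmul (k mod n) p" using nmul_mod[of n p k] n(2) by (simp add: p_def)
      moreover have "k mod n < n" using n(1) by simp
      ultimately show "nmul k p \<in> (\<lambda>k. nmul k p) ` {..<n}" by blast
    qed
    then have "finite (range (\<lambda>k. nmul k p))" by (rule finite_subset) simp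
    moreover have "(\<lambda>k. nmul k p + s) ` UNIV = (\<lambda>x. x + s) ` range (\<lambda>k. nmul k p)" by auto
    ultimately show ?thesis unfolding F_def by simp
  qed
  ultimately show ?thesis by (rule finite_subset)
qed

definition reflections :: "'a::group_add set \<Rightarrow> 'a set" where
  "reflections S = {w + s - w | w s. w \<in> word_group S \<and> s \<in> S}"

lemma reflections_mono: "J \<subseteq> S \<Longrightarrow> reflections J \<subseteq> reflections S"
  using word_group_mono[of J S] by (auto simp: reflections_def)

definition lin_fun :: "(('a \<Rightarrow> real) \<Rightarrow> real) \<Rightarrow> bool" where
  "lin_fun g \<longleftrightarrow> (\<forall>x u y v. g (lincomb x u y v) = x * g u + y * g v)"

lemma lin_fun_expand:
  assumes g: "lin_fun g" and A: "finite A" and v: "\<And>r. r \<notin> A \<Longrightarrow> v r = 0"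
  shows "g v = (\<Sum>s\<in>A. v s * g (simple_root s))"
  using A v
proof (induction A arbitrary: v rule: finite_induct)
  case empty
  then have "v = lincomb 0 v 0 v" by (auto simp: lincomb_def)
  then have "g v = 0 * g v + 0 * g v" using g unfolding lin_fun_def by metis
  then show ?case by simp
next
  case (insert a A)
  define u where "u = v(a := 0)"
  have v: "v = lincomb 1 u (v a) (simple_root a)"
    by (auto simp: u_def lincomb_def simple_root_def)
  have "g u = (\<Sum>s\<in>A. u s * g (simple_root s))"
    by (rule insert.IH) (use insert.prems in \<open>auto simp: u_def\<close>)
  also have "\<dots> = (\<Sum>s\<in>A. v s * g (simple_root s))"
    using insert.hyps by (intro sum.cong) (auto simp: u_def)
  finally have "g u = \<dots>" .
  moreover have "g v = 1 * g u + v a * g (simple_root a)"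
    by (subst v) (use g in \<open>simp only: lin_fun_def\<close>)
  ultimately show ?case using insert.hyps by simp
qed

context coxeter_group
begin

definition roots :: "('a \<Rightarrow> real) set" where
  "roots = {act w (simple_root s) | w s. w \<in> W \<and> s \<in> S}"

text \<open>A relation rather than a function: a reflection has two opposite roots, and that a root
  determines its reflection needs faithfulness of the action (\<open>root_refl_inj\<close>).\<close>

definition root_refl :: "('a \<Rightarrow> real) \<Rightarrow> 'a \<Rightarrow> bool" where
  "root_refl b t \<longleftrightarrow> (\<exists>w\<in>W. \<exists>s\<in>S. b = act w (simple_root s) \<and> t = w + s - w)"

lemma root_refl_exists: "b \<in> roots \<Longrightarrow> \<exists>t. root_refl b t"
  by (auto simp: roots_def root_refl_def)

lemma simple_root_root: "s \<in> S \<Longrightarrow> simple_root s \<in> roots"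
  unfolding roots_def by (force intro: exI[of _ 0])

lemma root_refl_root: "root_refl b t \<Longrightarrow> b \<in> roots"
  by (auto simp: roots_def root_refl_def)

lemma root_refl_reflection: "root_refl b t \<Longrightarrow> t \<in> reflections S"
  by (auto simp: reflections_def root_refl_def)

lemma reflections_W: "t \<in> reflections S \<Longrightarrow> t \<in> W"
  unfolding reflections_def diff_conv_add_uminus
  by (auto intro!: word_group_add intro: W_uminus word_group_gen simp del: add_uminus_conv_diff)

lemma reflections_invol: "t \<in> reflections S \<Longrightarrow> t + t = 0"
proof -
  assume "t \<in> reflections S"
  then obtain w s where "s \<in> S" "t = w + s - w" by (auto simp: reflections_def)
  then have "t + t = w + (s + s) - w" by (simp only: add.assoc diff_conv_add_uminus minus_add_cancel)
  then show ?thesis using \<open>s \<in> S\<close> invol by simp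
qed

lemma root_act:
  assumes "b \<in> roots" "w \<in> W" shows "act w b \<in> roots"
proof -
  obtain u s where us: "u \<in> W" "s \<in> S" "b = act u (simple_root s)"
    using assms by (auto simp: roots_def)
  then have "act w b = act (w + u) (simple_root s)" "w + u \<in> W"
    using act_add[OF assms(2) us(1)] word_group_add[OF assms(2) us(1)] by simp_all
  then show ?thesis using us(2) unfolding roots_def by blast
qed

lemma root_refl_conj:
  assumes "root_refl b t" "w \<in> W" shows "root_refl (act w b) (w + t - w)"
proof -
  obtain u s where us: "u \<in> W" "s \<in> S" "b = act u (simple_root s)" "t = u + s - u"
    using assms by (auto simp: root_refl_def)
  then have "w + t - w = (w + u) + s - (w + u)"
    by (simp only: add.assoc diff_conv_add_uminus minus_add)
  moreover have "act w b = act (w + u) (simple_root s)" "w + u \<in> W"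
    using us act_add[OF assms(2) us(1)] word_group_add[OF assms(2) us(1)] by simp_all
  ultimately show ?thesis
    unfolding root_refl_def using us(2) by blast
qed

lemma form_root: "b \<in> roots \<Longrightarrow> form b b = 1"
  by (auto simp: roots_def form_act form_simple_root pairing_simple_root)

lemma act_root_refl:
  assumes "root_refl b t"
  shows "act t v = lincomb 1 v (- 2 * form v b) b"
proof -
  obtain w s where ws: "w \<in> W" "s \<in> S" "b = act w (simple_root s)" "t = w + s + - w"
    using assms by (auto simp: root_refl_def)
  have "act t v = act w (refl s (act (- w) v))"
    using ws act_add W_uminus act_gen word_group_add word_group_gen by (metis)
  also have "\<dots> = lincomb 1 (act w (act (- w) v)) (- 2 * pairing s (act (- w) v)) (act w (simple_root s))"
    by (simp add: refl_def lin_mapD[OF act_lin])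
  also have "pairing s (act (- w) v) = form (act w (simple_root s)) (act w (act (- w) v))"
    using ws by (simp add: form_act form_simple_root del: act_uminus)
  finally show ?thesis using ws by (simp add: form_commute)
qed

text \<open>Evaluating \<open>t\<close> at \<open>b\<close> by both reflection formulas shows that
  \<open>b\<close> is a multiple of \<open>b'\<close>; both have norm 1, so the factor is 1 or
  -1.\<close>

lemma root_refl_unique:
  assumes "root_refl b t" "root_refl b' t"
  shows "b' = b \<or> b' = (\<lambda>r. - b r)"
proof -
  define x where "x = form b b'"
  have r: "form b b = 1" "form b' b' = 1" using assms root_refl_root form_root by blast+
  have "lincomb 1 b (- 2 * form b b) b = lincomb 1 b (- 2 * form b b') b'"
    using act_root_refl[OF assms(1), of b] act_root_refl[OF assms(2), of b] by simp
  then have b: "b r = x * b' r" for r using r by (auto simp: lincomb_def x_def fun_eq_iff)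
  then have "b = lincomb x b' 0 b'" by (auto simp: lincomb_def)
  then have "form b w = x * form b' w" for w
    using form_lincomb1[of x b' 0 b' w] by simp
  from this[of b] have "form b b = x * form b' b" .
  then have "x * x = 1" using r by (simp add: form_commute[of b' b] x_def)
  then have "x = 1 \<or> x = -1" by (simp add: square_eq_1_iff power2_eq_square)
  then show ?thesis using b by (auto simp: fun_eq_iff)
qed

lemma act_neg: "act w (\<lambda>r. - v r) = (\<lambda>r. - act w v r)"
  by (rule lin_map_uminus[OF act_lin])

lemma root_uminus:
  assumes "b \<in> roots" shows "(\<lambda>r. - b r) \<in> roots"
proof -
  obtain w s where ws: "w \<in> W" "s \<in> S" "b = act w (simple_root s)"
    using assms by (auto simp: roots_def)
  have "refl s (simple_root s) = (\<lambda>r. - simple_root s r)"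
    using ws by (simp add: refl_def pairing_simple_root lincomb_def)
  then have "(\<lambda>r. - b r) = act (w + s) (simple_root s)"
    using ws act_add[OF ws(1) word_group_gen[OF ws(2)]] by (simp add: act_gen act_neg)
  then show ?thesis using ws word_group_add word_group_gen unfolding roots_def by blast
qed

text \<open>One of \<open>w\<close> and \<open>w + s\<close> is lengthened by \<open>s\<close>, so
  \<open>act_pos\<close> applies to the root or to its negative. Both cannot be positive, since a
  root is not zero.\<close>

lemma pos_uminus:
  assumes b: "b \<in> roots"
  shows "pos (\<lambda>r. - b r) \<longleftrightarrow> \<not> pos b"
proof -
  have one: "pos b \<or> pos (\<lambda>r. - b r)"
  proof -
    obtain w s where ws: "w \<in> W" "s \<in> S" "b = act w (simple_root s)"
      using assms by (auto simp: roots_def)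
    show ?thesis
    proof (cases "len (w + s) = Suc (len w)")
      case True
      then show ?thesis using act_pos ws by blast
    next
      case False
      have w': "w + s \<in> W" using ws word_group_add word_group_gen by blast
      have "w + s + s = w" using ws invol by (simp add: add.assoc)
      then have "len (w + s + s) = Suc (len (w + s))"
        using False len_step_right[OF ws(2,1)] by simp
      from act_pos[OF w' ws(2) this] have "pos (act w (refl s (simple_root s)))"
        using ws act_add[OF ws(1) word_group_gen[OF ws(2)]] act_gen by simp
      moreover have "refl s (simple_root s) = (\<lambda>r. - simple_root s r)"
        using ws by (simp add: refl_def pairing_simple_root lincomb_def)
      ultimately show ?thesis using ws act_neg by simp
    qed
  qed
  have "\<not> (pos b \<and> pos (\<lambda>r. - b r))"
  proof
    assume "pos b \<and> pos (\<lambda>r. - b r)"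
    then have "b = (\<lambda>r. 0)" by (auto simp: pos_def fun_eq_iff intro: antisym)
    then have "form b b = 0" by (simp add: form_def)
    then show False using form_root[OF b] by simp
  qed
  then show ?thesis using one by blast
qed

lemma refl_simple_root: "s \<in> S \<Longrightarrow> refl s (simple_root s) = (\<lambda>r. - simple_root s r)"
  by (simp add: refl_def pairing_simple_root lincomb_def)

lemma pos_simple_root: "pos (simple_root s)"
  by (simp add: pos_def simple_root_def)

lemma refl_root: "b \<in> roots \<Longrightarrow> s \<in> S \<Longrightarrow> refl s b \<in> roots"
  using root_act[of b s] act_gen word_group_gen by metis

text \<open>\<open>refl s\<close> changes only the coordinate at \<open>s\<close>. Hence all other
  coordinates of \<open>b\<close> vanish, and norm 1 fixes the remaining one.\<close>

lemma refl_flips: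
  assumes s: "s \<in> S" and b: "b \<in> roots" "pos b" "\<not> pos (refl s b)"
  shows "b = simple_root s"
proof -
  have "pos (\<lambda>r. - refl s b r)" using pos_uminus[OF refl_root[OF b(1) s]] b by simp
  then have z: "b r = 0" if "r \<noteq> s" for r
    using that b(2) by (auto simp: pos_def refl_def lincomb_def simple_root_def intro: antisym split: if_splits dest!: spec[of _ r])
  then have eq: "b = lincomb (b s) (simple_root s) 0 b"
    by (auto simp: lincomb_def simple_root_def)
  have "form b b = b s * form (simple_root s) b" by (subst (1) eq) (simp add: form_lincomb1)
  also have "form (simple_root s) b = b s"
    by (subst eq) (use s in \<open>simp add: form_lincomb2 form_simple_root pairing_simple_root\<close>)
  finally have "b s * b s = 1" using form_root[OF b(1)] by simp
  then have "b s = 1 \<or> b s = -1" by (simp add: square_eq_1_iff)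
  moreover have "b s \<ge> 0" using b(2) by (simp add: pos_def)
  ultimately have "b s = 1" by auto
  then show ?thesis using z by (auto simp: simple_root_def)
qed

text \<open>Each letter adds at most one pair of opposite roots, by \<open>refl_flips\<close>. These
  are the walls between two chambers; their finiteness drives all later sign arguments.\<close>

lemma finite_flips:
  assumes "w \<in> W"
  shows "finite {b \<in> roots. pos b \<noteq> pos (act w b)}"
  using assms
proof (induction rule: word_group_mem_induct)
  case zero
  then show ?case by simp
next
  case (step s w)
  have "{b \<in> roots. pos b \<noteq> pos (act (s + w) b)} \<subseteq>
    {b \<in> roots. pos b \<noteq> pos (act w b)} \<union>
    act (- w) ` {simple_root s, (\<lambda>r. - simple_root s r)}"
    (is "_ \<subseteq> ?A \<union> ?B")
  proof (rule subsetI, rule ccontr)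
    fix b assume "b \<in> {b \<in> roots. pos b \<noteq> pos (act (s + w) b)}" "b \<notin> ?A \<union> ?B"
    then have b: "b \<in> roots" "pos b \<noteq> pos (act (s + w) b)" "b \<notin> ?B" "pos b = pos (act w b)" by blast+
    let ?c = "act w b"
    have c: "?c \<in> roots" using b step root_act by blast
    have eq: "act (s + w) b = refl s ?c" using act_step step by blast
    have "pos ?c = pos (refl s ?c)"
    proof (rule ccontr)
      assume ne: "pos ?c \<noteq> pos (refl s ?c)"
      have "?c = simple_root s \<or> ?c = (\<lambda>r. - simple_root s r)"
      proof (cases "pos ?c")
        case True
        then show ?thesis using refl_flips[OF step(1) c] ne by blast
      next
        case False
        let ?d = "\<lambda>r. - ?c r"
        have d: "?d \<in> roots" "pos ?d" using root_uminus[OF c] pos_uminus[OF c] False by auto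
        have "refl s ?d = (\<lambda>r. - refl s ?c r)" by (rule lin_map_uminus[OF refl_lin])
        then have "\<not> pos (refl s ?d)" using ne False pos_uminus[OF refl_root[OF c step(1)]] by simp
        then have "?d = simple_root s" using refl_flips[OF step(1) d] by blast
        then have "- ?c r = simple_root s r" for r by (rule fun_cong)
        then have "?c r = - simple_root s r" for r by (metis minus_minus)
        then show ?thesis by blast
      qed
      then have "act (- w) ?c \<in> act (- w) ` {simple_root s, (\<lambda>r. - simple_root s r)}" by blast
      then show False using b(3) step(2) by simp
    qed
    then show False using b eq by simp
  qed
  then show ?case by (rule finite_subset) (use step in simp)
qed

text \<open>The last letter of a reduced word for a nonzero \<open>w\<close> is a simple root that
  \<open>w\<close> makes negative.\<close>

lemma act_faithful:
  assumes w: "w \<in> W" and fix_roots: "\<And>s. s \<in> S \<Longrightarrow> act w (simple_root s) = simple_root s"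
  shows "w = 0"
proof (rule ccontr)
  assume "w \<noteq> 0"
  obtain ws where ws: "reduced_word S ws" "sum_list ws = - w" using word_len_exists[OF W_uminus[OF w]] by blast
  then obtain s x where sx: "ws = s # x" using \<open>w \<noteq> 0\<close> by (cases ws) auto
  have s: "s \<in> S" using ws sx reduced_ConsD by blast
  have "reduced_word S x" using ws sx reduced_ConsD by blast
  have x: "sum_list x = - (w + s)" using ws sx s by (simp add: minus_add uminus_gen flip: ws(2))
  have wsW: "w + s \<in> W" using w s word_group_add word_group_gen by blast
  have "len (w + s) = length x" using \<open>reduced_word S x\<close> x len_uminus[OF wsW] by (simp add: reduced_word_def)
  moreover have "len w = Suc (length x)" using ws sx len_uminus[OF w] by (simp add: reduced_word_def)
  moreover have "w + s + s = w" using s invol by (simp add: add.assoc)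
  ultimately have "pos (act (w + s) (simple_root s))" using act_pos[OF wsW s] by simp
  then have "pos (\<lambda>r. - act w (simple_root s) r)"
    using act_add[OF w word_group_gen[OF s]] act_gen[OF s] refl_simple_root[OF s] act_neg by simp
  then show False using fix_roots[OF s] pos_uminus[OF simple_root_root[OF s]] pos_simple_root by simp
qed

lemma infinite_roots:
  assumes "infinite W" shows "infinite roots"
proof
  assume fin_roots: "finite roots"
  have "inj_on (\<lambda>w. restrict (act w) roots) W"
  proof (rule inj_onI)
    fix u w assume uw: "u \<in> W" "w \<in> W" "restrict (act u) roots = restrict (act w) roots"
    have "- u + w = 0"
    proof (rule act_faithful)
      show "- u + w \<in> W" using uw W_uminus word_group_add by blast
      fix s assume s: "s \<in> S"
      have "act (- u + w) (simple_root s) = act (- u) (act w (simple_root s))"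
        using act_add uw W_uminus by blast
      also have "act w (simple_root s) = act u (simple_root s)"
        using uw(3) simple_root_root[OF s] by (metis restrict_apply')
      finally show "act (- u + w) (simple_root s) = simple_root s" using uw by simp
    qed
    then show "u = w" by (metis add.inverse_inverse minus_unique)
  qed
  moreover have "(\<lambda>w. restrict (act w) roots) ` W \<subseteq> roots \<rightarrow>\<^sub>E roots"
    using root_act by auto
  moreover have "finite (roots \<rightarrow>\<^sub>E roots)" using fin_roots by (simp add: finite_PiE)
  ultimately show False using assms by (meson finite_imageD finite_subset)
qed

lemma root_support:
  assumes "b \<in> roots" "r \<notin> S" shows "b r = 0"
proof -
  have z: "foldr refl ws v r = 0" if "ws \<in> lists S" "v r = 0" for ws v
    using that by (induction ws rule: list.induct)
      (use assms(2) in \<open>auto simp: refl_def lincomb_def simple_root_def\<close>)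
  obtain ws s where ws: "ws \<in> lists S" "s \<in> S" "b = foldr refl ws (simple_root s)"
    using assms(1) act_sum_list by (force simp: roots_def word_group_def)
  have "simple_root s r = 0" using ws assms(2) by (auto simp: simple_root_def)
  then show ?thesis using z[of ws "simple_root s"] ws by simp
qed

text \<open>Fixed point argument on the Tits cone: the sum \<open>y\<close> of an orbit of a point inside the
  fundamental chamber is invariant under the finite subgroup, can be moved into the closed
  fundamental chamber, and there its stabilizer is a standard parabolic subgroup.\<close>

lemma finite_subgroup_parabolic:
  assumes F: "finite F" "F \<noteq> {}" "F \<subseteq> W" "\<And>f g. f \<in> F \<Longrightarrow> g \<in> F \<Longrightarrow> f + g \<in> F"
    and inf: "infinite W"
  shows "\<exists>w\<in>W. \<exists>J. J \<subset> S \<and> (\<forall>f\<in>F. - w + f + w \<in> word_group J)"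
proof -
  \<comment> \<open>Points of the Tits cone are linear functionals on the root space.
    \<open>ht\<close> is 1 on every simple root, hence inside the fundamental chamber;
    \<open>y\<close> is its orbit sum and \<open>Y w\<close> the translate of
    \<open>y\<close>.\<close>
  define ht where "ht v = (\<Sum>s\<in>S. v s)" for v :: "'a \<Rightarrow> real"
  define y where "y v = (\<Sum>f\<in>F. ht (act (- f) v))" for v
  define Y where "Y w v = y (act w v)" for w v
  have lin_ht: "ht (lincomb x u z v) = x * ht u + z * ht v" for x u z v
    by (simp add: ht_def lincomb_def sum.distrib sum_distrib_left)
  have lin_Y: "lin_fun (Y w)" for w
    unfolding lin_fun_def Y_def y_def
    by (simp add: lin_mapD[OF act_lin] lin_ht sum.distrib sum_distrib_left)
  have Y_lincomb: "Y w (lincomb x u z v) = x * Y w u + z * Y w v" for w x u z v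
    using lin_Y unfolding lin_fun_def by blast
  have Y_neg: "Y w (\<lambda>r. - v r) = - Y w v" for w v
    using Y_lincomb[of w "-1" v 0 v] by (simp add: lincomb_def)
  have ht_nonneg: "pos v \<Longrightarrow> ht v \<ge> 0" for v unfolding ht_def pos_def by (rule sum_nonneg) auto
  have inv: "y (act g v) = y v" if g: "g \<in> F" for g v
  proof -
    have "(\<lambda>f. g + f) ` F = F"
      by (rule endo_inj_surj) (use F g in \<open>auto intro: inj_onI\<close>)
    then have bij: "bij_betw (\<lambda>f. g + f) F F" by (auto simp: bij_betw_def intro: inj_onI)
    have "y (act g v) = (\<Sum>f\<in>F. ht (act (- (g + f)) (act g v)))"
      unfolding y_def by (rule sum.reindex_bij_betw[OF bij, symmetric])
    also have "\<dots> = y v"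
      unfolding y_def
    proof (rule sum.cong)
      fix f assume "f \<in> F"
      then have "f \<in> W" "g \<in> W" using F g by auto
      then have "act (- (g + f)) (act g v) = act (- f) (act (- g) (act g v))"
        using act_add[of "- f" "- g"] W_uminus by (simp only: minus_add)
      then show "ht (act (- (g + f)) (act g v)) = ht (act (- f) v)" using \<open>g \<in> W\<close> by simp
    qed simp
    finally show ?thesis .
  qed
  \<comment> \<open>The walls between the point \<open>Y w\<close> and the fundamental chamber.
    Minimizing their number moves the point into the closed chamber.\<close>
  define N where "N w = {b \<in> roots. pos b \<and> Y w b < 0}" for w
  have fN: "finite (N w)" if w: "w \<in> W" for w
  proof -
    have "N w \<subseteq> (\<Union>f\<in>F. {b \<in> roots. pos b \<noteq> pos (act (- f + w) b)})"
    proof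
      fix b assume b: "b \<in> N w"
      then have "(\<Sum>f\<in>F. ht (act (- f) (act w b))) < 0" by (simp add: N_def Y_def y_def)
      then have "\<not> (\<forall>f\<in>F. ht (act (- f) (act w b)) \<ge> 0)"
        using sum_nonneg[of F "\<lambda>f. ht (act (- f) (act w b))"] by fastforce
      then obtain f where f: "f \<in> F" "\<not> pos (act (- f) (act w b))" using ht_nonneg by blast
      then have "act (- f) (act w b) = act (- f + w) b" using act_add F w W_uminus by (metis subsetD)
      then show "b \<in> (\<Union>f\<in>F. {b \<in> roots. pos b \<noteq> pos (act (- f + w) b)})" using f b by (auto simp: N_def)
    qed
    moreover have "finite \<dots>" using F w W_uminus word_group_add by (intro finite_UN_I finite_flips) blast+
    ultimately show ?thesis by (rule finite_subset)
  qed
  obtain w where w: "w \<in> W" and min: "\<And>u. u \<in> W \<Longrightarrow> card (N w) \<le> card (N u)"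
    using ex_has_least_nat[of "\<lambda>x. x \<in> W" 0 "\<lambda>w. card (N w)"] by auto
  \<comment> \<open>If a simple root \<open>s\<close> were negative, passing to \<open>w + s\<close>
    would remove it from \<open>N w\<close> and merely permute the rest.\<close>
  have dom: "Y w (simple_root s) \<ge> 0" if s: "s \<in> S" for s
  proof (rule ccontr)
    assume neg: "\<not> ?thesis"
    have wsW: "w + s \<in> W" using w s word_group_add word_group_gen by blast
    have Yws: "Y (w + s) v = Y w (refl s v)" for v
      unfolding Y_def using act_add[OF w word_group_gen[OF s]] act_gen[OF s] by simp
    have "N (w + s) \<subseteq> refl s ` (N w - {simple_root s})"
    proof
      fix b assume "b \<in> N (w + s)"
      then have b: "b \<in> roots" "pos b" "Y w (refl s b) < 0" by (auto simp: N_def Yws)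
      have "b \<noteq> simple_root s" using b(3) neg Y_neg[of w "simple_root s"] refl_simple_root[OF s] by auto
      then have "pos (refl s b)" using refl_flips[OF s b(1,2)] by blast
      moreover have "refl s b \<noteq> simple_root s"
      proof
        assume "refl s b = simple_root s"
        then have "b = (\<lambda>r. - simple_root s r)" using refl_refl[OF s, of b] refl_simple_root[OF s] by simp
        then show False using b(2) pos_uminus[OF simple_root_root[OF s]] pos_simple_root by simp
      qed
      ultimately have "refl s b \<in> N w - {simple_root s}" using b refl_root[OF b(1) s] by (auto simp: N_def)
      moreover have "b = refl s (refl s b)" using refl_refl[OF s] by simp
      ultimately show "b \<in> refl s ` (N w - {simple_root s})" by blast
    qed
    then have "card (N (w + s)) \<le> card (N w - {simple_root s})"
      using fN[OF w] by (meson card_image_le card_mono finite_Diff finite_imageI order_trans)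
    also have "\<dots> < card (N w)"
      by (rule card_Diff1_less[OF fN[OF w]]) (use s neg simple_root_root pos_simple_root in \<open>auto simp: N_def\<close>)
    finally show False using min[OF wsW] by simp
  qed
  have expand: "Y w b = (\<Sum>s\<in>S. b s * Y w (simple_root s))" if "b \<in> roots" for b
    by (rule lin_fun_expand[OF lin_Y fin]) (use root_support that in blast)
  have pos_Y: "Y w b \<ge> 0" if "b \<in> roots" "pos b" for b
    unfolding expand[OF that(1)] using that(2) dom by (intro sum_nonneg mult_nonneg_nonneg) (auto simp: pos_def)
  define J where "J = {s \<in> S. Y w (simple_root s) = 0}"
  \<comment> \<open>For the first letter \<open>s\<close> of a reduced word for \<open>f\<close>,
    the inverse of \<open>f\<close> makes the root of \<open>s\<close> negative. Invariance then
    gives \<open>Y w\<close> a value at most 0 on that root, so it is 0, and \<open>s\<close> can be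
    stripped.\<close>
  have stab: "f \<in> word_group J" if "f \<in> W" "\<And>v. Y w (act f v) = Y w v" for f
    using that
  proof (induction "len f" arbitrary: f rule: less_induct)
    case less
    show ?case
    proof (cases "f = 0")
      case False
      obtain ws where ws: "reduced_word S ws" "sum_list ws = f" using word_len_exists[OF less.prems(1)] by blast
      then obtain s x where sx: "ws = s # x" using False by (cases ws) auto
      define g where "g = sum_list x"
      have s: "s \<in> S" and rx: "reduced_word S x" using ws sx reduced_ConsD by blast+
      have g: "g \<in> W" using rx word_group_sum_list by (auto simp: reduced_word_def g_def)
      have fg: "f = s + g" using ws sx by (simp add: g_def)
      have l: "len f = Suc (len g)" using ws sx rx by (simp add: reduced_word_def g_def)
      have gs: "- g + s = - f" using fg s by (simp add: minus_add uminus_gen)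
      have "len (- g + s) = Suc (len (- g))" using l gs len_uminus g less.prems(1) by simp
      then have p: "pos (act (- g) (simple_root s))" using act_pos W_uminus[OF g] s by blast
      have "act (- f) (simple_root s) = act (- g) (refl s (simple_root s))"
        using act_add[OF W_uminus[OF g] word_group_gen[OF s]] act_gen[OF s] gs by simp
      also have "\<dots> = (\<lambda>r. - act (- g) (simple_root s) r)" using refl_simple_root[OF s] act_neg by simp
      finally have "Y w (act (- f) (simple_root s)) = - Y w (act (- g) (simple_root s))" using Y_neg by simp
      also have "\<dots> \<le> 0" using pos_Y[OF root_act[OF simple_root_root[OF s] W_uminus[OF g]] p] by simp
      finally have "Y w (act (- f) (simple_root s)) \<le> 0" .
      moreover have "Y w (act (- f) (simple_root s)) = Y w (simple_root s)"
        using less.prems(2)[of "act (- f) (simple_root s)"] less.prems(1) by simp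
      ultimately have Y0: "Y w (simple_root s) = 0" using dom[OF s] by simp
      have Ys: "Y w (refl s v) = Y w v" for v
        unfolding refl_def Y_lincomb using Y0 by simp
      have "Y w (act g v) = Y w v" for v
        using Ys[of "act g v"] less.prems(2)[of v] act_step[OF s g] fg by simp
      then have "g \<in> word_group J" using less.hyps[of g] l g by simp
      moreover have "s \<in> J" using s Y0 by (simp add: J_def)
      ultimately show ?thesis using fg word_group_add word_group_gen by blast
    qed simp
  qed
  have conj: "- w + f + w \<in> word_group J" if f: "f \<in> F" for f
  proof (rule stab)
    have fW: "f \<in> W" using f F by blast
    show "- w + f + w \<in> W" by (intro word_group_add W_uminus w fW)
    fix v
    have "act (- w + f + w) v = act (- w) (act f (act w v))"
      using act_add[OF word_group_add[OF W_uminus[OF w] fW] w] act_add[OF W_uminus[OF w] fW] by simp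
    then show "Y w (act (- w + f + w) v) = Y w v"
      unfolding Y_def using w inv[OF f] by simp
  qed
  \<comment> \<open>Otherwise the invariant functional vanishes on all roots. But \<open>F\<close>
    flips only finitely many roots, so some positive root stays positive under all of
    \<open>F\<close>, and \<open>y\<close> is positive there.\<close>
  have "J \<noteq> S"
  proof
    assume "J = S"
    then have Y0: "Y w b = 0" if "b \<in> roots" for b
      using expand[OF that] by (auto simp: J_def intro!: sum.neutral)
    define P where "P = {b \<in> roots. pos b}"
    have "roots \<subseteq> P \<union> (\<lambda>b r. - b r) ` P"
    proof
      fix b assume b: "b \<in> roots"
      show "b \<in> P \<union> (\<lambda>b r. - b r) ` P"
      proof (cases "pos b")
        case False
        then have "(\<lambda>r. - b r) \<in> P" using root_uminus[OF b] pos_uminus[OF b] by (simp add: P_def)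
        then show ?thesis by (intro UnI2 image_eqI[of _ _ "\<lambda>r. - b r"]) auto
      qed (use b in \<open>simp add: P_def\<close>)
    qed
    then have "infinite P" using infinite_roots[OF inf] finite_subset by (metis finite_Un finite_imageI)
    moreover have "finite (\<Union>f\<in>F. {b \<in> roots. pos b \<noteq> pos (act (- f) b)})"
      using F W_uminus by (intro finite_UN_I finite_flips) blast+
    ultimately obtain b where b: "b \<in> P" "b \<notin> (\<Union>f\<in>F. {b \<in> roots. pos b \<noteq> pos (act (- f) b)})"
      by (meson finite_subset subsetI)
    have "ht (act (- f) b) > 0" if f: "f \<in> F" for f
    proof -
      let ?b = "act (- f) b"
      have r: "?b \<in> roots" using b f F root_act W_uminus by (auto simp: P_def)
      have p: "pos ?b" using b f by (auto simp: P_def)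
      have "ht ?b \<noteq> 0"
      proof
        assume "ht ?b = 0"
        then have "\<forall>s\<in>S. ?b s = 0"
          using p fin by (subst (asm) ht_def, subst (asm) sum_nonneg_eq_0_iff) (auto simp: pos_def)
        then have "form ?b ?b = 0" by (simp add: form_def)
        then show False using form_root[OF r] by simp
      qed
      then show ?thesis using ht_nonneg[OF p] by simp
    qed
    then have "y b > 0" unfolding y_def using F by (intro sum_pos) auto
    moreover have "y b = Y w (act (- w) b)" using w by (simp add: Y_def)
    ultimately show False using Y0[of "act (- w) b"] b root_act W_uminus w by (auto simp: P_def)
  qed
  then have "J \<subset> S" by (auto simp: J_def)
  then show ?thesis using w conj by blast
qed

text \<open>The difference of the two roots lies in the radical of the form, so the product of the
  reflections is unipotent: its n-th power moves \<open>b\<close> by 2 n (b - b').\<close>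

lemma same_pairings_infinite_order:
  assumes b: "root_refl b t" "root_refl b' t'" "b \<noteq> b'"
    and same: "\<And>s. s \<in> S \<Longrightarrow> pairing s b = pairing s b'" and n: "n > 0"
  shows "nmul n (t + t') \<noteq> 0"
proof
  assume zero: "nmul n (t + t') = 0"
  have tW: "t \<in> W" "t' \<in> W" using b root_refl_reflection reflections_W by blast+
  have feq: "form v b = form v b'" for v unfolding form_def using same by simp
  have one: "form b b = 1" "form b' b = 1" "form b b' = 1" "form b' b' = 1"
    using form_root root_refl_root b feq by metis+
  have step: "act (t + t') v = (\<lambda>r. v r + 2 * form v b * (b r - b' r))" for v
  proof -
    have "act (t + t') v = act t (lincomb 1 v (- 2 * form v b') b')"
      using act_add[OF tW] act_root_refl[OF b(2)] by simp
    also have "\<dots> = lincomb 1 (lincomb 1 v (- 2 * form v b') b') (2 * form v b) b"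
      using act_root_refl[OF b(1)] one feq by (simp add: form_lincomb1)
    finally show ?thesis using feq[of v] by (simp add: lincomb_def algebra_simps)
  qed
  have "act (nmul n (t + t')) b = (\<lambda>r. b r + 2 * real n * (b r - b' r))" for n
  proof (induction n)
    case 0 then show ?case by simp
  next
    case (Suc n)
    let ?v = "\<lambda>r. b r + 2 * real n * (b r - b' r)"
    have "nmul n (t + t') \<in> W" by (induction n) (use word_group_add[OF word_group_add[OF tW]] in auto)
    then have "act (nmul (Suc n) (t + t')) b = act (t + t') ?v"
      using act_add[of "t + t'"] tW word_group_add Suc by (metis nmul.simps(2))
    also have "?v = lincomb 1 b (2 * real n) (lincomb 1 b (-1) b')" by (simp add: lincomb_def)
    then have "form ?v b = 1" using one by (simp add: form_lincomb1)
    then have "act (t + t') ?v = (\<lambda>r. ?v r + 2 * (b r - b' r))" using step[of ?v] by simp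
    finally show ?case by (simp add: algebra_simps)
  qed
  from this[of n] have "b = (\<lambda>r. b r + 2 * real n * (b r - b' r))" using zero by simp
  then have "\<forall>r. 2 * real n * (b r - b' r) = 0" by (metis add_cancel_right_right)
  then show False using n b(3) by (auto simp: fun_eq_iff)
qed

text \<open>If all products of two reflections have finite order, then up to conjugation every pair of
  a simple root and a root lies in one of the finitely many finite parabolic subgroups, so the
  form takes finitely many values on such pairs.\<close>

lemma infinite_dihedral_step:
  assumes inf: "infinite W" and par: "\<And>J. J \<subset> S \<Longrightarrow> finite (word_group J)"
  shows "\<exists>t\<in>reflections S. \<exists>t'\<in>reflections S. \<forall>n>0. nmul n (t + t') \<noteq> 0"
proof (rule ccontr)
  assume "\<not> ?thesis"
  then have ord: "\<exists>n>0. nmul n (t + t') = 0" if "t \<in> reflections S" "t' \<in> reflections S" for t t'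
    using that by blast
  define P where "P = \<Union> (word_group ` {J. J \<subset> S})"
  have "finite {J. J \<subset> S}" by (rule finite_subset[of _ "Pow S"]) (use fin in auto)
  then have fP: "finite P" unfolding P_def using par by blast
  \<comment> \<open>Roots whose reflection lies in a proper standard parabolic subgroup: finitely
    many, as a reflection has at most two roots.\<close>
  define G where "G = {b. \<exists>p\<in>P. root_refl b p}"
  have "finite G"
  proof -
    have "finite {b. root_refl b p}" for p
    proof (cases "\<exists>b. root_refl b p")
      case True
      then obtain b where "root_refl b p" by blast
      then have "{b. root_refl b p} \<subseteq> {b, (\<lambda>r. - b r)}" using root_refl_unique by blast
      then show ?thesis by (rule finite_subset) simp
    qed simp
    moreover have "G = (\<Union>p\<in>P. {b. root_refl b p})" by (auto simp: G_def)
    ultimately show ?thesis using fP by simp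
  qed
  define V where "V = (\<lambda>(b, b'). form b b') ` (G \<times> G)"
  have fV: "finite V" using \<open>finite G\<close> by (simp add: V_def)
  have val: "pairing s b \<in> V" if s: "s \<in> S" and b: "b \<in> roots" for s b
  proof -
    obtain t where t: "root_refl b t" using root_refl_exists[OF b] by blast
    have sr: "root_refl (simple_root s) s" unfolding root_refl_def using s by (intro bexI[of _ 0] bexI[of _ s]) auto
    have st: "s \<in> reflections S" "t \<in> reflections S" using sr t root_refl_reflection by blast+
    obtain n where "n > 0" "nmul n (s + t) = 0" using ord[OF st] by blast
    then have fF: "finite (word_group {s, t})" using finite_dihedral reflections_invol st by blast
    have FW: "word_group {s, t} \<subseteq> W"
    proof
      fix x assume "x \<in> word_group {s, t}"
      then show "x \<in> W"
        by (induction rule: word_group_mem_induct) (use reflections_W[OF st(1)] reflections_W[OF st(2)] word_group_add in auto)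
    qed
    obtain w J where w: "w \<in> W" "J \<subset> S" "\<And>f. f \<in> word_group {s, t} \<Longrightarrow> - w + f + w \<in> word_group J"
      using finite_subgroup_parabolic[OF fF _ FW _ inf] word_group_add[of _ "{s, t}"] word_group_zero[of "{s, t}"]
      by (metis empty_iff)
    have g: "act (- w) c \<in> G" if "root_refl c p" "p \<in> {s, t}" for c p
    proof -
      have "root_refl (act (- w) c) (- w + p + w)"
        using root_refl_conj[OF that(1) W_uminus[OF w(1)]] by simp
      moreover have "- w + p + w \<in> P" using w that word_group_gen[of p "{s, t}"] by (auto simp: P_def)
      ultimately show ?thesis by (auto simp: G_def)
    qed
    have "pairing s b = form (act (- w) (simple_root s)) (act (- w) b)"
      using form_act[OF W_uminus[OF w(1)]] form_simple_root[OF s] by simp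
    then show ?thesis using g[OF sr] g[OF t] by (force simp: V_def)
  qed
  \<comment> \<open>Pigeonhole: infinitely many roots, but finitely many possible vectors of
    pairings with the simple roots.\<close>
  let ?f = "\<lambda>b. restrict (\<lambda>s. pairing s b) S"
  have "?f ` roots \<subseteq> S \<rightarrow>\<^sub>E V" using val by auto
  moreover have "finite (S \<rightarrow>\<^sub>E V)" using fV fin by (simp add: finite_PiE)
  ultimately have "\<not> inj_on ?f roots" using infinite_roots[OF inf] by (meson finite_imageD finite_subset)
  then obtain b b' where b: "b \<in> roots" "b' \<in> roots" "b \<noteq> b'" "?f b = ?f b'" by (auto simp: inj_on_def)
  obtain t t' where t: "root_refl b t" "root_refl b' t'" using root_refl_exists b by blast
  obtain n where "n > 0" "nmul n (t + t') = 0" using ord t root_refl_reflection by blast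
  moreover have "pairing s b = pairing s b'" if "s \<in> S" for s using b(4) that by (metis restrict_apply')
  ultimately show False using same_pairings_infinite_order[OF t b(3)] by blast
qed

end

text \<open>Descends to a minimal subset generating an infinite group, where all proper standard
  parabolic subgroups are finite.\<close>

lemma infinite_dihedral:
  assumes "coxeter_group S" "infinite (word_group S)"
  shows "\<exists>t\<in>reflections S. \<exists>t'\<in>reflections S. \<forall>n>0. nmul n (t + t') \<noteq> 0"
proof -
  have "finite S" using assms(1) by (rule coxeter_group.fin)
  then show ?thesis using assms
  proof (induction S rule: finite_psubset_induct)
    case (psubset S)
    show ?case
    proof (cases "\<exists>J. J \<subset> S \<and> infinite (word_group J)")
      case True
      then obtain J where J: "J \<subset> S" "infinite (word_group J)" by blast
      have "coxeter_group J" using coxeter_group.parabolic(1)[OF psubset.prems(1)] J by blast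
      then show ?thesis using psubset.IH[OF J(1)] J reflections_mono[of J S] by blast
    next
      case False
      then show ?thesis using coxeter_group.infinite_dihedral_step[OF psubset.prems(1,2)] by blast
    qed
  qed
qed

section \<open>Walls separating the ends of a line\<close>

definition zmul :: "int \<Rightarrow> 'a::group_add \<Rightarrow> 'a" where
  "zmul j x = (if j \<ge> 0 then nmul (nat j) x else - nmul (nat (- j)) x)"

lemma zmul_0 [simp]: "zmul 0 x = 0"
  by (simp add: zmul_def)

lemma zmul_of_nat [simp]: "zmul (int n) x = nmul n x"
  by (simp add: zmul_def)

lemma zmul_Suc: "zmul (j + 1) x = x + zmul j x"
proof (cases "j \<ge> 0")
  case True
  then have "nat (j + 1) = Suc (nat j)" by simp
  then show ?thesis using True by (simp add: zmul_def)
next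
  case False
  then obtain n where n: "j = - int (Suc n)" using int_cases[of j] by (metis of_nat_0_le_iff)
  have "- nmul n x = x + - (nmul n x + x)" by (simp only: minus_add add_minus_cancel)
  then have "- nmul n x = x + - nmul (Suc n) x" by (simp add: nmul_commute)
  moreover have "zmul (j + 1) x = - nmul n x"
  proof -
    have "j + 1 = - int n" using n by simp
    then show ?thesis by (auto simp: zmul_def)
  qed
  moreover have "zmul j x = - nmul (Suc n) x" using n by (simp add: zmul_def nat_add_distrib)
  ultimately show ?thesis by simp
qed

lemma zmul_pred: "zmul (j - 1) x = - x + zmul j x"
  using zmul_Suc[of "j - 1" x] by (simp flip: add.assoc)

lemma zmul_add: "zmul (i + j) x = zmul i x + zmul j x"
proof (induction i rule: int_induct[where k = 0])
  case (step1 i)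
  have "i + 1 + j = (i + j) + 1" by simp
  then show ?case using step1 zmul_Suc[of "i + j" x] zmul_Suc[of i x] by (simp only: add.assoc)
next
  case (step2 i)
  have "i - 1 + j = (i + j) - 1" by simp
  then show ?case using step2 zmul_pred[of "i + j" x] zmul_pred[of i x] by (simp only: add.assoc)
qed simp

lemma zmul_minus: "zmul (- j) x = - zmul j x"
  by (rule minus_unique[symmetric]) (simp flip: zmul_add)

lemma nmul_conj: "nmul n (g + x - g) = g + nmul n x - (g :: 'a::group_add)"
proof (induction n)
  case (Suc n)
  have "nmul (Suc n) (g + x - g) = (g + x - g) + (g + nmul n x - g)" using Suc by simp
  also have "\<dots> = g + (x + nmul n x) - g"
    by (simp only: diff_conv_add_uminus add.assoc minus_add_cancel)
  finally show ?case by simp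
qed simp

lemma zmul_conj: "zmul j (g + x - g) = g + zmul j x - g"
proof (cases "j \<ge> 0")
  case False
  have "- (g + nmul n x - g) = g + - nmul n x - g" for n
    by (simp only: diff_conv_add_uminus minus_add minus_minus add.assoc)
  then show ?thesis using False by (simp add: zmul_def nmul_conj)
qed (simp add: zmul_def nmul_conj)

lemma zmul_mult: "zmul (int m * j) x = zmul j (nmul m x)"
proof (induction j rule: int_induct[where k = 0])
  case (step1 i)
  have "int m * (i + 1) = int m + int m * i" by (simp add: algebra_simps)
  then show ?case using step1 by (simp only: zmul_add[of "int m"] zmul_Suc zmul_of_nat)
next
  case (step2 i)
  have "zmul (int m * (i - 1)) x = zmul (- int m + int m * i) x" by (simp add: algebra_simps)
  then show ?case using step2 by (simp only: zmul_pred zmul_add zmul_minus zmul_of_nat)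
qed simp

lemma finite_int_bound:
  assumes "finite (X :: int set)" shows "\<exists>J::nat. \<forall>j\<ge>J. int j \<notin> X \<and> - int j \<notin> X"
proof -
  have "finite (abs ` X)" using assms by simp
  then obtain B where B: "\<forall>x\<in>abs ` X. x \<le> B" by (meson bdd_above_finite bdd_above_def)
  have "\<forall>j\<ge>nat B + 1. int j \<notin> X \<and> - int j \<notin> X"
  proof (intro allI impI)
    fix j assume "j \<ge> nat B + 1"
    then have "int j > B" by linarith
    then show "int j \<notin> X \<and> - int j \<notin> X" using B by force
  qed
  then show ?thesis by blast
qed

lemma sign_change: "\<not> P 0 \<Longrightarrow> P n \<Longrightarrow> \<exists>i<n. \<not> P i \<and> P (Suc i)"
  by (induction n) (auto simp: less_Suc_eq)

definition virtual_centralizer :: "'a::group_add set \<Rightarrow> 'a \<Rightarrow> 'a set" where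
  "virtual_centralizer S c = {y \<in> word_group S. \<exists>m>0. y + nmul m c = nmul m c + y}"

context coxeter_group
begin

lemma zmul_W:
  assumes "c \<in> W" shows "zmul j c \<in> W"
proof -
  have "nmul n c \<in> W" for n by (induction n) (use assms word_group_add in auto)
  then show ?thesis using W_uminus by (simp add: zmul_def)
qed

lemma act_zmul_add:
  assumes "c \<in> W" shows "act (zmul (i + j) c) b = act (zmul i c) (act (zmul j c) b)"
  unfolding zmul_add using act_add zmul_W[OF assms] by blast

lemma zmul_period:
  assumes "c \<in> W" "act (zmul d c) b = b" shows "act (zmul (int k * d) c) b = b"
proof (induction k)
  case (Suc k)
  have "int (Suc k) * d = d + int k * d" by (simp add: algebra_simps)
  then show ?case using act_zmul_add[OF assms(1)] Suc assms(2) by simp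
qed simp

text \<open>The roots whose half-space contains one end of the line \<open>c\<^sup>j\<close> but not the other.\<close>

definition skewered :: "'a \<Rightarrow> ('a \<Rightarrow> real) set" where
  "skewered c = {b \<in> roots. \<exists>J::nat. \<forall>j\<ge>J. pos (act (zmul (int j) c) b) \<and> \<not> pos (act (zmul (- int j) c) b)}"

text \<open>A root fixed by a nonzero power of \<open>c\<close> would have the same sign far out in
  both directions.\<close>

lemma skewered_inj:
  assumes c: "c \<in> W" and b: "b \<in> skewered c"
  shows "inj (\<lambda>j. act (zmul j c) b)"
proof -
  have False if eq: "act (zmul i c) b = act (zmul j c) b" and ij: "i < j" for i j
  proof -
    define d where "d = j - i"
    have "act (zmul (- i + i) c) b = act (zmul (- i + j) c) b"
      using eq by (simp only: act_zmul_add[OF c])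
    then have per: "act (zmul d c) b = b" by (simp add: d_def)
    obtain J :: nat where J: "\<And>j. j \<ge> J \<Longrightarrow> pos (act (zmul (int j) c) b) \<and> \<not> pos (act (zmul (- int j) c) b)"
      using b by (auto simp: skewered_def)
    \<comment> \<open>A multiple of the period \<open>d\<close> that lies beyond the threshold
      \<open>J\<close>.\<close>
    define k where "k = J * nat d"
    have k: "int k = int J * d" "k \<ge> J" using ij by (auto simp: k_def d_def)
    have "act (zmul (int k) c) b = b" using zmul_period[OF c per] k by simp
    moreover from this have "act (zmul (- int k) c) b = b"
      using act_zmul_add[OF c, of "- int k" "int k" b] by simp
    ultimately show False using J[OF k(2)] by auto
  qed
  then show ?thesis by (metis (no_types, lifting) injI linorder_cases)
qed

text \<open>Since \<open>y\<close> commutes with a power of \<open>c\<close>, its conjugates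
  \<open>u j\<close> by powers of \<open>c\<close> form a finite set and flip only finitely many
  roots. The roots c^j b are distinct, so for large |j| the roots c^j y b = u_j c^j b and c^j b have
  the same sign.\<close>

lemma virtual_centralizer_skewered:
  assumes c: "c \<in> W" and y: "y \<in> virtual_centralizer S c" and b: "b \<in> skewered c"
  shows "act y b \<in> skewered c"
proof -
  obtain m where m: "m > 0" "y + nmul m c = nmul m c + y" and yW: "y \<in> W"
    using y by (auto simp: virtual_centralizer_def)
  define u where "u j = zmul j c + y - zmul j c" for j
  have u_per: "u (i + int m * j) = u i" for i j
  proof -
    have "y + nmul m c - y = nmul m c" using m(2) by (simp only: diff_eq_eq)
    then have "y + zmul j (nmul m c) - y = zmul j (nmul m c)" using zmul_conj[of j y "nmul m c"] by simp
    then have "zmul (int m * j) c + y = y + zmul (int m * j) c" by (simp add: zmul_mult diff_eq_eq)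
    then have "zmul (int m * j) c + y - zmul (int m * j) c = y" by (simp add: diff_eq_eq)
    moreover have "u (i + int m * j) = zmul i c + (zmul (int m * j) c + y - zmul (int m * j) c) - zmul i c"
      unfolding u_def zmul_add diff_conv_add_uminus minus_add by (simp only: add.assoc)
    ultimately show ?thesis by (simp only: u_def)
  qed
  have "u j \<in> u ` {0..<int m}" for j
  proof -
    have "u j = u (j mod int m + int m * (j div int m))" by simp
    also have "\<dots> = u (j mod int m)" by (rule u_per)
    finally show ?thesis using m(1) by auto
  qed
  moreover have uW: "u j \<in> W" for j
    unfolding u_def diff_conv_add_uminus by (intro word_group_add W_uminus zmul_W c yW)
  ultimately have range_u: "range u \<subseteq> u ` {0..<int m}" by blast
  have "finite (range u)" by (rule finite_subset[OF range_u]) simp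
  define X where "X = (\<Union>x\<in>range u. {b \<in> roots. pos b \<noteq> pos (act x b)})"
  have "finite X" unfolding X_def
    by (rule finite_UN_I[OF \<open>finite (range u)\<close>]) (use uW finite_flips in blast)
  then have "finite ((\<lambda>j. act (zmul j c) b) -` X)"
    by (rule finite_vimageI) (rule skewered_inj[OF c b])
  then obtain J where J: "\<And>j. j \<ge> J \<Longrightarrow> act (zmul (int j) c) b \<notin> X \<and> act (zmul (- int j) c) b \<notin> X"
    using finite_int_bound by fastforce
  obtain J' where J': "\<And>j. j \<ge> J' \<Longrightarrow> pos (act (zmul (int j) c) b) \<and> \<not> pos (act (zmul (- int j) c) b)"
    using b by (auto simp: skewered_def)
  have br: "b \<in> roots" using b by (simp add: skewered_def)
  have eq: "pos (act (zmul j c) (act y b)) = pos (act (zmul j c) b)" if "act (zmul j c) b \<notin> X" for j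
  proof -
    have "act (zmul j c) (act y b) = act (zmul j c + y) b" using act_add zmul_W c yW by simp
    also have "zmul j c + y = u j + zmul j c" by (simp add: u_def)
    also have "act (u j + zmul j c) b = act (u j) (act (zmul j c) b)" using act_add zmul_W c uW by simp
    finally show ?thesis using that root_act[OF br zmul_W[OF c]] by (auto simp: X_def)
  qed
  have "\<forall>j\<ge>max J J'. pos (act (zmul (int j) c) (act y b)) \<and> \<not> pos (act (zmul (- int j) c) (act y b))"
  proof (intro allI impI)
    fix j assume "j \<ge> max J J'"
    then show "pos (act (zmul (int j) c) (act y b)) \<and> \<not> pos (act (zmul (- int j) c) (act y b))"
      using eq[of "int j"] eq[of "- int j"] J[of j] J'[of j] by simp
  qed
  then show ?thesis unfolding skewered_def using root_act[OF br yW] by blast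
qed

lemma virtual_centralizer_uminus:
  assumes "y \<in> virtual_centralizer S c" shows "- y \<in> virtual_centralizer S c"
proof -
  obtain m where m: "m > 0" "y + nmul m c = nmul m c + y" "y \<in> W"
    using assms by (auto simp: virtual_centralizer_def)
  have "- y + nmul m c = - y + (nmul m c + y) - y" by (simp add: add_diff_eq[symmetric])
  also have "\<dots> = nmul m c - y" by (simp flip: m(2))
  finally show ?thesis using m W_uminus by (auto simp: virtual_centralizer_def)
qed

lemma zmul_virtual_centralizer: "c \<in> W \<Longrightarrow> zmul j c \<in> virtual_centralizer S c"
  using zmul_W[of c j] zmul_add[of j 1 c] zmul_add[of 1 j c] zmul_of_nat[of 1 c]
  unfolding virtual_centralizer_def by (auto intro!: exI[of _ 1] simp: add.commute)

text \<open>The direction, 1 or -1, in which the way from the base chamber to its image under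
  \<open>w\<close> crosses the wall of \<open>b\<close>; 0 if it does not.\<close>

definition crossing :: "'a \<Rightarrow> ('a \<Rightarrow> real) \<Rightarrow> int" where
  "crossing w b = of_bool (pos b) - of_bool (pos (act (- w) b))"

text \<open>Cut down to the nonzero terms, because \<open>skewered c\<close> is infinite unless
  empty and an infinite sum has the default value 0.\<close>

definition crossings :: "'a \<Rightarrow> 'a \<Rightarrow> int" where
  "crossings c w = (\<Sum>b\<in>{b \<in> skewered c. crossing w b \<noteq> 0}. crossing w b)"

lemma finite_crossing:
  assumes "w \<in> W" shows "finite {b \<in> skewered c. crossing w b \<noteq> 0}"
  by (rule finite_subset[OF _ finite_flips[OF W_uminus[OF assms]]])
    (auto simp: skewered_def crossing_def of_bool_def split: if_splits)

lemma crossings_eq: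
  assumes "finite A" "A \<subseteq> skewered c" "{b \<in> skewered c. crossing w b \<noteq> 0} \<subseteq> A"
  shows "crossings c w = (\<Sum>b\<in>A. crossing w b)"
  unfolding crossings_def by (rule sum.mono_neutral_left) (use assms in auto)

text \<open>\<open>crossing\<close> satisfies a cocycle identity in which the term of
  \<open>w\<close> is pulled back by \<open>y\<close>. Only \<open>y\<close> has to permute
  \<open>skewered c\<close>, so \<open>w\<close> may be any element.\<close>

lemma crossings_add:
  assumes c: "c \<in> W" and y: "y \<in> virtual_centralizer S c" and w: "w \<in> W"
  shows "crossings c (y + w) = crossings c y + crossings c w"
proof -
  have yW: "y \<in> W" using y by (simp add: virtual_centralizer_def)
  let ?s = "\<lambda>w. {b \<in> skewered c. crossing w b \<noteq> 0}"
  have stab: "act y b \<in> skewered c" "act (- y) b \<in> skewered c" if "b \<in> skewered c" for b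
    using virtual_centralizer_skewered[OF c _ that] y virtual_centralizer_uminus[OF y] by auto
  \<comment> \<open>A common finite index set that carries all three sums.\<close>
  define A where "A = ?s y \<union> act y ` ?s w \<union> ?s (y + w)"
  have A: "finite A" "A \<subseteq> skewered c"
    using finite_crossing yW w word_group_add[OF yW w] stab by (auto simp: A_def)
  have inj: "inj_on (act (- y)) A"
    by (rule inj_on_inverseI[of _ "act y"]) (use yW in simp)
  have cross: "crossing (y + w) b = crossing y b + crossing w (act (- y) b)" for b
  proof -
    have "act (- (y + w)) b = act (- w) (act (- y) b)"
      using act_add[OF W_uminus[OF w] W_uminus[OF yW]] by (simp only: minus_add)
    then show ?thesis by (simp add: crossing_def)
  qed
  have "crossings c (y + w) = (\<Sum>b\<in>A. crossing (y + w) b)"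
    by (rule crossings_eq) (use A in \<open>auto simp: A_def\<close>)
  also have "\<dots> = (\<Sum>b\<in>A. crossing y b) + (\<Sum>b\<in>A. crossing w (act (- y) b))"
    by (simp add: cross sum.distrib)
  also have "(\<Sum>b\<in>A. crossing y b) = crossings c y"
    by (rule crossings_eq[symmetric]) (use A in \<open>auto simp: A_def\<close>)
  also have "(\<Sum>b\<in>A. crossing w (act (- y) b)) = (\<Sum>b\<in>act (- y) ` A. crossing w b)"
    using sum.reindex[OF inj, of "crossing w"] by (simp add: o_def)
  also have "\<dots> = crossings c w"
  proof (rule crossings_eq[symmetric])
    show "finite (act (- y) ` A)" using A by simp
    show "act (- y) ` A \<subseteq> skewered c" using A stab by auto
    show "?s w \<subseteq> act (- y) ` A"
    proof
      fix b assume "b \<in> ?s w"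
      then have "act y b \<in> A" by (auto simp: A_def)
      moreover have "b = act (- y) (act y b)" using yW by simp
      ultimately show "b \<in> act (- y) ` A" by blast
    qed
  qed
  finally show ?thesis .
qed

lemma crossings_nmul:
  assumes c: "c \<in> W" shows "crossings c (nmul k c) = int k * crossings c c"
proof (induction k)
  case 0
  have "crossings c (0 + 0) = crossings c 0 + crossings c 0"
    using crossings_add[OF c _ word_group_zero] zmul_virtual_centralizer[OF c, of 0] by simp
  then show ?case by simp
next
  case (Suc k)
  have "c \<in> virtual_centralizer S c" using zmul_virtual_centralizer[OF c, of 1] zmul_of_nat[of 1 c] by simp
  then show ?case
    using crossings_add[OF c _ zmul_W[OF c, of "int k"]] Suc by (simp add: algebra_simps)
qed

text \<open>A sufficiently high power of \<open>c\<close> crosses no wall of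
  \<open>skewered c\<close> backwards and crosses at least one forwards; additivity carries this
  back to \<open>c\<close>.\<close>

lemma crossings_nonzero:
  assumes c: "c \<in> W" and ne: "skewered c \<noteq> {}"
  shows "crossings c c \<noteq> 0"
proof -
  \<comment> \<open>Every sign change along an orbit c^j b happens at one of these finitely many
    roots, so one threshold \<open>J\<close> serves all orbits.\<close>
  define E where "E = {b \<in> skewered c. crossing c b \<noteq> 0}"
  have fE: "finite E" unfolding E_def by (rule finite_crossing[OF c])
  have zstab: "act (zmul j c) b \<in> skewered c" if "b \<in> skewered c" for b j
    using virtual_centralizer_skewered[OF c zmul_virtual_centralizer[OF c] that] .
  have minus1: "act (- c) (act (zmul j c) b) = act (zmul (j - 1) c) b" for j b
    using act_zmul_add[OF c, of "- 1" j b] zmul_minus[of 1 c] zmul_of_nat[of 1 c] by (simp add: algebra_simps)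
  have "\<exists>J. \<forall>e\<in>E. \<forall>j\<ge>J. pos (act (zmul (int j) c) e) \<and> \<not> pos (act (zmul (- int j) c) e)"
  proof -
    have "\<forall>e\<in>E. \<exists>J. \<forall>j\<ge>J. pos (act (zmul (int j) c) e) \<and> \<not> pos (act (zmul (- int j) c) e)"
      by (auto simp: E_def skewered_def)
    then obtain f where f: "\<And>e j. e \<in> E \<Longrightarrow> j \<ge> f e \<Longrightarrow> pos (act (zmul (int j) c) e) \<and> \<not> pos (act (zmul (- int j) c) e)"
      by metis
    have "f e \<le> sum f E" if "e \<in> E" for e using that fE by (simp add: member_le_sum)
    then show ?thesis using f by (meson order_trans)
  qed
  then obtain J where J: "\<And>e j. e \<in> E \<Longrightarrow> j \<ge> J \<Longrightarrow> pos (act (zmul (int j) c) e)"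
    "\<And>e j. e \<in> E \<Longrightarrow> j \<ge> J \<Longrightarrow> \<not> pos (act (zmul (- int j) c) e)" by blast
  obtain e where e: "e \<in> E"
  proof -
    obtain b where b: "b \<in> skewered c" using ne by blast
    then obtain K where K: "pos (act (zmul (int K) c) b)" "\<not> pos (act (zmul (- int K) c) b)"
      by (auto simp: skewered_def)
    obtain i where i: "\<not> pos (act (zmul (int i - int K) c) b)" "pos (act (zmul (int (Suc i) - int K) c) b)"
      using sign_change[of "\<lambda>i. pos (act (zmul (int i - int K) c) b)" "2 * K"] K by auto
    have "act (zmul (int (Suc i) - int K) c) b \<in> E"
      using i zstab[OF b] minus1[of "int (Suc i) - int K" b] by (simp add: E_def crossing_def)
    then show thesis by (rule that)
  qed
  \<comment> \<open>With the factor 2, a backward crossing is impossible: the sign change would lie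
    fewer than \<open>J\<close> steps from each end of a segment of length 2 J.\<close>
  define k where "k = 2 * J"
  let ?k = "nmul k c"
  have act_k: "act (- ?k) b = act (zmul (- int k) c) b" for b by (simp add: zmul_minus)
  have nonneg: "crossing ?k b \<ge> 0" if b: "b \<in> skewered c" for b
  proof (rule ccontr)
    assume "\<not> ?thesis"
    then have p: "\<not> pos b" "pos (act (zmul (- int k) c) b)"
      unfolding crossing_def act_k by (auto simp: of_bool_def split: if_splits)
    obtain i where i: "i < k" "\<not> pos (act (zmul (- int i) c) b)" "pos (act (zmul (- int (Suc i)) c) b)"
      using sign_change[of "\<lambda>i. pos (act (zmul (- int i) c) b)" k] p by auto
    let ?e = "act (zmul (- int i) c) b"
    have "- int (Suc i) = - int i - 1" by simp
    then have "pos (act (zmul (- int i - 1) c) b)" using i(3) by (simp only:)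
    then have "?e \<in> E" using i(2) zstab[OF b] minus1[of "- int i" b] by (simp add: E_def crossing_def)
    have "act (zmul (int i) c) ?e = b" using act_zmul_add[OF c, of "int i" "- int i" b] by simp
    then have "i < J" using J(1)[OF \<open>?e \<in> E\<close>, of i] p by force
    have "act (zmul (- int (k - i)) c) ?e = act (zmul (- int k) c) b"
      using act_zmul_add[OF c, of "- int (k - i)" "- int i" b] i(1) by (simp add: of_nat_diff)
    then have "k - i < J" using J(2)[OF \<open>?e \<in> E\<close>, of "k - i"] p by force
    then show False using \<open>i < J\<close> by (simp add: k_def)
  qed
  let ?b = "act (zmul (int J) c) e"
  have "crossing ?k ?b = 1"
  proof -
    have "act (zmul (- int k) c) ?b = act (zmul (- int J) c) e"
      using act_zmul_add[OF c, of "- int k" "int J" e] by (simp add: k_def)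
    then show ?thesis using J[OF e, of J] unfolding crossing_def act_k by simp
  qed
  moreover have "?b \<in> skewered c" by (rule zstab) (use e in \<open>simp add: E_def\<close>)
  ultimately have "crossings c ?k > 0"
    unfolding crossings_def using finite_crossing[OF zmul_W[OF c, of "int k"]] nonneg
    by (intro sum_pos2[of _ ?b]) auto
  then show ?thesis using crossings_nmul[OF c, of k] by auto
qed

lemma root_refl_inj:
  assumes "root_refl b t" "root_refl b t'" shows "t = t'"
proof -
  have W: "t \<in> W" "t' \<in> W" using assms root_refl_reflection reflections_W by blast+
  have "- t + t' = 0"
  proof (rule act_faithful)
    show "- t + t' \<in> W" by (intro word_group_add W_uminus W)
    fix s
    have "act t' (simple_root s) = act t (simple_root s)"
      using act_root_refl[OF assms(1)] act_root_refl[OF assms(2)] by simp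
    then show "act (- t + t') (simple_root s) = simple_root s"
      using act_add[OF W_uminus[OF W(1)] W(2)] W by simp
  qed
  then show ?thesis by (metis add.inverse_inverse minus_unique)
qed

text \<open>\<open>t\<close> inverts \<open>c\<close> and negates its root \<open>b\<close>, so c^-j
  b is the negative of t c^j b. As \<open>t\<close> and \<open>c\<close> flip only finitely many
  roots, the signs of c^j b are eventually constant and opposite at the two ends; thus
  \<open>b\<close> or its negative is skewered.\<close>

lemma dihedral_skewered:
  assumes t: "t \<in> reflections S" "t' \<in> reflections S" and inf: "\<And>n. n > 0 \<Longrightarrow> nmul n (t + t') \<noteq> 0"
  shows "skewered (t + t') \<noteq> {}"
proof -
  define c where "c = t + t'"
  have tW: "t \<in> W" using t reflections_W by blast
  have c: "c \<in> W" unfolding c_def by (intro word_group_add reflections_W t)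
  have tt: "t + t = 0" "- t = t" using reflections_invol[OF t(1)] minus_unique by blast+
  have t't': "t' + t' = 0" "- t' = t'" using reflections_invol[OF t(2)] minus_unique by blast+
  obtain b where bt: "root_refl b t" using t(1) by (auto simp: reflections_def root_refl_def)
  then have b: "b \<in> roots" by (rule root_refl_root)
  have tb: "act t b = (\<lambda>r. - b r)" using act_root_refl[OF bt, of b] form_root[OF b] by (simp add: lincomb_def)
  have conj: "t + zmul j c = zmul (- j) c + t" for j
  proof -
    have "t + c - t = t' + - t" using tt(1) by (simp add: c_def flip: add.assoc)
    also have "\<dots> = - c" using t't' by (simp add: c_def minus_add)
    finally have "t + c - t = - c" .
    then have "zmul j (- c) = t + zmul j c - t" using zmul_conj[of j t c] by simp
    moreover have "zmul j (- c) = zmul (- j) c" by (auto simp: zmul_def nmul_uminus)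
    ultimately show ?thesis by (simp add: diff_eq_eq)
  qed
  define g where "g j = act (zmul j c) b" for j
  have groots: "g j \<in> roots" for j using root_act[OF b zmul_W[OF c]] by (simp add: g_def)
  \<comment> \<open>If c^d fixes \<open>b\<close>, it commutes with \<open>t\<close>; since
    \<open>t\<close> also inverts it, c^(2d) is trivial.\<close>
  have inj: "inj g"
  proof -
    have False if eq: "g i = g j" and ij: "i < j" for i j
    proof -
      define d where "d = j - i"
      have "act (zmul (- i + i) c) b = act (zmul (- i + j) c) b"
        using eq by (simp only: act_zmul_add[OF c] g_def)
      then have "act (zmul d c) b = b" by (simp add: d_def)
      then have "root_refl b (zmul d c + t - zmul d c)" using root_refl_conj[OF bt zmul_W[OF c]] by metis
      then have "zmul d c + t - zmul d c = t" using bt root_refl_inj by blast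
      then have "zmul d c + t = zmul (- d) c + t" using conj[of d] by (simp add: diff_eq_eq)
      then have "zmul d c = zmul (- d) c" by simp
      then have "zmul (d + d) c = zmul (d + - d) c" unfolding zmul_add by simp
      then have "nmul (nat (d + d)) c = 0" using ij by (simp add: zmul_def d_def)
      then show False using inf[of "nat (d + d)"] ij by (simp add: c_def d_def)
    qed
    then show ?thesis by (metis (no_types, lifting) injI linorder_cases)
  qed
  have refl: "g (- j) = (\<lambda>r. - act t (g j) r)" for j
  proof -
    have "act t (g j) = act (t + zmul j c) b" using act_add[OF tW zmul_W[OF c]] by (simp add: g_def)
    also have "\<dots> = act (zmul (- j) c) (act t b)" using act_add[OF zmul_W[OF c] tW] by (simp only: conj)
    also have "\<dots> = (\<lambda>r. - g (- j) r)" by (simp add: tb act_neg g_def)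
    finally show ?thesis by simp
  qed
  define X where "X = {b \<in> roots. pos b \<noteq> pos (act t b)} \<union> {b \<in> roots. pos b \<noteq> pos (act c b)}"
  have "finite (g -` X)" by (rule finite_vimageI[OF _ inj]) (use finite_flips tW c in \<open>simp add: X_def\<close>)
  then obtain J where J: "\<And>j. j \<ge> J \<Longrightarrow> g (int j) \<notin> X" using finite_int_bound by fastforce
  have step: "pos (g (int (Suc j))) = pos (g (int j))" if "j \<ge> J" for j
  proof -
    have "g (int (Suc j)) = act c (g (int j))"
      using act_zmul_add[OF c, of 1 "int j" b] zmul_of_nat[of 1 c] by (simp add: g_def add.commute)
    then show ?thesis using J[OF that] groots by (auto simp: X_def)
  qed
  have const: "pos (g (int j)) = pos (g (int J))" if "j \<ge> J" for j
    using that by (induction j rule: dec_induct) (auto simp: step simp del: of_nat_Suc)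
  have opp: "pos (g (- int j)) = (\<not> pos (g (int J)))" if "j \<ge> J" for j
  proof -
    have "pos (g (- int j)) = (\<not> pos (act t (g (int j))))"
      unfolding refl by (rule pos_uminus[OF root_act[OF groots tW]])
    also have "pos (act t (g (int j))) = pos (g (int j))" using J[OF that] groots by (auto simp: X_def)
    finally show ?thesis using const[OF that] by simp
  qed
  show ?thesis
  proof (cases "pos (g (int J))")
    case True
    then have "b \<in> skewered c" using b const opp by (auto simp: skewered_def g_def)
    then show ?thesis by (auto simp: c_def)
  next
    case False
    have "act (zmul j c) (\<lambda>r. - b r) = (\<lambda>r. - g j r)" for j by (simp add: act_neg g_def)
    then have "pos (act (zmul j c) (\<lambda>r. - b r)) = (\<not> pos (g j))" for j
      using pos_uminus[OF groots[of j]] by simp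
    then have "\<forall>j\<ge>J. pos (act (zmul (int j) c) (\<lambda>r. - b r)) \<and> \<not> pos (act (zmul (- int j) c) (\<lambda>r. - b r))"
      using const opp False by (simp del: zmul_of_nat)
    then have "(\<lambda>r. - b r) \<in> skewered c" unfolding skewered_def using root_uminus[OF b] by blast
    then show ?thesis by (auto simp: c_def)
  qed
qed

lemma virtual_centralizer_hom:
  assumes "infinite W"
  shows "\<exists>c\<in>W. \<exists>D::'a \<Rightarrow> int. D c \<noteq> 0 \<and> (\<forall>y\<in>virtual_centralizer S c. \<forall>w\<in>W. D (y + w) = D y + D w)"
proof -
  have "coxeter_group S" by unfold_locales
  then obtain t t' where t: "t \<in> reflections S" "t' \<in> reflections S" "\<And>n. n > 0 \<Longrightarrow> nmul n (t + t') \<noteq> 0"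
    using infinite_dihedral assms by blast
  have c: "t + t' \<in> W" using t reflections_W word_group_add by blast
  show ?thesis
    using c crossings_nonzero[OF c dihedral_skewered[OF t]] crossings_add[OF c] by blast
qed

end

section \<open>Retractions and BN-pairs\<close>

text \<open>By Tychonoff the product of the finite discrete ranges is compact, so the sequence has a
  cluster point there. A pointwise convergent subsequence need not exist when the index type is
  uncountable.\<close>

lemma finite_ranges_cluster:
  fixes f :: "nat \<Rightarrow> 'a \<Rightarrow> 'b"
  assumes fin: "\<And>x. finite (range (\<lambda>j. f j x))"
  shows "\<exists>r. \<forall>F. finite F \<longrightarrow> infinite {j. \<forall>x\<in>F. f j x = r x}"
proof -
  define T where "T x = discrete_topology (range (\<lambda>j. f j x))" for x
  define X where "X = product_topology T UNIV"
  have comp: "compact_space X"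
    unfolding X_def compact_space_product_topology using fin by (simp add: T_def compact_space_discrete_topology)
  have top: "topspace X = (\<Pi>\<^sub>E x\<in>UNIV. range (\<lambda>j. f j x))"
    by (simp add: X_def T_def)
  define C where "C k = X closure_of (f ` {k..})" for k :: nat
  have fX: "f j \<in> topspace X" for j by (auto simp: top)
  have "\<Inter>(range C) \<noteq> {}"
  proof -
    have "\<Inter>\<F> \<noteq> {}" if "finite \<F>" "\<F> \<subseteq> range C" for \<F>
    proof -
      obtain K where K: "finite K" "\<F> = C ` K" using finite_subset_image[OF \<open>finite \<F>\<close> \<open>\<F> \<subseteq> range C\<close>] by blast
      obtain m where m: "\<forall>k\<in>K. k \<le> m" using K(1) finite_nat_set_iff_bounded_le by blast
      have "f m \<in> C k" if "k \<in> K" for k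
        using closure_of_subset_Int[of X "f ` {k..}"] fX m that by (auto simp: C_def)
      then show ?thesis using K by blast
    qed
    then show ?thesis
      using comp unfolding compact_space_fip by (auto simp: C_def)
  qed
  then obtain r where r: "\<And>k. r \<in> C k" by auto
  have "infinite {j. \<forall>x\<in>F. f j x = r x}" if F: "finite F" for F
  proof -
    have rX: "r \<in> topspace X" using r[of 0] closure_of_subset_topspace[of X] by (auto simp: C_def)
    define U where "U = (\<Pi>\<^sub>E x\<in>UNIV. if x \<in> F then {r x} else range (\<lambda>j. f j x))"
    have "openin X U"
      unfolding X_def U_def
    proof (rule product_topology_basis)
      show "openin (T x) (if x \<in> F then {r x} else range (\<lambda>j. f j x))" for x
        using rX by (auto simp: T_def top PiE_iff)
      show "finite {x. (if x \<in> F then {r x} else range (\<lambda>j. f j x)) \<noteq> topspace (T x)}"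
        by (rule finite_subset[OF _ F]) (auto simp: T_def)
    qed
    moreover have "r \<in> U" using rX by (auto simp: U_def top PiE_iff)
    ultimately have meet: "\<exists>j\<ge>k. f j \<in> U" for k
      using r[of k] unfolding C_def in_closure_of by blast
    have "\<exists>j\<ge>k. j \<in> {j. \<forall>x\<in>F. f j x = r x}" for k
    proof -
      obtain j where j: "j \<ge> k" "f j \<in> U" using meet by blast
      have "f j x = r x" if "x \<in> F" for x
        using PiE_mem[OF j(2)[unfolded U_def] UNIV_I, of x] that by simp
      then show ?thesis using j(1) by blast
    qed
    then show ?thesis by (simp add: infinite_nat_iff_unbounded_le)
  qed
  then show ?thesis by blast
qed

section \<open>Bruhat decomposition and exchange condition of a BN-pair\<close>

lemma word_len_step:
  assumes "s \<in> S" "w \<in> word_group S" shows "word_len S (s + w) \<le> Suc (word_len S w)"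
proof -
  obtain ws where "reduced_word S ws" "sum_list ws = w" using word_len_exists assms by blast
  then show ?thesis using word_len_le[of "s # ws" S] assms by (auto simp: reduced_word_def)
qed

text \<open>A BN-pair together with a presentation \<open>p\<close> of the quotient map \<open>N \<rightarrow> N / (B \<inter> N)\<close>, so that the
  Weyl group becomes the subset \<open>p ` N\<close> of a group type.\<close>

locale bn_system =
  fixes B N :: "'g::group_add set" and p :: "'g \<Rightarrow> 'w::group_add" and S :: "'w set"
  assumes subB: "subgrp B" and subN: "subgrp N" and gen: "gen_subgrp (B \<union> N) = UNIV"
    and p_add: "m \<in> N \<Longrightarrow> n \<in> N \<Longrightarrow> p (m + n) = p m + p n"
    and p_ker: "n \<in> N \<Longrightarrow> p n = 0 \<longleftrightarrow> n \<in> B"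
    and finS: "finite S" and S0: "0 \<notin> S" and S_invol: "s \<in> S \<Longrightarrow> s + s = 0"
    and p_image: "p ` N = word_group S"
    and bn1: "m \<in> N \<Longrightarrow> p m \<in> S \<Longrightarrow> n \<in> N \<Longrightarrow> b \<in> B \<Longrightarrow>
      \<exists>b1\<in>B. \<exists>b2\<in>B. \<exists>k\<in>N. (p k = p n \<or> p k = p m + p n) \<and> m + b + n = b1 + k + b2"
    and bn2: "m \<in> N \<Longrightarrow> p m \<in> S \<Longrightarrow> \<exists>b\<in>B. m + b + m \<notin> B"
begin

abbreviation Weyl where "Weyl \<equiv> word_group S"

definition cell :: "'w \<Rightarrow> 'g set" where
  "cell w = {b + n + b' | b n b'. b \<in> B \<and> n \<in> N \<and> b' \<in> B \<and> p n = w}"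

lemma B_closed: "0 \<in> B" "x \<in> B \<Longrightarrow> y \<in> B \<Longrightarrow> x + y \<in> B" "x \<in> B \<Longrightarrow> - x \<in> B"
  using subB by (auto simp: subgrp_def)

lemma N_closed: "0 \<in> N" "x \<in> N \<Longrightarrow> y \<in> N \<Longrightarrow> x + y \<in> N" "x \<in> N \<Longrightarrow> - x \<in> N"
  using subN by (auto simp: subgrp_def)

lemma p_zero [simp]: "p 0 = 0"
  using p_ker B_closed N_closed by blast

lemma p_uminus: "n \<in> N \<Longrightarrow> p (- n) = - p n"
  using p_add[of n "- n"] N_closed minus_unique[of "p n" "p (- n)"] by simp

lemma uminus_S: "s \<in> S \<Longrightarrow> - s = s"
  using S_invol minus_unique by blast

lemma S_cancel: "s \<in> S \<Longrightarrow> s + (s + w) = w"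
  using S_invol by (simp flip: add.assoc)

lemma W_lift: "w \<in> Weyl \<Longrightarrow> \<exists>n\<in>N. p n = w"
  using p_image by (metis imageE)

lemma p_W: "n \<in> N \<Longrightarrow> p n \<in> Weyl"
  using p_image by blast

lemma Weyl_uminus: "w \<in> Weyl \<Longrightarrow> - w \<in> Weyl"
  using W_lift p_uminus p_W N_closed by metis

lemma cellI: "b \<in> B \<Longrightarrow> n \<in> N \<Longrightarrow> b' \<in> B \<Longrightarrow> b + n + b' \<in> cell (p n)"
  unfolding cell_def by blast

lemma cell_lift: "n \<in> N \<Longrightarrow> n \<in> cell (p n)"
  using cellI[of 0 n 0] B_closed by simp

lemma cell_rep:
  assumes "x \<in> cell (p n)" "n \<in> N" shows "\<exists>b\<in>B. \<exists>b'\<in>B. x = b + n + b'"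
proof -
  obtain b m b' where x: "b \<in> B" "m \<in> N" "b' \<in> B" "p m = p n" "x = b + m + b'"
    using assms by (auto simp: cell_def)
  have mn: "- n + m \<in> N" by (intro N_closed assms x)
  have "p (- n + m) = 0" using p_add[of "- n" m] N_closed(3) p_uminus assms x by simp
  then have "- n + m \<in> B" using p_ker mn by blast
  then have "- n + m + b' \<in> B" using B_closed x by blast
  moreover have "x = b + n + (- n + m + b')" using x by (simp add: add.assoc)
  ultimately show ?thesis using x by blast
qed

lemma cell_left: "b \<in> B \<Longrightarrow> x \<in> cell w \<Longrightarrow> b + x \<in> cell w"
  unfolding cell_def using B_closed(2) by clarify (metis add.assoc)

lemma cell_right: "b \<in> B \<Longrightarrow> x \<in> cell w \<Longrightarrow> x + b \<in> cell w"
  unfolding cell_def using B_closed(2) by clarify (metis add.assoc)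

lemma cell_0: "cell 0 = B"
proof
  show "cell 0 \<subseteq> B" using p_ker B_closed(2) by (auto simp: cell_def)
  show "B \<subseteq> cell 0" using cell_right[of _ 0 0] cell_lift[of 0] N_closed by auto
qed

lemma cell_uminus: "x \<in> cell w \<Longrightarrow> - x \<in> cell (- w)"
proof -
  assume "x \<in> cell w"
  then obtain b n b' where x: "b \<in> B" "n \<in> N" "b' \<in> B" "p n = w" "x = b + n + b'"
    by (auto simp: cell_def)
  then have "- x = - b' + - n + - b" by (simp only: minus_add add.assoc)
  then show ?thesis using cellI[of "- b'" "- n" "- b"] x B_closed(3) N_closed(3) p_uminus by simp
qed

lemma cell_eq:
  assumes "w \<in> Weyl" "x \<in> cell u" "x \<in> cell w" shows "cell u \<subseteq> cell w"
proof
  fix y assume y: "y \<in> cell u"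
  obtain b n b' where x: "b \<in> B" "n \<in> N" "b' \<in> B" "p n = u" "x = b + n + b'"
    using assms by (auto simp: cell_def)
  obtain d d' where y: "d \<in> B" "d' \<in> B" "y = d + n + d'" using cell_rep[of y n] x y by blast
  have "- b + x + - b' = n" using x by (simp only: add.assoc minus_add_cancel add_0_right right_minus)
  then have "n \<in> cell w" using assms x cell_left[of "- b"] cell_right[of "- b'"] B_closed(3) by metis
  then show "y \<in> cell w" using y cell_left cell_right by blast
qed

lemma cell_mult_left:
  assumes s: "s \<in> S" and w: "w \<in> Weyl" and x: "x \<in> cell s" and y: "y \<in> cell w"
  shows "x + y \<in> cell w \<or> x + y \<in> cell (s + w)"
proof -
  obtain b m b' where x': "b \<in> B" "m \<in> N" "b' \<in> B" "p m = s" "x = b + m + b'"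
    using x by (auto simp: cell_def)
  obtain d n d' where y': "d \<in> B" "n \<in> N" "d' \<in> B" "p n = w" "y = d + n + d'"
    using y by (auto simp: cell_def)
  obtain b1 b2 k where k: "b1 \<in> B" "b2 \<in> B" "k \<in> N" "p k = w \<or> p k = s + w" "m + (b' + d) + n = b1 + k + b2"
    using bn1[of m n "b' + d"] x' y' s B_closed(2) by blast
  have "x + y = b + (m + (b' + d) + n) + d'" using x' y' by (simp only: add.assoc)
  also have "\<dots> = (b + b1) + k + (b2 + d')" by (simp only: k(5)) (simp only: add.assoc)
  finally have "x + y \<in> cell (p k)" using cellI k x' y' B_closed(2) by simp
  then show ?thesis using k by auto
qed

lemma cell_mult_right:
  assumes s: "s \<in> S" and w: "w \<in> Weyl" and x: "x \<in> cell w" and y: "y \<in> cell s"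
  shows "x + y \<in> cell w \<or> x + y \<in> cell (w + s)"
proof -
  have "- y + - x \<in> cell (- w) \<or> - y + - x \<in> cell (s + - w)"
    using cell_mult_left[OF s Weyl_uminus[OF w] _ cell_uminus[OF x], of "- y"] cell_uminus[OF y] uminus_S[OF s]
    by (simp del: add_uminus_conv_diff)
  then have "- (- y + - x) \<in> cell (- (- w)) \<or> - (- y + - x) \<in> cell (- (s + - w))"
    using cell_uminus by blast
  moreover have "- (- y + - x) = x + y" "- (s + - w) = w + s"
    using uminus_S[OF s] by (simp_all only: minus_add minus_minus)
  ultimately show ?thesis by simp
qed

lemma cell_split:
  assumes "u \<in> Weyl" "w \<in> Weyl" "x \<in> cell (u + w)"
  shows "\<exists>y\<in>cell u. \<exists>z\<in>cell w. x = y + z"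
proof -
  obtain m n where mn: "m \<in> N" "p m = u" "n \<in> N" "p n = w" using W_lift assms by metis
  then obtain b b' where b: "b \<in> B" "b' \<in> B" "x = b + (m + n) + b'"
    using cell_rep[of x "m + n"] assms(3) p_add N_closed(2) by metis
  have "b + m \<in> cell u" "n + b' \<in> cell w" using mn b cell_left cell_right cell_lift by blast+
  moreover have "x = (b + m) + (n + b')" using b by (simp only: add.assoc)
  ultimately show ?thesis by blast
qed

text \<open>Along a word for \<open>u\<close> each letter either acts or is skipped, so only
  finitely many left factors \<open>z\<close> occur, and they depend on \<open>u\<close> alone. This
  is the source of finiteness in the retraction argument.\<close>

lemma cell_mult_finite:
  assumes "u \<in> Weyl"
  shows "\<exists>Z. finite Z \<and> Z \<subseteq> Weyl \<and> (\<forall>h\<in>cell u. \<forall>w\<in>Weyl. \<forall>x\<in>cell w. \<exists>z\<in>Z. h + x \<in> cell (z + w))"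
  using assms
proof (induction rule: word_group_mem_induct)
  case zero
  show ?case by (rule exI[of _ "{0}"]) (use cell_0 cell_left in auto)
next
  case (step s u)
  then obtain Z where Z: "finite Z" "Z \<subseteq> Weyl" "\<forall>h\<in>cell u. \<forall>w\<in>Weyl. \<forall>x\<in>cell w. \<exists>z\<in>Z. h + x \<in> cell (z + w)" by blast
  let ?Z = "Z \<union> (\<lambda>z. s + z) ` Z"
  have "\<exists>z\<in>?Z. h + x \<in> cell (z + w)" if h: "h \<in> cell (s + u)" and w: "w \<in> Weyl" and x: "x \<in> cell w" for h w x
  proof -
    obtain h1 h2 where h12: "h1 \<in> cell s" "h2 \<in> cell u" "h = h1 + h2"
      using cell_split[OF word_group_gen[OF step(1)] step(2) h] by blast
    obtain z where z: "z \<in> Z" "h2 + x \<in> cell (z + w)" using Z(3) h12 w x by blast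
    have "z + w \<in> Weyl" using z(1) Z(2) w word_group_add by blast
    from cell_mult_left[OF step(1) this h12(1) z(2)] have
      "h + x \<in> cell (z + w) \<or> h + x \<in> cell ((s + z) + w)" using h12(3) by (simp add: add.assoc)
    then show ?thesis using z(1) by blast
  qed
  moreover have "?Z \<subseteq> Weyl" using Z(2) step(1) word_group_add[OF word_group_gen[OF step(1)]] by auto
  ultimately show ?case using Z(1) by (intro exI[of _ ?Z]) auto
qed

lemma cell_cover: "\<exists>w\<in>Weyl. g \<in> cell w"
proof -
  let ?U = "\<Union>w\<in>Weyl. cell w"
  have "subgrp ?U"
    unfolding subgrp_def
  proof (intro conjI ballI)
    show "0 \<in> ?U" using cell_0 B_closed(1) by (intro UN_I[of 0]) auto
    show "- x \<in> ?U" if "x \<in> ?U" for x using that cell_uminus Weyl_uminus by blast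
    fix x y assume "x \<in> ?U" "y \<in> ?U"
    then obtain u w where uw: "u \<in> Weyl" "x \<in> cell u" "w \<in> Weyl" "y \<in> cell w" by blast
    obtain Z where Z: "Z \<subseteq> Weyl" "\<forall>h\<in>cell u. \<forall>w\<in>Weyl. \<forall>x\<in>cell w. \<exists>z\<in>Z. h + x \<in> cell (z + w)"
      using cell_mult_finite[OF uw(1)] by blast
    then obtain z where "z \<in> Z" "x + y \<in> cell (z + w)" using uw by blast
    then show "x + y \<in> ?U" using Z(1) uw(3) word_group_add by blast
  qed
  moreover have "B \<union> N \<subseteq> ?U" using cell_0 cell_lift p_W word_group_zero by blast
  ultimately have "gen_subgrp (B \<union> N) \<subseteq> ?U" unfolding gen_subgrp_def by blast
  then show ?thesis using gen by blast
qed

text \<open>Induction on the shorter length: stripping the first letter \<open>s\<close> of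
  \<open>u\<close> leaves \<open>v\<close>, whose cell equals that of \<open>w\<close> or of
  \<open>s + w\<close>.\<close>

lemma cell_disjoint:
  assumes "u \<in> Weyl" "w \<in> Weyl" "x \<in> cell u" "x \<in> cell w"
  shows "u = w"
proof -
  have main: "u = w" if "u \<in> Weyl" "w \<in> Weyl" "cell u = cell w" "word_len S u \<le> word_len S w" for u w
    using that
  proof (induction "word_len S u" arbitrary: u w rule: less_induct)
    case less
    obtain us where us: "reduced_word S us" "sum_list us = u" using less.prems word_len_exists by blast
    show ?case
    proof (cases us)
      case Nil
      obtain n where n: "n \<in> N" "p n = w" using W_lift less.prems by blast
      have "cell w = B" using Nil us less.prems cell_0 by simp
      then show ?thesis using cell_lift n p_ker Nil us by force
    next
      case (Cons s vs)
      define v where "v = sum_list vs"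
      have s: "s \<in> S" and vs: "vs \<in> lists S" using us Cons by (auto simp: reduced_word_def)
      have v: "v \<in> Weyl" "u = s + v" using vs word_group_sum_list us Cons by (auto simp: v_def)
      have lv: "word_len S v < word_len S u"
        using word_len_le[OF vs] us Cons by (auto simp: reduced_word_def v_def)
      have sw: "s + w \<in> Weyl" using s less.prems word_group_add word_group_gen by blast
      obtain m n where mn: "m \<in> N" "p m = s" "n \<in> N" "p n = v" using W_lift v word_group_gen[OF s] by metis
      have "m + n \<in> cell w" using cell_lift[of "m + n"] mn p_add N_closed(2) v less.prems by auto
      moreover have "- m \<in> cell s" using cell_uminus[OF cell_lift[OF mn(1)]] mn uminus_S s by simp
      ultimately have "n \<in> cell w \<or> n \<in> cell (s + w)"
        using cell_mult_left[OF s less.prems(2), of "- m" "m + n"] by (simp flip: add.assoc)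
      moreover have "n \<in> cell v" using cell_lift mn by blast
      ultimately have "cell v = cell w \<or> cell v = cell (s + w)"
        using cell_eq less.prems(2) sw v(1) by blast
      then show ?thesis
      proof
        assume "cell v = cell w"
        then have "v = w" using less.hyps[OF lv v(1) less.prems(2)] lv less.prems by simp
        then show ?thesis using lv less.prems by simp
      next
        assume c: "cell v = cell (s + w)"
        \<comment> \<open>This keeps \<open>v\<close> no longer than \<open>s + w\<close>, as the
          induction hypothesis demands.\<close>
        have "word_len S w \<le> Suc (word_len S (s + w))"
          using word_len_step[OF s sw] S_cancel[OF s] by simp
        then have "v = s + w" using less.hyps[OF lv v(1) sw c] lv less.prems by simp
        then show ?thesis using v S_cancel[OF s] by simp
      qed
    qed
  qed
  have "cell u = cell w" using cell_eq assms by blast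
  then show ?thesis using main[of u w] main[of w u] assms by (metis nle_le)
qed

text \<open>The Weyl distance in the building from the base chamber \<open>B\<close> to the chamber
  gB.\<close>

definition weyl_of :: "'g \<Rightarrow> 'w" where
  "weyl_of g = (THE w. w \<in> Weyl \<and> g \<in> cell w)"

lemma weyl_of: "weyl_of g \<in> Weyl" "g \<in> cell (weyl_of g)"
proof -
  have "\<exists>!w. w \<in> Weyl \<and> g \<in> cell w" using cell_cover cell_disjoint by blast
  from theI'[OF this] show "weyl_of g \<in> Weyl" "g \<in> cell (weyl_of g)" by (simp_all add: weyl_of_def)
qed

lemma weyl_of_eq: "w \<in> Weyl \<Longrightarrow> g \<in> cell w \<Longrightarrow> weyl_of g = w"
  using cell_disjoint weyl_of by blast

text \<open>Stands for "\<open>s\<close> lengthens \<open>w\<close>", but is phrased with cells: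
  lengths can be compared only once the exchange condition is proved.\<close>

definition ascends :: "'w \<Rightarrow> 'w \<Rightarrow> bool" where
  "ascends s w \<longleftrightarrow> (\<forall>x\<in>cell s. \<forall>y\<in>cell w. x + y \<in> cell (s + w))"

text \<open>By \<open>bn2\<close> some m + b + m stays in the cell of \<open>s\<close>. Computing m
  + b + m + y in two ways places it in the cells of \<open>w\<close> and of \<open>s + w\<close>,
  which are disjoint.\<close>

lemma not_ascends_twice:
  assumes s: "s \<in> S" and w: "w \<in> Weyl" and "ascends s w" "ascends s (s + w)"
  shows False
proof -
  obtain m where m: "m \<in> N" "p m = s" using W_lift word_group_gen[OF s] by blast
  obtain b where b: "b \<in> B" "m + b + m \<notin> B" using bn2 m s by blast
  have ms: "m \<in> cell s" "m + b \<in> cell s" using m b cell_lift cell_right by blast+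
  have "m + b + m \<in> cell s \<or> m + b + m \<in> cell (s + s)"
    using cell_mult_left[OF s word_group_gen[OF s]] ms by blast
  then have mbm: "m + b + m \<in> cell s" using b cell_0 S_invol[OF s] by simp
  obtain y where y: "y \<in> N" "p y = w" using W_lift w by blast
  then have yw: "y \<in> cell w" using cell_lift by blast
  have "m + y \<in> cell (s + w)" using assms(3) ms(1) yw by (simp add: ascends_def)
  then have "m + b + (m + y) \<in> cell (s + (s + w))" using assms(4) ms(2) by (simp add: ascends_def)
  moreover have "m + b + m + y \<in> cell (s + w)" using assms(3) mbm yw by (simp add: ascends_def)
  ultimately have "w = s + w"
    using cell_disjoint[OF w word_group_add[OF word_group_gen[OF s] w]] S_cancel[OF s] by (simp add: add.assoc)
  then have "0 + w = s + w" by simp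
  then have "s = 0" by (simp only: add_right_cancel)
  then show False using S0 s by simp
qed

text \<open>A product witnessing the failure at \<open>w + r\<close> lies in the cell of
  \<open>w + r\<close>; splitting off the factor in the cell of \<open>r\<close> also places it in
  the cell of \<open>s + w\<close>.\<close>

lemma ascends_fold:
  assumes s: "s \<in> S" and r: "r \<in> S" and w: "w \<in> Weyl" and asc: "ascends s w" "\<not> ascends s (w + r)"
  shows "s + w = w + r"
proof -
  have wr: "w + r \<in> Weyl" and sw: "s + w \<in> Weyl" using w s r word_group_add word_group_gen by blast+
  obtain x y where xy: "x \<in> cell s" "y \<in> cell (w + r)" "x + y \<notin> cell (s + (w + r))"
    using asc(2) by (auto simp: ascends_def)
  then have xyc: "x + y \<in> cell (w + r)" using cell_mult_left[OF s wr] by blast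
  obtain y1 y2 where y: "y1 \<in> cell w" "y2 \<in> cell r" "y = y1 + y2"
    using cell_split[OF w word_group_gen[OF r] xy(2)] by blast
  have "x + y1 \<in> cell (s + w)" using asc(1) xy(1) y(1) by (simp add: ascends_def)
  then have "x + y1 + y2 \<in> cell (s + w) \<or> x + y1 + y2 \<in> cell (s + w + r)"
    using cell_mult_right[OF r sw] y(2) by blast
  then have "x + y \<in> cell (s + w)" using xy(3) y(3) by (simp add: add.assoc)
  then show ?thesis using cell_disjoint[OF sw wr] xyc by blast
qed

text \<open>The letter to delete is the one at which a prefix of the word first stops
  ascending.\<close>

lemma not_ascends_exchange:
  assumes s: "s \<in> S" and ws: "ws \<in> lists S" and "\<not> ascends s (sum_list ws)"
  shows "\<exists>i<length ws. s + sum_list ws = sum_list (take i ws @ drop (Suc i) ws)"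
proof -
  have "ascends s 0" using cell_0 cell_right by (auto simp: ascends_def)
  then obtain i where i: "i < length ws" "ascends s (sum_list (take i ws))" "\<not> ascends s (sum_list (take (Suc i) ws))"
    using sign_change[of "\<lambda>i. \<not> ascends s (sum_list (take i ws))" "length ws"] assms by auto
  have take_Suc: "sum_list (take (Suc i) ws) = sum_list (take i ws) + ws ! i"
    using i(1) by (simp add: take_Suc_conv_app_nth)
  have "take i ws \<in> lists S" using ws by (auto dest: in_set_takeD)
  moreover have "ws ! i \<in> S" using ws i(1) by auto
  ultimately have "s + sum_list (take i ws) = sum_list (take (Suc i) ws)"
    using ascends_fold[OF s _ word_group_sum_list] i take_Suc by simp
  then have "s + sum_list (take (Suc i) ws) = sum_list (take i ws)" using S_cancel[OF s] by metis
  then have "s + (sum_list (take (Suc i) ws) + sum_list (drop (Suc i) ws)) = sum_list (take i ws) + sum_list (drop (Suc i) ws)"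
    by (simp flip: add.assoc)
  then have "s + sum_list ws = sum_list (take i ws @ drop (Suc i) ws)"
    by (simp flip: sum_list_append)
  then show ?thesis using i(1) by blast
qed

text \<open>If \<open>s\<close> ascended at \<open>w\<close>, it would not ascend at
  \<open>s + w\<close>; deleting a letter from a reduced word of \<open>s + w\<close> would then
  make \<open>w\<close> shorter than \<open>s + w\<close>, against the length hypothesis.\<close>

lemma coxeter: "coxeter_group S"
proof
  fix s ws assume s: "s \<in> S" and ws: "reduced_word S ws" and len: "word_len S (s + sum_list ws) \<le> length ws"
  have wsS: "ws \<in> lists S" using ws by (simp add: reduced_word_def)
  have wW: "sum_list ws \<in> Weyl" using word_group_sum_list[OF wsS] .
  have "\<not> ascends s (sum_list ws)"
  proof
    assume asc: "ascends s (sum_list ws)"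
    have "s + sum_list ws \<in> Weyl" using word_group_add[OF word_group_gen[OF s] wW] .
    then obtain vs where vs: "reduced_word S vs" "sum_list vs = s + sum_list ws" using word_len_exists by blast
    have vsS: "vs \<in> lists S" using vs by (simp add: reduced_word_def)
    have "\<not> ascends s (sum_list vs)" using not_ascends_twice[OF s wW asc] vs by auto
    then obtain i where i: "i < length vs" "s + sum_list vs = sum_list (take i vs @ drop (Suc i) vs)"
      using not_ascends_exchange[OF s vsS] by blast
    have "take i vs @ drop (Suc i) vs \<in> lists S" using vsS by (auto dest!: in_set_takeD in_set_dropD)
    from word_len_le[OF this] have "word_len S (s + sum_list vs) < length vs" unfolding i(2) using i(1) by simp
    then have "word_len S (sum_list ws) < length vs" using vs S_cancel[OF s] by simp
    then show False using len ws vs by (simp add: reduced_word_def)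
  qed
  then show "\<exists>i<length ws. s + sum_list ws = sum_list (take i ws @ drop (Suc i) ws)"
    using not_ascends_exchange[OF s wsS] by blast
qed (use finS S0 S_invol in auto)

lemma weyl_of_left_finite: "\<exists>Z. finite Z \<and> (\<forall>x. \<exists>z\<in>Z. weyl_of (h + x) = z + weyl_of x)"
proof -
  obtain Z where Z: "finite Z" "Z \<subseteq> Weyl" "\<forall>h'\<in>cell (weyl_of h). \<forall>w\<in>Weyl. \<forall>x\<in>cell w. \<exists>z\<in>Z. h' + x \<in> cell (z + w)"
    using cell_mult_finite[OF weyl_of(1)[of h]] by metis
  have "\<exists>z\<in>Z. weyl_of (h + x) = z + weyl_of x" for x
  proof -
    obtain z where "z \<in> Z" "h + x \<in> cell (z + weyl_of x)" using Z(3) weyl_of by blast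
    moreover from this have "z + weyl_of x \<in> Weyl" using Z(2) by (intro word_group_add weyl_of(1)) blast
    ultimately show ?thesis using weyl_of_eq by blast
  qed
  then show ?thesis using Z(1) by blast
qed

lemma weyl_of_uminus: "weyl_of (- x) = - weyl_of x"
  using weyl_of_eq[OF Weyl_uminus[OF weyl_of(1)] cell_uminus[OF weyl_of(2)]] .

lemma weyl_of_right_finite: "\<exists>Z. finite Z \<and> (\<forall>x. \<exists>z\<in>Z. weyl_of (x + h) = weyl_of x + z)"
proof -
  obtain Z where Z: "finite Z" "\<forall>x. \<exists>z\<in>Z. weyl_of (- h + x) = z + weyl_of x"
    using weyl_of_left_finite by blast
  have "\<exists>z\<in>uminus ` Z. weyl_of (x + h) = weyl_of x + z" for x
  proof -
    obtain z where z: "z \<in> Z" "weyl_of (- h + - x) = z + weyl_of (- x)" using Z(2) by blast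
    then have "- weyl_of (x + h) = z + - weyl_of x"
      using weyl_of_uminus[of "x + h"] weyl_of_uminus[of x] by (simp only: minus_add)
    then have "- (- weyl_of (x + h)) = - (z + - weyl_of x)" by (simp only:)
    then have "weyl_of (x + h) = weyl_of x + - z" by (simp only: minus_add minus_minus)
    then show ?thesis using z(1) by blast
  qed
  then show ?thesis using Z(1) by (intro exI[of _ "uminus ` Z"]) auto
qed

lemma nmul_N: "n \<in> N \<Longrightarrow> nmul j n \<in> N \<and> p (nmul j n) = nmul j (p n)"
  by (induction j) (auto simp: N_closed p_add)

text \<open>The map \<open>r\<close> below is a retraction of the building onto its standard apartment, centered at an
  end of the orbit of the base chamber under \<open>n\<close>.\<close>

lemma centralizer_hom_exists:
  assumes inf: "infinite Weyl"
  shows "\<exists>n. \<exists>f::'g \<Rightarrow> int. f n \<noteq> 0 \<and>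
    (\<forall>g h. g + n = n + g \<longrightarrow> h + n = n + h \<longrightarrow> f (g + h) = f g + f h)"
proof -
  obtain c D where c: "c \<in> Weyl" and Dc: "D c \<noteq> (0::int)"
    and D_add: "\<And>y w. y \<in> virtual_centralizer S c \<Longrightarrow> w \<in> Weyl \<Longrightarrow> D (y + w) = D y + D w"
    using coxeter_group.virtual_centralizer_hom[OF coxeter inf] by blast
  obtain n where n: "n \<in> N" "p n = c" using W_lift c by blast
  \<comment> \<open>The retraction centered at the chamber n^-j B; the shift by c^-j normalizes it
    so that \<open>0\<close> goes to \<open>0\<close> and \<open>n\<close> to \<open>c\<close> for
    every \<open>j\<close>.\<close>
  define R where "R j g = - nmul j c + weyl_of (nmul j n + g)" for j g
  have weyl_n: "weyl_of (nmul j n) = nmul j c" for j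
    using nmul_N[OF n(1)] n(2) cell_lift p_W weyl_of_eq by metis
  have "finite (range (\<lambda>j. R j g))" for g
  proof -
    obtain Z where Z: "finite Z" "\<forall>x. \<exists>z\<in>Z. weyl_of (x + g) = weyl_of x + z"
      using weyl_of_right_finite by blast
    have "R j g \<in> Z" for j
    proof -
      obtain z where "z \<in> Z" "weyl_of (nmul j n + g) = nmul j c + z" using Z(2) weyl_n by metis
      then show ?thesis by (simp add: R_def flip: add.assoc)
    qed
    then have "range (\<lambda>j. R j g) \<subseteq> Z" by (rule image_subsetI)
    then show ?thesis using Z(1) by (rule finite_subset)
  qed
  then obtain r where r: "\<And>F. finite F \<Longrightarrow> infinite {j. \<forall>x\<in>F. R j x = r x}"
    using finite_ranges_cluster[of R] by blast
  have R_weyl: "weyl_of (nmul j n + g) = nmul j c + R j g" for j g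
    by (simp add: R_def flip: add.assoc)
  have RW: "R j g \<in> Weyl" for j g
    unfolding R_def using word_group_add[OF Weyl_uminus weyl_of(1)] coxeter_group.zmul_W[OF coxeter c, of "int j"] by simp
  have pick: "\<exists>j. R j x = r x \<and> R j y = r y" for x y
  proof -
    have "infinite {j. \<forall>z\<in>{x, y}. R j z = r z}" by (rule r) simp
    then have "{j. \<forall>z\<in>{x, y}. R j z = r z} \<noteq> {}" by (metis finite.emptyI)
    then show ?thesis by auto
  qed
  have rW: "r g \<in> Weyl" for g using pick[of g g] RW by metis
  have r0: "r 0 = 0" using pick[of 0 0] weyl_n by (auto simp: R_def)
  have rn: "r n = c"
  proof -
    have "R j n = c" for j
    proof -
      have "weyl_of (nmul j n + n) = nmul j c + c" using weyl_n[of "Suc j"] by (simp add: nmul_commute)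
      then show ?thesis by (simp add: R_def flip: add.assoc)
    qed
    then show ?thesis using pick[of n n] by metis
  qed
  \<comment> \<open>Adjacent chambers have equal or adjacent images; each \<open>R j\<close> has
    this property and only two points are compared.\<close>
  have r_adj: "r (x + y) = r x \<or> r (x + y) = r x + s" if "s \<in> S" "y \<in> cell s" for x y s
  proof -
    obtain j where j: "R j x = r x" "R j (x + y) = r (x + y)" using pick by blast
    have ws: "weyl_of (nmul j n + x) + s \<in> Weyl" using weyl_of(1) that word_group_add word_group_gen by blast
    have "weyl_of (nmul j n + x + y) = weyl_of (nmul j n + x) \<or>
      weyl_of (nmul j n + x + y) = weyl_of (nmul j n + x) + s"
      using cell_mult_right[OF that(1) weyl_of(1) weyl_of(2) that(2)] weyl_of_eq[OF weyl_of(1)] weyl_of_eq[OF ws]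
      by blast
    then show ?thesis using j R_weyl[of j x] R_weyl[of j "x + y"] by (auto simp: add.assoc)
  qed
  have r_B: "r (x + b) = r x" if "b \<in> B" for x b
  proof -
    obtain j where j: "R j x = r x" "R j (x + b) = r (x + b)" using pick by blast
    have "weyl_of (nmul j n + x + b) = weyl_of (nmul j n + x)"
      by (rule weyl_of_eq[OF weyl_of(1) cell_right[OF that weyl_of(2)]])
    then show ?thesis using j by (simp add: R_def add.assoc)
  qed
  define Y where "Y h x = r (h + x) - r x" for h x
  have YW: "Y h x \<in> Weyl" for h x
    unfolding Y_def diff_conv_add_uminus by (intro word_group_add Weyl_uminus rW)
  \<comment> \<open>As \<open>h\<close> commutes with n^j, the element \<open>u j\<close> is the
    factor by which \<open>h\<close> changes the Weyl distance of n^j x. It ranges over a finite set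
    for infinitely many \<open>j\<close>, so two values agree.\<close>
  have Y_vc: "Y h x \<in> virtual_centralizer S c" if h: "h + n = n + h" for h x
  proof -
    have comm: "h + nmul j n = nmul j n + h" for j
      by (induction j) (use h in \<open>auto simp: add.assoc[symmetric], simp add: add.assoc\<close>)
    obtain Z where Z: "finite Z" "\<forall>x. \<exists>z\<in>Z. weyl_of (h + x) = z + weyl_of x"
      using weyl_of_left_finite by blast
    define I where "I = {j. \<forall>g\<in>{h + x, x}. R j g = r g}"
    have I: "infinite I" unfolding I_def by (rule r) simp
    define u where "u j = nmul j c + Y h x - nmul j c" for j
    have "u j \<in> Z" if j: "j \<in> I" for j
    proof -
      have "weyl_of (nmul j n + (h + x)) = weyl_of (h + (nmul j n + x))"
        using comm[of j] by (simp flip: add.assoc)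
      then obtain z where z: "z \<in> Z" "weyl_of (nmul j n + (h + x)) = z + weyl_of (nmul j n + x)"
        using Z(2) by metis
      then have "nmul j c + r (h + x) = z + (nmul j c + r x)" using j by (simp add: R_weyl I_def)
      moreover have "u j = (nmul j c + r (h + x)) - r x - nmul j c"
        unfolding u_def Y_def by (simp only: diff_conv_add_uminus add.assoc)
      moreover have "z + (nmul j c + r x) - r x - nmul j c = z"
        by (simp only: diff_conv_add_uminus add.assoc right_minus add_0_right)
      ultimately have "u j = z" by simp
      then show ?thesis using z(1) by simp
    qed
    then have "\<not> inj_on u I" using I Z(1) by (meson finite_imageD finite_subset image_subsetI)
    then obtain i j where ij: "i \<noteq> j" "u i = u j" by (auto simp: inj_on_def)
    have "\<exists>m>0. Y h x + nmul m c = nmul m c + Y h x" if "i < j" "u i = u j" for i j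
    proof -
      define d where "d = j - i"
      have j: "nmul j c = nmul i c + nmul d c" using that(1) by (simp add: d_def flip: nmul_add)
      have "nmul i c + Y h x - nmul i c = nmul i c + (nmul d c + Y h x - nmul d c) - nmul i c"
        using that(2) unfolding u_def j by (simp only: diff_conv_add_uminus minus_add add.assoc)
      then have "Y h x = nmul d c + Y h x - nmul d c" by (simp only: diff_conv_add_uminus add_right_cancel add_left_cancel)
      then have "Y h x + nmul d c = nmul d c + Y h x" by (metis diff_add_cancel)
      then show ?thesis using that(1) by (auto simp: d_def intro!: exI[of _ "j - i"])
    qed
    then have "\<exists>m>0. Y h x + nmul m c = nmul m c + Y h x" using ij by (metis linorder_neqE_nat)
    then show ?thesis using YW by (simp add: virtual_centralizer_def)
  qed
  \<comment> \<open>If the displacement changes at all, it changes by a conjugate \<open>t\<close>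
    of \<open>s\<close>. Passing back uses the same \<open>t\<close>, so D t enters with both signs
    and must vanish.\<close>
  have adj: "D (Y h (x + y)) = D (Y h x)" if h: "h + n = n + h" and s: "s \<in> S" and y: "y \<in> cell s" for h x y s
  proof -
    define t where "t = r x + s - r x"
    have t: "t \<in> Weyl" unfolding t_def diff_conv_add_uminus
      by (intro word_group_add Weyl_uminus rW word_group_gen s)
    have tt: "t + t = 0"
    proof -
      have "t + t = r x + (s + s) - r x"
        unfolding t_def by (simp only: diff_conv_add_uminus add.assoc minus_add_cancel)
      then show ?thesis using S_invol[OF s] by simp
    qed
    have "Y h (x + y) = Y h x \<or> Y h (x + y) = Y h x + t"
    proof -
      have 1: "r (h + (x + y)) = r (h + x) \<or> r (h + (x + y)) = r (h + x) + s"
        using r_adj[OF s y, of "h + x"] by (simp add: add.assoc)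
      have 2: "r (x + y) = r x \<or> r (x + y) = r x + s" using r_adj[OF s y] .
      have "r (h + x) + s - r x = Y h x + t"
        unfolding Y_def t_def by (simp only: diff_conv_add_uminus add.assoc minus_add_cancel)
      moreover have "r (h + x) - (r x + s) = r (h + x) + s - r x"
        by (simp only: diff_conv_add_uminus minus_add uminus_S[OF s] add.assoc)
      moreover have "r (h + x) + s - (r x + s) = Y h x"
        unfolding Y_def by (simp only: diff_conv_add_uminus minus_add add.assoc add_minus_cancel)
      ultimately show ?thesis using 1 2 unfolding Y_def by metis
    qed
    then show ?thesis
    proof
      assume Y': "Y h (x + y) = Y h x + t"
      then have "Y h x = Y h (x + y) + t" using tt by (simp add: add.assoc)
      then have "D (Y h x) = D (Y h (x + y)) + D t" using D_add[OF Y_vc[OF h, of "x + y"] t] by simp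
      moreover have "D (Y h (x + y)) = D (Y h x) + D t" using Y' D_add[OF Y_vc[OF h] t] by simp
      ultimately show ?thesis by simp
    qed simp
  qed
  \<comment> \<open>Any two chambers are joined by a gallery, here read off from a word for the Weyl
    element.\<close>
  have const: "D (Y h x) = D (Y h 0)" if h: "h + n = n + h" for h x
  proof -
    have "\<forall>y\<in>cell w. \<forall>x. D (Y h (x + y)) = D (Y h x)" if "w \<in> Weyl" for w
      using that
    proof (induction rule: word_group_mem_induct)
      case zero
      then show ?case
        using cell_0 r_B by (auto simp: Y_def simp flip: add.assoc)
    next
      case (step s w)
      show ?case
      proof (intro ballI allI)
        fix y x assume "y \<in> cell (s + w)"
        then obtain y1 y2 where y: "y1 \<in> cell s" "y2 \<in> cell w" "y = y1 + y2"
          using cell_split word_group_gen step by blast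
        have "D (Y h (x + y1 + y2)) = D (Y h (x + y1))" using step.IH y by blast
        also have "\<dots> = D (Y h x)" by (rule adj[OF h step(1) y(1)])
        finally show "D (Y h (x + y)) = D (Y h x)" using y(3) by (simp add: add.assoc)
      qed
    qed
    from this[OF weyl_of(1)] weyl_of(2)[of x] have "D (Y h (0 + x)) = D (Y h 0)" by blast
    then show ?thesis by simp
  qed
  define f where "f h = D (Y h 0)" for h
  have "f n \<noteq> 0" using Dc r0 rn by (simp add: f_def Y_def)
  moreover have "f (g + h) = f g + f h" if g: "g + n = n + g" and h: "h + n = n + h" for g h
  proof -
    \<comment> \<open>Displacements form a cocycle; \<open>const\<close> moves the base point of the
      first term from \<open>h\<close> back to \<open>0\<close>.\<close>
    have "Y (g + h) 0 = Y g h + Y h 0"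
      unfolding Y_def by (simp add: diff_conv_add_uminus add.assoc del: add_uminus_conv_diff)
    then have "f (g + h) = D (Y g h) + D (Y h 0)" unfolding f_def using D_add[OF Y_vc[OF g] YW] by simp
    then show ?thesis using const[OF g, of h] by (simp add: f_def)
  qed
  ultimately show ?thesis by blast
qed

end

section \<open>Compact groups\<close>

lemma nmul_zmul: "nmul m (zmul j x) = zmul (int m * j) x"
proof (induction m)
  case (Suc m)
  have "int (Suc m) * j = j + int m * j" by (simp add: algebra_simps)
  then show ?case using Suc by (simp only: zmul_add nmul.simps)
qed simp

lemma nmul_centralizer: "h + n = n + h \<Longrightarrow> nmul j h + n = n + nmul j (h :: 'a::monoid_add)"
proof (induction j)
  case (Suc j)
  have "nmul (Suc j) h + n = h + (nmul j h + n)" by (simp add: add.assoc)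
  also have "\<dots> = (h + n) + nmul j h" by (simp only: Suc.IH[OF Suc.prems] add.assoc)
  also have "h + n = n + h" by (rule Suc.prems)
  finally show ?case by (simp add: add.assoc)
qed simp

lemma continuous_on_nmul: "continuous_on A (nmul j :: 'a::topological_monoid_add \<Rightarrow> 'a)"
  by (induction j) (auto intro!: continuous_intros)

text \<open>With \<open>u 2\<^sup>k + v 3\<^sup>k = 1\<close> the element \<open>n\<close> is a \<open>2\<^sup>k\<close>-th multiple plus a \<open>3\<^sup>k\<close>-th multiple. By
  compactness the first summand can be chosen independently of \<open>k\<close>, and then both summands are
  killed by every homomorphism to the integers.\<close>

lemma compact_group_hom_trivial:
  fixes n :: "'g::{topological_group_add, t2_space}" and f :: "'g \<Rightarrow> int"
  assumes comp: "compact (UNIV :: 'g set)"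
    and hom: "\<And>g h. g + n = n + g \<Longrightarrow> h + n = n + h \<Longrightarrow> f (g + h) = f g + f h"
  shows "f n = 0"
proof -
  define Z where "Z = {h. h + n = n + h}"
  have "closed Z" unfolding Z_def by (intro closed_Collect_eq continuous_intros)
  then have Z: "compact Z" using comp closed_Int_compact[of Z UNIV] by simp
  define P where "P q k = nmul (q ^ k) ` Z" for q k :: nat
  have cP: "closed (P q k)" for q k
    unfolding P_def by (intro compact_imp_closed compact_continuous_image continuous_on_nmul Z)
  have PZ: "P q k \<subseteq> Z" for q k using nmul_centralizer by (auto simp: P_def Z_def)
  have P_mono: "P q l \<subseteq> P q k" if "k \<le> l" for q k l
  proof
    fix x assume "x \<in> P q l"
    then obtain h where h: "h \<in> Z" "x = nmul (q ^ l) h" by (auto simp: P_def)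
    have "q ^ l = q ^ k * q ^ (l - k)" using that by (simp flip: power_add)
    then have "x = nmul (q ^ k) (nmul (q ^ (l - k)) h)" using h by (simp add: nmul_mult)
    moreover have "nmul (q ^ (l - k)) h \<in> Z" using h nmul_centralizer by (simp add: Z_def)
    ultimately show "x \<in> P q k" by (auto simp: P_def)
  qed
  \<comment> \<open>The possible first summands at stage \<open>k\<close>. These closed sets
    decrease with \<open>k\<close>, so compactness provides one summand for all stages.\<close>
  define R where "R k = P 2 k \<inter> (\<lambda>a. - a + n) -` P 3 k" for k
  have cR: "closed (R k)" for k
    unfolding R_def by (intro closed_Int closed_vimage cP continuous_intros)
  have R_mono: "R l \<subseteq> R k" if "k \<le> l" for k l
    using P_mono[OF that] by (auto simp: R_def)
  have R_ne: "R k \<noteq> {}" for k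
  proof -
    have "coprime ((2::int) ^ k) (3 ^ k)" by (simp add: coprime_power_left_iff coprime_power_right_iff)
    then obtain u v :: int where uv: "u * 2 ^ k + v * 3 ^ k = 1"
      using bezout_int[of "2 ^ k" "3 ^ k"] by (metis coprime_iff_gcd_eq_1)
    have zZ: "zmul j n \<in> Z" for j
      using zmul_add[of j 1 n] zmul_add[of 1 j n] zmul_of_nat[of 1 n] by (simp add: Z_def add.commute)
    define a where "a = nmul (2 ^ k) (zmul u n)"
    define b where "b = nmul (3 ^ k) (zmul v n)"
    have "a + b = zmul (2 ^ k * u + 3 ^ k * v) n" by (simp add: a_def b_def nmul_zmul zmul_add)
    also have "2 ^ k * u + 3 ^ k * v = 1" using uv by (simp add: mult.commute)
    finally have "a + b = n" using zmul_of_nat[of 1 n] by simp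
    then have "- a + n = b" by (metis minus_add_cancel)
    then have "a \<in> R k" using zZ by (auto simp: R_def P_def a_def b_def)
    then show ?thesis by blast
  qed
  have "UNIV \<inter> \<Inter>(range R) \<noteq> {}"
  proof (rule compact_imp_fip[OF comp])
    fix \<F> assume F: "finite \<F>" "\<F> \<subseteq> range R"
    obtain K where K: "finite K" "\<F> = R ` K" using finite_subset_image[OF F] by blast
    obtain m where "\<forall>k\<in>K. k \<le> m" using K(1) finite_nat_set_iff_bounded_le by blast
    then have "R m \<subseteq> \<Inter>\<F>" using K R_mono by blast
    then show "UNIV \<inter> \<Inter>\<F> \<noteq> {}" using R_ne[of m] by blast
  qed (use cR in auto)
  then obtain a where a: "\<And>k. a \<in> R k" by auto
  have f0: "f 0 = 0" using hom[of 0 0] by simp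
  have f_nmul: "f (nmul j h) = int j * f h" if "h \<in> Z" for j h
  proof (induction j)
    case (Suc j)
    have "f (h + nmul j h) = f h + f (nmul j h)"
      using that nmul_centralizer[of h n j] by (intro hom) (auto simp: Z_def)
    then show ?case using Suc by (simp add: algebra_simps)
  qed (simp add: f0)
  have zero: "f x = 0" if q: "q \<ge> 2" and x: "\<And>k. x \<in> P q k" for q x
  proof (rule ccontr)
    assume "f x \<noteq> 0"
    \<comment> \<open>q^k exceeds k, the absolute value of the nonzero integer f x that it would
      have to divide.\<close>
    define k where "k = nat \<bar>f x\<bar>"
    obtain h where "h \<in> Z" "x = nmul (q ^ k) h" using x[of k] by (auto simp: P_def)
    then have "int (q ^ k) dvd f x" using f_nmul by simp
    then have "\<bar>int (q ^ k)\<bar> \<le> \<bar>f x\<bar>" by (rule dvd_imp_le_int[OF \<open>f x \<noteq> 0\<close>])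
    then have "int (q ^ k) \<le> \<bar>f x\<bar>" by (simp only: abs_of_nat)
    moreover have "k < q ^ k" using q by (meson less_exp less_le_trans power_mono zero_le)
    then have "int k < int (q ^ k)" by (simp only: of_nat_less_iff)
    moreover have "int k = \<bar>f x\<bar>" by (simp add: k_def)
    ultimately show False by linarith
  qed
  have "f a = 0" by (rule zero[of 2]) (use a in \<open>auto simp: R_def\<close>)
  moreover have "f (- a + n) = 0" by (rule zero[of 3]) (use a in \<open>auto simp: R_def\<close>)
  moreover have "f (a + (- a + n)) = f a + f (- a + n)"
    using a[of 0] PZ[of 2 0] PZ[of 3 0] by (intro hom) (auto simp: R_def Z_def)
  ultimately show ?thesis by simp
qed

section \<open>Representing the Weyl group by permutations\<close>

typedef 'a bijection = "{f :: 'a \<Rightarrow> 'a. bij f}"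
  by (rule exI[of _ id]) simp

setup_lifting type_definition_bijection

instantiation bijection :: (type) group_add
begin

lift_definition zero_bijection :: "'a bijection" is id by simp
lift_definition plus_bijection :: "'a bijection \<Rightarrow> 'a bijection \<Rightarrow> 'a bijection" is "(\<circ>)" by (rule bij_comp)
lift_definition uminus_bijection :: "'a bijection \<Rightarrow> 'a bijection" is inv by (rule bij_imp_bij_inv)
definition minus_bijection :: "'a bijection \<Rightarrow> 'a bijection \<Rightarrow> 'a bijection" where
  "minus_bijection f g = f + - g"

instance
proof
  fix a b c :: "'a bijection"
  show "a + b + c = a + (b + c)" by transfer (simp add: o_assoc)
  show "0 + a = a" "a + 0 = a" by (transfer, simp)+
  show "- a + a = 0" by transfer (simp add: bij_is_inj)
  show "a + - b = a - b" by (simp add: minus_bijection_def)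
qed

end

text \<open>The cosets of \<open>T\<close> are mere sets, whereas \<open>bn_system\<close> wants the
  Weyl group inside a group type. The regular representation provides this: \<open>n\<close> becomes
  left translation on the cosets.\<close>

lemma BN_pair_bn_system:
  fixes B N :: "'g::group_add set" and S :: "'g set set"
  assumes BN: "BN_pair B N S"
  shows "\<exists>(p :: 'g \<Rightarrow> 'g set bijection) S'. bn_system B N p S' \<and> (finite (p ` N) \<longrightarrow> finite (weyl B N))"
proof -
  define T where "T = B \<inter> N"
  define coset where "coset n = (+) n ` T" for n
  have cplx_coset: "cplx {n} T = coset n" for n by (auto simp: cplx_def coset_def)
  have subB: "subgrp B" and subN: "subgrp N" and gen: "gen_subgrp (B \<union> N) = UNIV"
    and norm: "normal_in T N" and finS: "finite S" and SW: "S \<subseteq> weyl B N"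
    and S_inv: "\<And>s. s \<in> S \<Longrightarrow> s \<noteq> T \<and> cplx s s = T"
    and wgenW: "wgen T S = weyl B N"
    and bn1: "\<And>s w. s \<in> S \<Longrightarrow> w \<in> weyl B N \<Longrightarrow>
        cplx (cplx s B) w \<subseteq> cplx (cplx B w) B \<union> cplx (cplx B (cplx s w)) B"
    and bn2: "\<And>s. s \<in> S \<Longrightarrow> cplx (cplx s B) s \<noteq> B"
    using BN unfolding BN_pair_def T_def by blast+
  have weyl_eq: "weyl B N = coset ` N" unfolding weyl_def using cplx_coset by (auto simp: T_def)
  have Bc: "0 \<in> B" "\<And>x y. x \<in> B \<Longrightarrow> y \<in> B \<Longrightarrow> x + y \<in> B" "\<And>x. x \<in> B \<Longrightarrow> - x \<in> B"
    using subB by (auto simp: subgrp_def)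
  have Nc: "0 \<in> N" "\<And>x y. x \<in> N \<Longrightarrow> y \<in> N \<Longrightarrow> x + y \<in> N" "\<And>x. x \<in> N \<Longrightarrow> - x \<in> N"
    using subN by (auto simp: subgrp_def)
  have Tc: "0 \<in> T" "\<And>x y. x \<in> T \<Longrightarrow> y \<in> T \<Longrightarrow> x + y \<in> T" "\<And>x. x \<in> T \<Longrightarrow> - x \<in> T"
    using Bc Nc by (auto simp: T_def)
  have TN: "t \<in> T \<Longrightarrow> t \<in> N" and TB: "t \<in> T \<Longrightarrow> t \<in> B" for t by (auto simp: T_def)
  have conj: "n + t - n \<in> T" if "n \<in> N" "t \<in> T" for n t
    using norm that by (simp add: normal_in_def)
  have coset_iff: "x \<in> coset n \<longleftrightarrow> - n + x \<in> T" for n x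
    by (auto simp: coset_def image_iff intro!: bexI[of _ "- n + x"] simp flip: add.assoc)
  have coset_self: "n \<in> coset n" for n using Tc(1) by (simp add: coset_iff)
  have coset_eq: "coset m = coset n \<longleftrightarrow> - m + n \<in> T" for m n
  proof
    assume "coset m = coset n"
    then show "- m + n \<in> T" using coset_self[of n] coset_iff by blast
  next
    assume mn: "- m + n \<in> T"
    have "- m + x \<in> T \<longleftrightarrow> - n + x \<in> T" for x
    proof
      assume "- m + x \<in> T"
      then have "- (- m + n) + (- m + x) \<in> T" using Tc(2,3) mn by blast
      moreover have "- (- m + n) + (- m + x) = - n + x"
        by (simp only: minus_add minus_minus add.assoc add_minus_cancel)
      ultimately show "- n + x \<in> T" by simp
    next
      assume "- n + x \<in> T"
      then have "(- m + n) + (- n + x) \<in> T" using Tc(2) mn by blast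
      moreover have "(- m + n) + (- n + x) = - m + x" by (simp only: add.assoc add_minus_cancel)
      ultimately show "- m + x \<in> T" by simp
    qed
    then show "coset m = coset n" using coset_iff by blast
  qed
  have shift_coset: "(+) n ` coset m = coset (n + m)" for n m
    by (auto simp: coset_def image_image add.assoc)
  \<comment> \<open>Acting as the identity off the Weyl group makes this a bijection of the whole
    type of subsets.\<close>
  define L where "L n X = (if X \<in> weyl B N then (+) n ` X else X)" for n X
  have L_coset: "L n (coset m) = coset (n + m)" if "m \<in> N" for n m
    using that shift_coset by (simp add: L_def weyl_eq)
  have L_add: "L (m + n) = L m \<circ> L n" if "m \<in> N" "n \<in> N" for m n
  proof
    fix X show "L (m + n) X = (L m \<circ> L n) X"
    proof (cases "X \<in> weyl B N")
      case True
      then obtain k where "k \<in> N" "X = coset k" by (auto simp: weyl_eq)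
      then show ?thesis using L_coset that Nc(2) by (simp add: add.assoc)
    qed (simp add: L_def)
  qed
  have L_0: "L 0 = id" by (auto simp: L_def fun_eq_iff)
  have L_bij: "bij (L n)" if "n \<in> N" for n
  proof (rule o_bij)
    show "L (- n) \<circ> L n = id" using L_add[of "- n" n] that Nc(3) L_0 by simp
    show "L n \<circ> L (- n) = id" using L_add[of n "- n"] that Nc(3) L_0 by simp
  qed
  define p where "p n = Abs_bijection (L n)" for n
  have p_rep: "Rep_bijection (p n) = L n" if "n \<in> N" for n
    unfolding p_def using L_bij[OF that] by (simp add: Abs_bijection_inverse)
  have p_eq: "p m = p n \<longleftrightarrow> coset m = coset n" if "m \<in> N" "n \<in> N" for m n
  proof
    assume "p m = p n"
    then have "L m (coset 0) = L n (coset 0)" using p_rep that by metis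
    then show "coset m = coset n" using L_coset[OF Nc(1)] by simp
  next
    assume c: "coset m = coset n"
    have "L m = L n"
    proof
      fix X show "L m X = L n X"
      proof (cases "X \<in> weyl B N")
        case True
        then obtain k where k: "k \<in> N" "X = coset k" by (auto simp: weyl_eq)
        \<comment> \<open>Normality of \<open>T\<close> makes the translation depend only on the
          coset of the translating element.\<close>
        have "- k + (- m + n) - - k \<in> T" using conj[of "- k" "- m + n"] c coset_eq k Nc(3) by blast
        then have "- (m + k) + (n + k) \<in> T" by (simp add: minus_add add.assoc diff_conv_add_uminus del: add_uminus_conv_diff)
        then have "coset (m + k) = coset (n + k)" using coset_eq by blast
        then show ?thesis using L_coset k by simp
      qed (simp add: L_def)
    qed
    then show "p m = p n" by (simp add: p_def)
  qed
  have p_add: "p (m + n) = p m + p n" if "m \<in> N" "n \<in> N" for m n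
  proof -
    have "Rep_bijection (p (m + n)) = Rep_bijection (p m + p n)"
      using that Nc(2) by (simp add: p_rep L_add plus_bijection.rep_eq)
    then show ?thesis by (simp add: Rep_bijection_inject)
  qed
  have p_0: "p 0 = 0"
  proof -
    have "p 0 + p 0 = p 0 + 0" using p_add[OF Nc(1,1)] by simp
    then show ?thesis by (simp only: add_left_cancel)
  qed
  have p_ker: "p n = 0 \<longleftrightarrow> n \<in> T" if "n \<in> N" for n
    using p_eq[OF Nc(1) that] coset_eq[of 0 n] p_0 by auto
  have p_T: "p t = 0" if "t \<in> T" for t using p_ker that TN by blast
  define S' where "S' = {p m | m. m \<in> N \<and> coset m \<in> S}"
  have S'_lift: "coset m \<in> S" if "m \<in> N" "p m \<in> S'" for m
    using that p_eq by (auto simp: S'_def)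
  have S_T: "m \<notin> T" "m + m \<in> T" if "m \<in> N" "coset m \<in> S" for m
  proof -
    have "coset 0 = T" by (auto simp: coset_iff)
    then have "coset 0 \<noteq> coset m" using S_inv[OF that(2)] by auto
    then show "m \<notin> T" using coset_eq[of 0 m] by auto
    have "m + m \<in> cplx (coset m) (coset m)" using coset_self by (auto simp: cplx_def)
    then show "m + m \<in> T" using S_inv[OF that(2)] by simp
  qed
  have "bn_system B N p S'"
  proof
    show "finite S'"
    proof -
      \<comment> \<open>One representative per coset in \<open>S\<close> suffices, as
        \<open>p\<close> is constant on cosets.\<close>
      have "S' \<subseteq> (\<lambda>X. p (SOME m. m \<in> N \<and> coset m = X)) ` S"
      proof
        fix s assume "s \<in> S'"
        then obtain m where m: "m \<in> N" "coset m \<in> S" "s = p m" by (auto simp: S'_def)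
        have "(SOME k. k \<in> N \<and> coset k = coset m) \<in> N \<and> coset (SOME k. k \<in> N \<and> coset k = coset m) = coset m"
          by (rule someI[of _ m]) (use m in simp)
        then have "p m = p (SOME k. k \<in> N \<and> coset k = coset m)" using p_eq m(1) by metis
        then show "s \<in> (\<lambda>X. p (SOME m. m \<in> N \<and> coset m = X)) ` S" using m by blast
      qed
      then show ?thesis using finS finite_surj by blast
    qed
    show "0 \<notin> S'" using S_T p_ker by (force simp: S'_def)
    show "s + s = 0" if s: "s \<in> S'" for s
    proof -
      obtain m where "m \<in> N" "coset m \<in> S" "s = p m" using s by (auto simp: S'_def)
      then show ?thesis using S_T(2) p_T p_add by metis
    qed
    show "p ` N = word_group S'"
    proof
      have wg: "\<forall>n\<in>N. w = coset n \<longrightarrow> p n \<in> word_group S'" if "w \<in> wgen T S" for w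
        using that
      proof induction
        case one
        have "T = coset 0" by (auto simp: coset_iff)
        then show ?case using p_eq[OF _ Nc(1)] p_0 word_group_zero by metis
      next
        case (step w s)
        obtain k where k: "k \<in> N" "w = coset k" using step.hyps(1) wgenW weyl_eq by auto
        obtain m where m: "m \<in> N" "s = coset m" using step.hyps(2) SW weyl_eq by auto
        have "p n \<in> word_group S'" if n: "n \<in> N" "cplx s w = coset n" for n
        proof -
          have "m + k \<in> coset n" using m k coset_self n(2) unfolding cplx_def by blast
          then have "p n = p (m + k)" using p_eq[OF n(1) Nc(2)] m k coset_iff coset_eq by blast
          moreover have "p m \<in> S'" using m step.hyps(2) by (auto simp: S'_def)
          moreover have "p k \<in> word_group S'" using step.IH k by blast
          ultimately show ?thesis using p_add m k word_group_add word_group_gen by metis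
        qed
        then show ?case by blast
      qed
      show "p ` N \<subseteq> word_group S'" using wg wgenW weyl_eq by blast
      show "word_group S' \<subseteq> p ` N"
      proof
        fix w assume "w \<in> word_group S'"
        then show "w \<in> p ` N"
        proof (induction rule: word_group_mem_induct)
          case zero
          show ?case using p_0 Nc(1) by (metis imageI)
        next
          case (step s w)
          then obtain m n where "m \<in> N" "s = p m" "n \<in> N" "w = p n" by (auto simp: S'_def)
          then show ?case using p_add Nc(2) by (metis imageI)
        qed
      qed
    qed
    show "\<exists>b1\<in>B. \<exists>b2\<in>B. \<exists>k\<in>N. (p k = p n \<or> p k = p m + p n) \<and> m + b + n = b1 + k + b2"
      if m: "m \<in> N" "p m \<in> S'" and n: "n \<in> N" and b: "b \<in> B" for m n b
    proof -
      have cN: "x \<in> N \<and> p x = p k" if "x \<in> coset k" "k \<in> N" for x k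
      proof -
        have "- k + x \<in> T" using that coset_iff by blast
        then have "x = k + (- k + x)" "- k + x \<in> N" using TN by (simp_all flip: add.assoc)
        then have "x \<in> N" using Nc(2) that(2) by metis
        moreover have "coset k = coset x" using \<open>- k + x \<in> T\<close> coset_eq by blast
        ultimately show ?thesis using p_eq that(2) by blast
      qed
      have "m + b + n \<in> cplx (cplx (coset m) B) (coset n)"
        using coset_self b unfolding cplx_def by blast
      then consider "m + b + n \<in> cplx (cplx B (coset n)) B" | "m + b + n \<in> cplx (cplx B (cplx (coset m) (coset n))) B"
        using bn1[OF S'_lift[OF m], of "coset n"] n weyl_eq by blast
      then show ?thesis
      proof cases
        case 1
        then obtain b1 k b2 where "b1 \<in> B" "k \<in> coset n" "b2 \<in> B" "m + b + n = b1 + k + b2"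
          unfolding cplx_def by blast
        then show ?thesis using cN n by blast
      next
        case 2
        then obtain b1 k k' b2 where k: "b1 \<in> B" "k \<in> coset m" "k' \<in> coset n" "b2 \<in> B" "m + b + n = b1 + (k + k') + b2"
          unfolding cplx_def by blast
        have "k + k' \<in> N" "p (k + k') = p m + p n"
          using cN[OF k(2) m(1)] cN[OF k(3) n] p_add Nc(2) by auto
        then show ?thesis using k by blast
      qed
    qed
    show "\<exists>b\<in>B. m + b + m \<notin> B" if m: "m \<in> N" "p m \<in> S'" for m
    proof (rule ccontr)
      assume "\<not> ?thesis"
      then have mBm: "m + b + m \<in> B" if "b \<in> B" for b using that by blast
      have s: "coset m \<in> S" using S'_lift m by blast
      have "cplx (cplx (coset m) B) (coset m) = B"
      proof
        show "cplx (cplx (coset m) B) (coset m) \<subseteq> B"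
        proof
          fix x assume "x \<in> cplx (cplx (coset m) B) (coset m)"
          then obtain t b t' where x: "t \<in> T" "b \<in> B" "t' \<in> T" "x = m + t + b + (m + t')"
            unfolding cplx_def coset_def by blast
          have "m + (t + b) + m \<in> B" using mBm x TB Bc(2) by blast
          then have "m + (t + b) + m + t' \<in> B" using x TB Bc(2) by blast
          then show "x \<in> B" using x by (simp add: add.assoc)
        qed
        show "B \<subseteq> cplx (cplx (coset m) B) (coset m)"
        proof
          fix b assume b: "b \<in> B"
          \<comment> \<open>m + m lies in \<open>T\<close>, hence in \<open>B\<close>; so mBm inside
            \<open>B\<close> already gives the reverse inclusion.\<close>
          define t where "t = - (m + m)"
          have t: "t \<in> B" using S_T(2)[OF m(1) s] TB Bc(3) by (simp add: t_def)
          have "- m + b + - m = t + (m + b + m) + t"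
            unfolding t_def by (simp add: minus_add add.assoc diff_conv_add_uminus del: add_uminus_conv_diff)
          then have "- m + b + - m \<in> B" using mBm[OF b] t Bc(2) by metis
          moreover have "b = m + (- m + b + - m) + m"
            by (simp add: add.assoc diff_conv_add_uminus del: add_uminus_conv_diff)
          ultimately show "b \<in> cplx (cplx (coset m) B) (coset m)"
            unfolding cplx_def using coset_self[of m] by blast
        qed
      qed
      then show False using bn2[OF s] by blast
    qed
  qed (use subB subN gen p_add p_ker in \<open>auto simp: T_def\<close>)
  moreover have "finite (weyl B N)" if "finite (p ` N)"
  proof -
    \<comment> \<open>A coset is recovered from its permutation as the image of the trivial
      coset.\<close>
    have "weyl B N = (\<lambda>q. Rep_bijection q (coset 0)) ` (p ` N)"
      unfolding weyl_eq image_image using p_rep L_coset[OF Nc(1)] by (intro image_cong) auto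
    then show ?thesis using that by simp
  qed
  ultimately show ?thesis by blast
qed

theorem theorem1:
  fixes B N :: "'g::{topological_group_add, t2_space} set"
    and S :: "'g set set"
  assumes "compact (UNIV :: 'g set)"
    and "BN_pair B N S"
  shows "finite (weyl B N)"
proof -
  obtain p :: "'g \<Rightarrow> 'g set bijection" and S' where
    bn: "bn_system B N p S'" and fin: "finite (p ` N) \<longrightarrow> finite (weyl B N)"
    using BN_pair_bn_system[OF assms(2)] by blast
  interpret bn_system B N p S' by (rule bn)
  have "finite (word_group S')"
  proof (rule ccontr)
    assume "infinite (word_group S')"
    then obtain n and f :: "'g \<Rightarrow> int" where "f n \<noteq> 0"
      "\<And>g h. g + n = n + g \<Longrightarrow> h + n = n + h \<Longrightarrow> f (g + h) = f g + f h"
      using centralizer_hom_exists by blast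
    then show False using compact_group_hom_trivial[OF assms(1), of n f] by blast
  qed
  then show ?thesis using fin p_image by simp
qed

end
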